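(* For every $n\ge 2$ the operator $d$ acts on the family $\mathcal P_{Mas}=\{P^n_{Mas}\mid n\ge 0\}$ by the formula $$dP^n_{Mas}=2St^{n-1}+(n-2)P^{n-1}_{Mas}+\sum_{s=0}^{n-2}\binom{n-2}{s}St^{s}\times P^{n-s-1}_{\Gamma}+\sum_{s=0}^{n-2}\binom{n-2}{s}St^{s+1}\times Pe^{n-s-2}+\sum_{s=0}^{n-3}\binom{n-2}{s}P^{s+2}_{Mas}\times Pe^{n-s-3}.$$ In particular, the family $\mathcal P_{Mas}$ has complexity $4$.
   Context: Polytopes are considered up to combinatorial equivalence (isomorphism of face posets). The ring $\mathcal P$ is the free abelian group generated by all simple convex polytopes, with addition corresponding to disjoint union, product given by Cartesian product, zero the empty set, unit the point $P^0$, graded by dimension. The operator $d:\mathcal P_n\to\mathcal P_{n-1}$ sends a polytope to the sum (disjoint union) of its facets; it is a derivation. A building set on $[n+1]=\{1,\dots,n+1\}$ is a set $B\subseteq 2^{[n+1]}$ of nonempty subsets containing all singletons and such that $S_1,S_2\in B$, $S_1\cap S_2\ne\varnothing$ imply $S_1\cup S_2\in B$; it is connected if $[n+1]\in B$. For connected $B$ the nestohedron $P_B$ is the simple $n$-polytope $\sum_{S\in B}\operatorname{conv}(e_i\mid i\in S)\subset\mathbb R^{n+1}$ (Minkowski sum). For a connected graph $\Gamma$ on $[n+1]$, the graphical building set consists of the nonempty $S\subseteq[n+1]$ such that the induced subgraph on $S$ is connected. $Pe^n$ (permutohedron) and $St^n$ (stellahedron) are the nestohedra of the graphical building sets of the complete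 graph and of the star graph on $[n+1]$, respectively. $P^0_{Mas}$ is a point, $P^1_{Mas}$ is a segment, and for $n\ge2$, $P^n_{Mas}=P_{B(P,n)}$, where $B(P,n)$ is the building set on $[n+1]$ consisting of: all singletons $\{i\}$; all sets $\{1,2\}\cup I$ with $I\subseteq\{3,\dots,n+1\}$ (including $I=\varnothing$); all sets $\{1\}\cup J$ with $\varnothing\ne J\subseteq\{3,\dots,n\}$. $P_\Gamma^0$ is a point, $P_\Gamma^1$ is a segment, and for $n\ge2$, $P^n_\Gamma=P_{B(\Gamma,n)}$, where $B(\Gamma,n)$ is the building set on $[n+1]$ consisting of: all singletons; all subsets of $\{1,\dots,n\}$ with at least two elements; all sets $\{1,n+1\}\cup J$ with $J\subseteq\{2,\dots,n\}$. A family of polytopes is a set $\mathcal F$ of combinatorial polytopes such that for each $n\ge0$ the subset $\mathcal F_n$ of $n$-dimensional elements is nonempty and finite; it is linear if each $\mathcal F_n$ has exactly one element. A family $\mathcal F$ is a $d$-family if the subring of $\mathcal P$ generated over $\mathbb Z$ by all elements of $\mathcal F$ is closed under $d$. The $d$-closure of $\mathcal F$ is a minimal (with respect to inclusion) extension of $\mathcal F$ to a $d$-family, if it exists. $\mathcal F$ has complexity $k\ge1$ if its $d$-closure exists and can be represented as a union of $k$ linear families. *)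

theory Defs
  imports "HOL-Analysis.Analysis" "HOL-Library.Poly_Mapping"
begin

section \<open>Combinatorial polytopes in real vector spaces\<close>

text \<open>
  Polytopes of all dimensions have to live in one type, so the ambient space used below is the
  infinite-dimensional real vector space of finitely supported sequences, which contains a copy of
  every \<open>\<real>\<^sup>N\<close>. The notions \<^const>\<open>aff_dim\<close> and \<^const>\<open>facet_of\<close> are confined to Euclidean
  spaces and are therefore restated for arbitrary real vector spaces. The empty set is a
  \<^const>\<open>face_of\<close> every polytope, but never a facet, so a point has no facets.
\<close>

definition pdim :: "'a::real_vector set \<Rightarrow> nat"
  where "pdim P = dim {x - y |x y. x \<in> P \<and> y \<in> P}"

definition facets :: "'a::real_vector set \<Rightarrow> 'a set set"
  where "facets P = {F. F face_of P \<and> F \<noteq> {} \<and> Suc (pdim F) = pdim P}"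

definition simple_polytope :: "'a::real_vector set \<Rightarrow> bool"
  where "simple_polytope P \<longleftrightarrow> polytope P \<and> P \<noteq> {} \<and>
    (\<forall>v. v extreme_point_of P \<longrightarrow> card {F \<in> facets P. v \<in> F} = pdim P)"

definition comb_equiv :: "'a::real_vector set \<Rightarrow> 'b::real_vector set \<Rightarrow> bool"
  where "comb_equiv P Q \<longleftrightarrow> (\<exists>f. bij_betw f {F. F face_of P} {G. G face_of Q} \<and>
    (\<forall>F F'. F face_of P \<longrightarrow> F' face_of P \<longrightarrow> (f F \<subseteq> f F' \<longleftrightarrow> F \<subseteq> F')))"

lemma span_differences:
  assumes "a \<in> P"
  shows "span {x - y |x y. x \<in> P \<and> y \<in> P} = span ((\<lambda>x. x - a) ` P)"
proof (rule span_eq[THEN iffD2], intro conjI subsetI)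
  fix v assume "v \<in> {x - y |x y. x \<in> P \<and> y \<in> P}"
  then obtain x y where *: "v = (x - a) - (y - a)" "x \<in> P" "y \<in> P" by auto
  show "v \<in> span ((\<lambda>x. x - a) ` P)"
    unfolding *(1) by (intro span_diff span_base imageI *)
next
  fix v assume "v \<in> (\<lambda>x. x - a) ` P"
  then show "v \<in> span {x - y |x y. x \<in> P \<and> y \<in> P}"
    using assms by (intro span_base) auto
qed

lemma pdim_eq_aff_dim:
  fixes P :: "'a::euclidean_space set"
  assumes "P \<noteq> {}"
  shows "int (pdim P) = aff_dim P"
proof -
  obtain a where a: "a \<in> P" using assms by auto
  have "aff_dim P = int (dim ((\<lambda>x. - a + x) ` P))"
    by (rule aff_dim_eq_dim) (simp add: a hull_inc)
  also have "(\<lambda>x. - a + x) ` P = (\<lambda>x. x - a) ` P" by (auto simp: algebra_simps)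
  also have "dim ((\<lambda>x. x - a) ` P) = dim (span ((\<lambda>x. x - a) ` P))"
    by (rule real_vector.dim_span[symmetric])
  also have "\<dots> = pdim P"
    unfolding pdim_def span_differences[OF a, symmetric] by (rule real_vector.dim_span)
  finally show ?thesis ..
qed

lemma facets_eq_facet_of:
  fixes P :: "'a::euclidean_space set"
  shows "facets P = {F. F facet_of P}"
proof (cases "P = {}")
  case True
  then show ?thesis by (auto simp: facets_def facet_of_def)
next
  case False
  then have P: "aff_dim P = int (pdim P)" by (simp add: pdim_eq_aff_dim)
  have "Suc (pdim F) = pdim P \<longleftrightarrow> aff_dim F = aff_dim P - 1" if "F \<noteq> {}" for F
    unfolding P using pdim_eq_aff_dim[OF that] by auto
  then show ?thesis by (auto simp: facets_def facet_of_def)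
qed


subsection \<open>Invariance under injective linear maps\<close>

lemma comb_equiv_refl: "comb_equiv P P"
  unfolding comb_equiv_def by (rule exI[of _ id]) auto

lemma comb_equiv_sym:
  assumes "comb_equiv P Q" shows "comb_equiv Q P"
proof -
  obtain f where f: "bij_betw f {F. F face_of P} {G. G face_of Q}"
    "\<And>F F'. F face_of P \<Longrightarrow> F' face_of P \<Longrightarrow> f F \<subseteq> f F' \<longleftrightarrow> F \<subseteq> F'"
    using assms unfolding comb_equiv_def by auto
  define g where "g = the_inv_into {F. F face_of P} f"
  have g: "bij_betw g {G. G face_of Q} {F. F face_of P}"
    unfolding g_def by (rule bij_betw_the_inv_into[OF f(1)])
  have fg: "f (g G) = G" "g G face_of P" if "G face_of Q" for G
    using that f_the_inv_into_f_bij_betw[OF f(1)] g unfolding g_def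
    by (auto dest: bij_betwE)
  show ?thesis
    unfolding comb_equiv_def using g f(2) fg by metis
qed

lemma comb_equiv_trans [trans]:
  assumes "comb_equiv P Q" "comb_equiv Q R" shows "comb_equiv P R"
proof -
  obtain f where f: "bij_betw f {F. F face_of P} {G. G face_of Q}"
    "\<And>F F'. F face_of P \<Longrightarrow> F' face_of P \<Longrightarrow> f F \<subseteq> f F' \<longleftrightarrow> F \<subseteq> F'"
    using assms(1) unfolding comb_equiv_def by auto
  obtain g where g: "bij_betw g {F. F face_of Q} {G. G face_of R}"
    "\<And>F F'. F face_of Q \<Longrightarrow> F' face_of Q \<Longrightarrow> g F \<subseteq> g F' \<longleftrightarrow> F \<subseteq> F'"
    using assms(2) unfolding comb_equiv_def by auto
  have "bij_betw (g \<circ> f) {F. F face_of P} {G. G face_of R}"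
    by (rule bij_betw_trans[OF f(1) g(1)])
  moreover have "f F face_of Q" if "F face_of P" for F
    using f(1) that by (auto dest: bij_betwE)
  ultimately show ?thesis
    unfolding comb_equiv_def using f(2) g(2) by (intro exI[of _ "g \<circ> f"]) auto
qed

lemma face_of_linear_image_iff:
  assumes "linear f" "inj f"
  shows "G face_of f ` P \<longleftrightarrow> (\<exists>F. F face_of P \<and> G = f ` F)"
  by (metis assms face_of_imp_subset face_of_linear_image subset_image_iff)

lemma comb_equiv_linear_image:
  assumes "linear f" "inj f"
  shows "comb_equiv P (f ` P)"
proof -
  have "bij_betw ((`) f) {F. F face_of P} {G. G face_of f ` P}"
    unfolding bij_betw_def inj_on_def
    using assms(2) face_of_linear_image_iff[OF assms] by (auto simp: inj_image_eq_iff)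
  then show ?thesis
    unfolding comb_equiv_def using assms(2)
    by (intro exI[of _ "(`) f"]) (simp add: inj_image_subset_iff)
qed

lemma dim_linear_image:
  assumes f: "linear f" "inj f"
  shows "dim (f ` V) = dim V"
proof -
  obtain B where B: "B \<subseteq> V" "independent B" "V \<subseteq> span B" "card B = dim V"
    using real_vector.basis_exists by metis
  have "independent (f ` B)"
    using linear_independent_injective_image[OF f(1) B(2)] f(2) by (simp add: inj_on_subset)
  moreover have "span (f ` B) = span (f ` V)"
    using B(1,3) by (metis linear_span_image[OF f(1)] real_vector.span_eq span_superset subset_trans)
  ultimately have "dim (f ` V) = card (f ` B)"
    by (metis real_vector.dim_eq_card)
  then show ?thesis
    using B(4) f(2) by (simp add: card_image inj_on_subset)
qed

lemma pdim_linear_image: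
  assumes f: "linear f" "inj f"
  shows "pdim (f ` P) = pdim P"
proof -
  have "{x - y |x y. x \<in> f ` P \<and> y \<in> f ` P} = f ` {x - y |x y. x \<in> P \<and> y \<in> P}"
    by (auto simp: image_iff linear_diff[OF f(1), symmetric]) (metis linear_diff[OF f(1)])+
  then show ?thesis
    unfolding pdim_def by (simp add: dim_linear_image[OF f])
qed

lemma facets_linear_image:
  assumes f: "linear f" "inj f"
  shows "facets (f ` P) = (`) f ` facets P"
  unfolding facets_def
  by (auto simp: face_of_linear_image_iff[OF f] pdim_linear_image[OF f] image_iff)

lemma simple_polytope_linear_image:
  assumes f: "linear f" "inj f" and P: "simple_polytope P"
  shows "simple_polytope (f ` P)"
proof -
  have "card {F \<in> facets (f ` P). v \<in> F} = pdim (f ` P)" if v: "v extreme_point_of f ` P" for v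
  proof -
    have "{v} face_of f ` P" using v by (simp add: face_of_singleton)
    then obtain F where "F face_of P" "{v} = f ` F" by (auto simp: face_of_linear_image_iff[OF f])
    moreover from this obtain w where w: "f w = v" "w \<in> F" by (metis imageE insertI1)
    ultimately have "F = {w}" using f(2) by (auto simp: inj_def)
    then have "w extreme_point_of P" using \<open>F face_of P\<close> by (simp add: face_of_singleton)
    then have "card {F \<in> facets P. w \<in> F} = pdim P"
      using P by (simp add: simple_polytope_def)
    moreover have "{F \<in> facets (f ` P). v \<in> F} = (`) f ` {F \<in> facets P. w \<in> F}"
      unfolding facets_linear_image[OF f] w(1)[symmetric] 
      by (auto simp: inj_eq[OF f(2)])
    moreover have "inj_on ((`) f) {F \<in> facets P. w \<in> F}"
      using f(2) by (auto simp: inj_on_def inj_image_eq_iff)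
    ultimately show ?thesis by (simp add: card_image pdim_linear_image[OF f])
  qed
  then show ?thesis
    using P f unfolding simple_polytope_def by (auto simp: polytope_linear_image)
qed


subsection \<open>Cartesian products\<close>

lemma face_of_Times_cases:
  assumes C: "C face_of P \<times> Q" and cv: "convex P" "convex Q"
  shows "fst ` C face_of P" "snd ` C face_of Q" "C = fst ` C \<times> snd ` C"
proof -
  have sub: "C \<subseteq> P \<times> Q" and cC: "convex C"
    using C face_of_imp_subset face_of_imp_convex by blast+
  have mix: "(a, b') \<in> C" if "(a, b) \<in> C" "(a', b') \<in> C" for a b a' b'
  proof (cases "(a, b') = (a', b)")
    case True
    then show ?thesis using that(1) by simp
  next
    case False
    have "midpoint (a, b) (a', b') \<in> C"
      using convexD[OF cC that, of "1/2" "1/2"] by (simp add: midpoint_def scaleR_add_right)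
    moreover have "midpoint (a, b) (a', b') = midpoint (a, b') (a', b)"
      by (simp add: midpoint_def add_ac)
    moreover have "midpoint (a, b') (a', b) \<in> open_segment (a, b') (a', b)"
      using False by simp
    moreover have "(a, b') \<in> P \<times> Q" "(a', b) \<in> P \<times> Q" using that sub by auto
    ultimately show ?thesis using face_ofD[OF C] by metis
  qed
  show "C = fst ` C \<times> snd ` C"
  proof (rule equalityI)
    show "fst ` C \<times> snd ` C \<subseteq> C"
      by (clarsimp, rule mix)
  qed (rule subset_fst_snd)
  have "a \<in> fst ` C \<and> a' \<in> fst ` C"
    if "x \<in> open_segment a a'" "a \<in> P" "a' \<in> P" and x: "x \<in> fst ` C" for x a a'
  proof -
    obtain b where b: "(x, b) \<in> C" using x by auto
    have "(x, b) \<in> open_segment (a, b) (a', b)"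
      using that(1) by (auto simp: in_segment algebra_simps)
    then have "(a, b) \<in> C \<and> (a', b) \<in> C"
      using face_ofD[OF C] b sub that by (metis mem_Sigma_iff subsetD)
    then show ?thesis by force
  qed
  then show "fst ` C face_of P"
    using sub cC unfolding face_of_def by (auto intro!: convex_linear_image linear_fst)
  have "a \<in> snd ` C \<and> a' \<in> snd ` C"
    if "x \<in> open_segment a a'" "a \<in> Q" "a' \<in> Q" and x: "x \<in> snd ` C" for x a a'
  proof -
    obtain b where b: "(b, x) \<in> C" using x by auto
    have "(b, x) \<in> open_segment (b, a) (b, a')"
      using that(1) by (auto simp: in_segment algebra_simps)
    then have "(b, a) \<in> C \<and> (b, a') \<in> C"
      using face_ofD[OF C] b sub that by (metis mem_Sigma_iff subsetD)
    then show ?thesis by force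
  qed
  then show "snd ` C face_of Q"
    using sub cC unfolding face_of_def by (auto intro!: convex_linear_image linear_snd)
qed

lemma comb_equiv_Times:
  assumes "comb_equiv P P'" "comb_equiv Q Q'"
    and cv: "convex P" "convex Q" "convex P'" "convex Q'"
  shows "comb_equiv (P \<times> Q) (P' \<times> Q')"
proof -
  obtain f where f: "bij_betw f {F. F face_of P} {G. G face_of P'}"
    "\<And>F F'. F face_of P \<Longrightarrow> F' face_of P \<Longrightarrow> f F \<subseteq> f F' \<longleftrightarrow> F \<subseteq> F'"
    using assms(1) unfolding comb_equiv_def by auto
  obtain g where g: "bij_betw g {F. F face_of Q} {G. G face_of Q'}"
    "\<And>F F'. F face_of Q \<Longrightarrow> F' face_of Q \<Longrightarrow> g F \<subseteq> g F' \<longleftrightarrow> F \<subseteq> F'"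
    using assms(2) unfolding comb_equiv_def by auto
  have ff: "f F face_of P'" if "F face_of P" for F using f(1) that by (auto dest: bij_betwE)
  have gf: "g F face_of Q'" if "F face_of Q" for F using g(1) that by (auto dest: bij_betwE)
  have fs: "\<exists>F. F face_of P \<and> f F = G" if "G face_of P'" for G
  proof -
    have "G \<in> f ` {F. F face_of P}" using that by (simp add: bij_betw_imp_surj_on[OF f(1)])
    then show ?thesis by (rule imageE) auto
  qed
  have gs: "\<exists>F. F face_of Q \<and> g F = G" if "G face_of Q'" for G
  proof -
    have "G \<in> g ` {F. F face_of Q}" using that by (simp add: bij_betw_imp_surj_on[OF g(1)])
    then show ?thesis by (rule imageE) auto
  qed
  have fe: "f F = {} \<longleftrightarrow> F = {}" if "F face_of P" for F
    by (metis f(2) fs empty_face_of empty_subsetI subset_empty that)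
  have ge: "g F = {} \<longleftrightarrow> F = {}" if "F face_of Q" for F
    by (metis g(2) gs empty_face_of empty_subsetI subset_empty that)
  define h where "h C = f (fst ` C) \<times> g (snd ` C)" for C
  note dec = face_of_Times_cases[OF _ cv(1,2)]
  note dec' = face_of_Times_cases[OF _ cv(3,4)]
  have hf: "h C face_of P' \<times> Q'" if "C face_of P \<times> Q" for C
    unfolding h_def using dec(1,2)[OF that] by (simp add: face_of_Times ff gf)
  have mono: "h C \<subseteq> h C' \<longleftrightarrow> C \<subseteq> C'" if C: "C face_of P \<times> Q" "C' face_of P \<times> Q" for C C'
  proof -
    have "C \<subseteq> C' \<longleftrightarrow> C = {} \<or> fst ` C \<subseteq> fst ` C' \<and> snd ` C \<subseteq> snd ` C'"
      using dec(3)[OF C(1)] dec(3)[OF C(2)] by (metis Sigma_empty1 image_is_empty times_subset_iff)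
    moreover have "h C \<subseteq> h C' \<longleftrightarrow> C = {} \<or> f (fst ` C) \<subseteq> f (fst ` C') \<and> g (snd ` C) \<subseteq> g (snd ` C')"
      unfolding h_def times_subset_iff using fe[OF dec(1)[OF C(1)]] ge[OF dec(2)[OF C(1)]] by simp
    ultimately show ?thesis
      using f(2) g(2) dec(1,2)[OF C(1)] dec(1,2)[OF C(2)] by simp
  qed
  have "\<exists>C. C face_of P \<times> Q \<and> h C = D" if D: "D face_of P' \<times> Q'" for D
  proof (cases "D = {}")
    case True
    then show ?thesis by (intro exI[of _ "{}"]) (simp add: h_def fe)
  next
    case False
    obtain F G where FG: "F face_of P" "f F = fst ` D" "G face_of Q" "g G = snd ` D"
      using fs[OF dec'(1)[OF D]] gs[OF dec'(2)[OF D]] by auto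
    moreover have "fst ` D \<noteq> {}" "snd ` D \<noteq> {}" using False by auto
    ultimately have "F \<noteq> {}" "G \<noteq> {}" using fe ge by metis+
    then have "h (F \<times> G) = D" unfolding h_def using FG dec'(3)[OF D] by simp
    then show ?thesis using FG(1,3) face_of_Times[OF FG(1,3)] by (intro exI[of _ "F \<times> G"] conjI)
  qed
  then have "h ` {F. F face_of P \<times> Q} = {G. G face_of P' \<times> Q'}"
    using hf by auto
  moreover have "inj_on h {F. F face_of P \<times> Q}"
  proof (rule inj_onI)
    fix C C' assume "C \<in> {F. F face_of P \<times> Q}" "C' \<in> {F. F face_of P \<times> Q}" "h C = h C'"
    then show "C = C'" using mono[of C C'] mono[of C' C] by auto
  qed
  ultimately have "bij_betw h {F. F face_of P \<times> Q} {G. G face_of P' \<times> Q'}"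
    by (simp add: bij_betw_def)
  then show ?thesis unfolding comb_equiv_def using mono by (intro exI[of _ h] conjI) simp_all
qed

lemma independent_Times:
  assumes "independent A" "independent B" "finite B"
  shows "independent ((\<lambda>x. (x, 0)) ` A \<union> Pair 0 ` B)"
  using assms(3,2)
proof (induction B rule: finite_induct)
  case empty
  have "linear (\<lambda>x::'a. (x, 0::'b))" by (intro linearI) auto
  then have "independent ((\<lambda>x. (x, 0::'b)) ` A)"
    by (rule linear_independent_injective_image[OF _ assms(1)]) (auto simp: inj_on_def)
  then show ?case by simp
next
  case (insert b B)
  let ?S = "(\<lambda>x. (x, 0)) ` A \<union> Pair 0 ` B"
  have b: "b \<notin> span B" "independent B"
    using insert by (auto simp: independent_insert)
  have "span ?S \<subseteq> span A \<times> span B"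
    by (rule span_minimal) (auto intro: span_base span_zero subspace_Times)
  then have "(0, b) \<notin> span ?S" using b by auto
  then show ?case using insert.IH b by (simp add: independent_insertI)
qed

lemma polytope_finite_dim:
  assumes "polytope P" "F \<subseteq> P"
  obtains V where "finite V" "F \<subseteq> span V"
proof -
  obtain V where V: "finite V" "P = convex hull V" using assms by (auto simp: polytope_def)
  have "F \<subseteq> span V" using assms(2) convex_hull_subset_span[of V] unfolding V(2) by simp
  then show thesis using that V(1) by blast
qed

lemma pdim_basis:
  assumes V: "finite V" "P \<subseteq> span V"
  obtains B where "finite B" "B \<subseteq> {x - y |x y. x \<in> P \<and> y \<in> P}" "independent B"
    "span B = span {x - y |x y. x \<in> P \<and> y \<in> P}" "card B = pdim P"
proof -
  let ?D = "{x - y |x y. x \<in> P \<and> y \<in> P}"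
  obtain B where B: "B \<subseteq> ?D" "independent B" "?D \<subseteq> span B" "card B = dim ?D"
    by (rule real_vector.basis_exists[of ?D])
  have "B \<subseteq> span V" using B(1) V(2) by (auto intro: span_diff)
  then have "finite B" using independent_span_bound[OF V(1) B(2)] by simp
  moreover have "span B = span ?D"
    using B(1,3) by (auto simp: real_vector.span_eq intro: span_base)
  ultimately show thesis using that[of B] B unfolding pdim_def by simp
qed

lemma pdim_Times:
  assumes "finite V" "P \<subseteq> span V" "finite W" "Q \<subseteq> span W" "P \<noteq> {}" "Q \<noteq> {}"
  shows "pdim (P \<times> Q) = pdim P + pdim Q"
proof -
  let ?D = "\<lambda>P. {x - y |x y. x \<in> P \<and> y \<in> P}"
  obtain A where A: "finite A" "A \<subseteq> ?D P" "independent A" "span A = span (?D P)" "card A = pdim P"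
    by (rule pdim_basis[OF assms(1,2)])
  obtain B where B: "finite B" "B \<subseteq> ?D Q" "independent B" "span B = span (?D Q)" "card B = pdim Q"
    by (rule pdim_basis[OF assms(3,4)])
  let ?S = "(\<lambda>x. (x, 0)) ` A \<union> Pair 0 ` B"
  have S: "independent ?S" by (rule independent_Times[OF A(3) B(3,1)])
  obtain p q where pq: "p \<in> P" "q \<in> Q" using assms by auto
  have D: "?D (P \<times> Q) = ?D P \<times> ?D Q" by fastforce
  have l: "linear (\<lambda>x::'a. (x, 0::'b))" "linear (Pair (0::'a) :: 'b \<Rightarrow> _)"
    by (intro linearI; auto)+
  have "?D P \<times> ?D Q \<subseteq> span ?S"
  proof clarify
    fix x y x' y' assume *: "x \<in> P" "y \<in> P" "x' \<in> Q" "y' \<in> Q"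
    have "x - y \<in> span A" "x' - y' \<in> span B" unfolding A(4) B(4) using * by (auto intro: span_base)
    then have "(x - y, 0) \<in> span ((\<lambda>x. (x, 0::'b)) ` A)" "(0, x' - y') \<in> span (Pair (0::'a) ` B)"
      by (auto simp: linear_span_image[OF l(1)] linear_span_image[OF l(2)])
    then have "(x - y, 0) + (0, x' - y') \<in> span ?S"
      by (intro span_add) (auto intro: span_mono[THEN subsetD])
    then show "(x - y, x' - y') \<in> span ?S" by simp
  qed
  moreover have "?S \<subseteq> span (?D P \<times> ?D Q)"
  proof (rule order_trans[OF _ span_superset], intro Un_least image_subsetI)
    fix w assume "w \<in> A"
    then show "(w, 0) \<in> ?D P \<times> ?D Q" using A(2) pq by auto
  next
    fix w assume "w \<in> B"
    then show "(0, w) \<in> ?D P \<times> ?D Q" using B(2) pq by auto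
  qed
  ultimately have "span ?S = span (?D P \<times> ?D Q)"
    by (simp only: real_vector.span_eq simp_thms)
  then have "pdim (P \<times> Q) = card ?S"
    unfolding pdim_def D using S by (rule real_vector.dim_eq_card)
  also have "\<dots> = card ((\<lambda>x. (x, 0::'b)) ` A) + card (Pair (0::'a) ` B)"
  proof (rule card_Un_disjoint)
    show "(\<lambda>x. (x, 0::'b)) ` A \<inter> Pair (0::'a) ` B = {}"
      using A(3) real_vector.dependent_zero by auto
  qed (use A B in auto)
  also have "\<dots> = pdim P + pdim Q"
    using A(5) B(5) by (simp add: card_image inj_on_def)
  finally show ?thesis .
qed

lemma pdim_Times_subset:
  assumes "polytope P" "polytope Q" "F \<subseteq> P" "G \<subseteq> Q" "F \<noteq> {}" "G \<noteq> {}"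
  shows "pdim (F \<times> G) = pdim F + pdim G"
  by (rule polytope_finite_dim[OF assms(1,3)], rule polytope_finite_dim[OF assms(2,4)])
    (rule pdim_Times[OF _ _ _ _ assms(5,6)])

lemma pdim_mono:
  assumes "polytope P" "F \<subseteq> P"
  shows "pdim F \<le> pdim P"
proof -
  let ?D = "\<lambda>P. {x - y |x y. x \<in> P \<and> y \<in> P}"
  obtain A where A: "finite A" "independent A" "span A = span (?D P)" "card A = pdim P"
    by (rule polytope_finite_dim[OF assms(1) order_refl], rule pdim_basis)
  obtain B where B: "B \<subseteq> ?D F" "independent B" "card B = pdim F"
    unfolding pdim_def by (rule real_vector.basis_exists[of "?D F"])
  have DF: "?D F \<subseteq> ?D P" using assms(2) by auto
  have "B \<subseteq> span A"
    unfolding A(3) by (intro order_trans[OF B(1) order_trans[OF DF span_superset]])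
  then show ?thesis using independent_span_bound[OF A(1) B(2)] A(4) B(3) by simp
qed

lemma span_differences_convex:
  assumes "convex F" "F \<noteq> {}" "v \<in> span {x - y |x y. x \<in> F \<and> y \<in> F}"
  obtains c x y where "c \<ge> 0" "x \<in> F" "y \<in> F" "v = c *\<^sub>R (x - y)"
proof -
  let ?W = "{c *\<^sub>R (x - y) |c x y. c \<ge> (0::real) \<and> x \<in> F \<and> y \<in> F}"
  have "subspace ?W"
  proof (rule subspaceI)
    show "0 \<in> ?W" using assms(2) by force
  next
    fix u w assume "u \<in> ?W" "w \<in> ?W"
    then obtain c x y c' x' y' where
      u: "u = c *\<^sub>R (x - y)" "c \<ge> 0" "x \<in> F" "y \<in> F" and
      w: "w = c' *\<^sub>R (x' - y')" "c' \<ge> 0" "x' \<in> F" "y' \<in> F" by blast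
    show "u + w \<in> ?W"
    proof (cases "c + c' = 0")
      case True
      then have "c = 0" "c' = 0" using u w by auto
      then show ?thesis using u w by force
    next
      case False
      then have s: "c + c' > 0" using u w by auto
      define a where "a = (c / (c + c')) *\<^sub>R x + (c' / (c + c')) *\<^sub>R x'"
      define b where "b = (c / (c + c')) *\<^sub>R y + (c' / (c + c')) *\<^sub>R y'"
      have one: "c / (c + c') + c' / (c + c') = 1"
        using s by (simp add: add_divide_distrib[symmetric])
      have "a \<in> F" "b \<in> F" unfolding a_def b_def
        using assms(1) u w s one by (auto intro!: convexD)
      moreover have "(c + c') *\<^sub>R a = c *\<^sub>R x + c' *\<^sub>R x'" "(c + c') *\<^sub>R b = c *\<^sub>R y + c' *\<^sub>R y'"
        unfolding a_def b_def using s by (simp_all add: scaleR_add_right)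
      then have "u + w = (c + c') *\<^sub>R (a - b)"
        unfolding u(1) w(1) scaleR_diff_right by (simp add: scaleR_diff_right)
      ultimately show ?thesis using s by (intro CollectI exI[of _ "c + c'"] exI[of _ a] exI[of _ b]) auto
    qed
  next
    fix r :: real and u assume "u \<in> ?W"
    then obtain c x y where u: "u = c *\<^sub>R (x - y)" "c \<ge> 0" "x \<in> F" "y \<in> F" by blast
    show "r *\<^sub>R u \<in> ?W"
    proof (cases "r \<ge> 0")
      case True
      then show ?thesis using u by (intro CollectI exI[of _ "r * c"] exI[of _ x] exI[of _ y]) auto
    next
      case False
      then have "r *\<^sub>R u = (- r * c) *\<^sub>R (y - x)" "- r * c \<ge> 0"
        unfolding u(1) using u(2) by (simp_all add: scaleR_diff_right mult_nonpos_nonneg)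
      then show ?thesis using u(3,4) by blast
    qed
  qed
  moreover have "{x - y |x y. x \<in> F \<and> y \<in> F} \<subseteq> ?W" by (force intro: exI[of _ "1::real"])
  ultimately have "v \<in> ?W" using assms(3) span_minimal by blast
  then show thesis using that by blast
qed

lemma face_of_same_pdim:
  assumes "polytope P" "F face_of P" "F \<noteq> {}" "pdim F = pdim P"
  shows "F = P"
proof -
  let ?D = "\<lambda>P. {x - y |x y. x \<in> P \<and> y \<in> P}"
  have sub: "F \<subseteq> P" and cF: "convex F"
    using assms(2) face_of_imp_subset face_of_imp_convex by blast+
  obtain A where A: "finite A" "independent A" "span A = span (?D P)" "card A = pdim P"
    by (rule polytope_finite_dim[OF assms(1) order_refl], rule pdim_basis)
  obtain B where B: "B \<subseteq> ?D F" "independent B" "card B = pdim F"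
    unfolding pdim_def by (rule real_vector.basis_exists[of "?D F"])
  have DF: "?D F \<subseteq> ?D P" using sub by auto
  have BA: "B \<subseteq> span A"
    unfolding A(3) by (intro order_trans[OF B(1) order_trans[OF DF span_superset]])
  then have "finite B" using independent_span_bound[OF A(1) B(2)] by simp
  have "span A \<subseteq> span B"
  proof
    fix x assume x: "x \<in> span A"
    show "x \<in> span B"
    proof (rule ccontr)
      assume "x \<notin> span B"
      then have "independent (insert x B)" "x \<notin> B"
        using B(2) independent_insertI span_base by blast+
      then have "card (insert x B) \<le> card A"
        using independent_span_bound[OF A(1)] x BA by blast
      then show False using \<open>x \<notin> B\<close> \<open>finite B\<close> A(4) B(3) assms(4) by simp
    qed
  qed
  also have "span B \<subseteq> span (?D F)" by (rule span_mono[OF B(1)])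
  finally have D: "?D P \<subseteq> span (?D F)"
    unfolding A(3) by (rule order_trans[OF span_superset])
  obtain a where a: "a \<in> F" using assms(3) by auto
  have "y \<in> F" if y: "y \<in> P" for y
  proof -
    have "y - a \<in> ?D P" using y a sub by blast
    then have "y - a \<in> span (?D F)" using D by (rule subsetD[rotated])
    then obtain c x z where c: "c \<ge> 0" "x \<in> F" "z \<in> F" "y - a = c *\<^sub>R (x - z)"
      using span_differences_convex[OF cF assms(3)] by blast
    show ?thesis
    proof (cases "c = 0 \<or> y = z")
      case True
      then show ?thesis using c a by auto
    next
      case False
      then have c0: "c > 0" using c by auto
      define m where "m = (1 / (1 + c)) *\<^sub>R a + (c / (1 + c)) *\<^sub>R x"
      have one: "1 / (1 + c) + c / (1 + c) = 1"
        using c0 by (simp add: add_divide_distrib[symmetric])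
      have "m \<in> F" unfolding m_def using cF a c c0 one by (auto intro!: convexD)
      have y': "a + c *\<^sub>R x = y + c *\<^sub>R z" using c(4) by (simp add: algebra_simps)
      have "m = (1 / (1 + c)) *\<^sub>R (a + c *\<^sub>R x)" unfolding m_def by (simp add: algebra_simps)
      also have "\<dots> = (1 / (1 + c)) *\<^sub>R y + (c / (1 + c)) *\<^sub>R z"
        unfolding y' by (simp add: algebra_simps)
      finally have "m = (1 - c / (1 + c)) *\<^sub>R y + (c / (1 + c)) *\<^sub>R z" using one by (simp add: diff_eq_eq[symmetric] eq_diff_eq)
      then have "m \<in> open_segment y z"
        using False c0 unfolding in_segment by (auto intro!: exI[of _ "c / (1 + c)"])
      then show ?thesis
        using face_ofD[OF assms(2)] y c sub \<open>m \<in> F\<close> by blast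
    qed
  qed
  then show ?thesis using sub by blast
qed

lemma facets_Times:
  assumes "polytope P" "polytope Q" "P \<noteq> {}" "Q \<noteq> {}"
  shows "facets (P \<times> Q) = (\<lambda>F. F \<times> Q) ` facets P \<union> (\<lambda>G. P \<times> G) ` facets Q"
proof -
  have cv: "convex P" "convex Q" using assms polytope_imp_convex by auto
  have PQ: "pdim (P \<times> Q) = pdim P + pdim Q"
    by (rule pdim_Times_subset[OF assms(1,2) order_refl order_refl assms(3,4)])
  have pd: "pdim (F \<times> G) = pdim F + pdim G" "pdim F \<le> pdim P" "pdim G \<le> pdim Q"
    if "F face_of P" "G face_of Q" "F \<noteq> {}" "G \<noteq> {}" for F G
    using that pdim_mono[OF assms(1) face_of_imp_subset] pdim_mono[OF assms(2) face_of_imp_subset]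
    by (simp_all add: pdim_Times_subset[OF assms(1,2)] face_of_imp_subset)
  have "C \<in> (\<lambda>F. F \<times> Q) ` facets P \<union> (\<lambda>G. P \<times> G) ` facets Q" if C: "C \<in> facets (P \<times> Q)" for C
  proof -
    have Cf: "C face_of P \<times> Q" "C \<noteq> {}" "Suc (pdim C) = pdim P + pdim Q"
      using C assms by (auto simp: facets_def PQ)
    obtain F G where FG: "F face_of P" "G face_of Q" "C = F \<times> G" "F \<noteq> {}" "G \<noteq> {}"
      using face_of_Times_cases[OF Cf(1) cv] Cf(2) by (metis image_is_empty)
    then have "Suc (pdim F + pdim G) = pdim P + pdim Q" "pdim F \<le> pdim P" "pdim G \<le> pdim Q"
      using pd Cf(3) by auto
    then consider "Suc (pdim F) = pdim P" "pdim G = pdim Q" | "pdim F = pdim P" "Suc (pdim G) = pdim Q"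
      by linarith
    then show ?thesis
    proof cases
      case 1
      then have "G = Q" using face_of_same_pdim FG assms by blast
      then show ?thesis using 1 FG by (auto simp: facets_def)
    next
      case 2
      then have "F = P" using face_of_same_pdim FG assms by blast
      then show ?thesis using 2 FG by (auto simp: facets_def)
    qed
  qed
  moreover have "F \<times> Q \<in> facets (P \<times> Q)" if "F \<in> facets P" for F
    using that pd[of F Q] assms cv
    by (auto simp: facets_def face_of_Times face_of_refl PQ)
  moreover have "P \<times> G \<in> facets (P \<times> Q)" if "G \<in> facets Q" for G
    using that pd[of P G] assms cv
    by (auto simp: facets_def face_of_Times face_of_refl PQ)
  ultimately show ?thesis by blast
qed

lemma finite_facets_at_vertex:
  assumes "simple_polytope P" "v extreme_point_of P"
  shows "finite {F \<in> facets P. v \<in> F}"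
proof (cases "pdim P = 0")
  case True
  then show ?thesis by (simp add: facets_def)
next
  case False
  then show ?thesis using assms unfolding simple_polytope_def by (metis card.infinite)
qed

lemma simple_polytope_Times:
  assumes P: "simple_polytope P" and Q: "simple_polytope Q"
  shows "simple_polytope (P \<times> Q)"
proof -
  have pq: "polytope P" "polytope Q" "P \<noteq> {}" "Q \<noteq> {}"
    using assms by (auto simp: simple_polytope_def)
  have cv: "convex P" "convex Q" using pq polytope_imp_convex by auto
  have "card {F \<in> facets (P \<times> Q). v \<in> F} = pdim (P \<times> Q)" if v: "v extreme_point_of P \<times> Q" for v
  proof -
    obtain a b where ab: "v = (a, b)" by force
    have "{(a, b)} face_of P \<times> Q" using v ab by (simp add: face_of_singleton)
    then have "{a} face_of P" "{b} face_of Q" using face_of_Times_cases(1,2)[OF _ cv] by force+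
    then have a: "a extreme_point_of P" and b: "b extreme_point_of Q"
      by (auto simp: face_of_singleton)
    then have ain: "a \<in> P" and bin: "b \<in> Q" by (auto simp: extreme_point_of_def)
    let ?A = "{F \<in> facets P. a \<in> F}" and ?B = "{G \<in> facets Q. b \<in> G}"
    have "{F \<in> facets (P \<times> Q). v \<in> F} = (\<lambda>F. F \<times> Q) ` ?A \<union> (\<lambda>G. P \<times> G) ` ?B"
      unfolding facets_Times[OF pq] ab using ain bin by auto
    moreover have "card ((\<lambda>F. F \<times> Q) ` ?A \<union> (\<lambda>G. P \<times> G) ` ?B)
        = card ((\<lambda>F. F \<times> Q) ` ?A) + card ((\<lambda>G. P \<times> G) ` ?B)"
    proof (rule card_Un_disjoint)
      show "(\<lambda>F. F \<times> Q) ` ?A \<inter> (\<lambda>G. P \<times> G) ` ?B = {}"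
      proof (rule ccontr)
        assume "(\<lambda>F. F \<times> Q) ` ?A \<inter> (\<lambda>G. P \<times> G) ` ?B \<noteq> {}"
        then obtain F G where "F \<in> facets P" "a \<in> F" "G \<in> facets Q" "b \<in> G" "F \<times> Q = P \<times> G" by auto
        then have "F = P" using pq(3,4) by (auto simp: times_eq_iff)
        then show False using \<open>F \<in> facets P\<close> by (simp add: facets_def)
      qed
    qed (use finite_facets_at_vertex[OF P a] finite_facets_at_vertex[OF Q b] in auto)
    moreover have "inj_on (\<lambda>F. F \<times> Q) ?A" "inj_on (\<lambda>G. P \<times> G) ?B"
      using pq by (auto simp: inj_on_def times_eq_iff)
    ultimately show ?thesis
      using P Q a b pq by (simp add: card_image simple_polytope_def pdim_Times_subset)
  qed
  then show ?thesis using pq by (simp add: simple_polytope_def polytope_Times)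
qed


section \<open>The type of combinatorial simple polytopes\<close>

instantiation poly_mapping :: (type, real_vector) real_vector
begin

lift_definition scaleR_poly_mapping :: "real \<Rightarrow> ('a \<Rightarrow>\<^sub>0 'b) \<Rightarrow> ('a \<Rightarrow>\<^sub>0 'b)"
  is "\<lambda>r f k. r *\<^sub>R f k"
  by (rule finite_subset[rotated]) auto

instance
  by standard (transfer; simp add: fun_eq_iff algebra_simps)+

end

lemma simple_polytope_point: "simple_polytope {0 :: 'a::real_vector}"
proof -
  have "dim {0 :: 'a} = 0"
    by (rule real_vector.dim_unique[of "{}"]) (auto simp: independent_empty)
  then have "facets {0 :: 'a} = {}" "pdim {0 :: 'a} = 0"
    by (auto simp: facets_def pdim_def)
  then show ?thesis by (auto simp: simple_polytope_def polytope_sing)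
qed

quotient_type cpolytope = "(nat \<Rightarrow>\<^sub>0 real) set" /
  partial: "\<lambda>P Q. simple_polytope P \<and> simple_polytope Q \<and> comb_equiv P Q"
proof (rule part_equivpI)
  show "\<exists>P::(nat \<Rightarrow>\<^sub>0 real) set. simple_polytope P \<and> simple_polytope P \<and> comb_equiv P P"
    using comb_equiv_refl simple_polytope_point by blast
qed (auto intro!: sympI transpI intro: comb_equiv_sym comb_equiv_trans)

text \<open>
  The combinatorial type of a simple polytope in any real vector space. The result does not depend
  on the choice, since \<open>abs_cpolytope\<close> identifies combinatorially equivalent polytopes.
\<close>

definition ctype :: "'a::real_vector set \<Rightarrow> cpolytope"
  where "ctype P = abs_cpolytope (SOME Q. simple_polytope Q \<and> comb_equiv P Q)"

lemma simple_rep_cpolytope: "simple_polytope (rep_cpolytope c)"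
  using Quotient3_rep_reflp[OF Quotient3_cpolytope] by blast

lemma cpolytope_eqI: "comb_equiv (rep_cpolytope c) (rep_cpolytope c') \<Longrightarrow> c = c'"
  using Quotient3_rel_rep[OF Quotient3_cpolytope, of c c'] simple_rep_cpolytope by blast

lemma comb_equiv_rep_ctype:
  fixes P :: "'a::real_vector set" and f :: "'a \<Rightarrow> nat \<Rightarrow>\<^sub>0 real"
  assumes "simple_polytope P" "linear f" "inj f"
  shows "comb_equiv P (rep_cpolytope (ctype P))"
proof -
  define Q :: "(nat \<Rightarrow>\<^sub>0 real) set" where "Q = (SOME Q. simple_polytope Q \<and> comb_equiv P Q)"
  have "simple_polytope (f ` P) \<and> comb_equiv P (f ` P)"
    using assms by (simp add: simple_polytope_linear_image comb_equiv_linear_image)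
  then have Q: "simple_polytope Q \<and> comb_equiv P Q"
    unfolding Q_def by (rule someI)
  then have *: "comb_equiv (rep_cpolytope (abs_cpolytope Q)) Q"
    using Quotient3_rep_abs[OF Quotient3_cpolytope, of Q] comb_equiv_refl by blast
  show ?thesis
    unfolding ctype_def Q_def[symmetric]
    by (rule comb_equiv_trans[OF conjunct2[OF Q] comb_equiv_sym[OF *]])
qed

lift_definition interleave :: "(nat \<Rightarrow>\<^sub>0 real) \<Rightarrow> (nat \<Rightarrow>\<^sub>0 real) \<Rightarrow> (nat \<Rightarrow>\<^sub>0 real)"
  is "\<lambda>x y k. if even k then x (k div 2) else y (k div 2)"
proof -
  fix x y :: "nat \<Rightarrow> real"
  assume "finite {k. x k \<noteq> 0}" "finite {k. y k \<noteq> 0}"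
  then have "finite ((\<lambda>k. 2 * k) ` {k. x k \<noteq> 0} \<union> (\<lambda>k. 2 * k + 1) ` {k. y k \<noteq> 0})"
    by simp
  then show "finite {k. (if even k then x (k div 2) else y (k div 2)) \<noteq> 0}"
  proof (rule rev_finite_subset, intro subsetI)
    fix k assume k: "k \<in> {k. (if even k then x (k div 2) else y (k div 2)) \<noteq> 0}"
    show "k \<in> (\<lambda>k. 2 * k) ` {k. x k \<noteq> 0} \<union> (\<lambda>k. 2 * k + 1) ` {k. y k \<noteq> 0}"
    proof (cases "even k")
      case True
      then show ?thesis using k by (intro UnI1 image_eqI[of _ _ "k div 2"]) auto
    next
      case False
      then show ?thesis using k by (intro UnI2 image_eqI[of _ _ "k div 2"]) auto
    qed
  qed
qed

lemma linear_interleave: "linear (\<lambda>p. interleave (fst p) (snd p))"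
  by (rule linearI; rule poly_mapping_eqI)
    (simp_all add: interleave.rep_eq plus_poly_mapping.rep_eq scaleR_poly_mapping.rep_eq)

lemma inj_interleave: "inj (\<lambda>p. interleave (fst p) (snd p))"
proof (rule injI)
  fix p q assume "interleave (fst p) (snd p) = interleave (fst q) (snd q)"
  then have eq: "Poly_Mapping.lookup (interleave (fst p) (snd p)) k = Poly_Mapping.lookup (interleave (fst q) (snd q)) k" for k
    by simp
  show "p = q"
  proof (rule prod_eqI; rule poly_mapping_eqI)
    fix k
    show "Poly_Mapping.lookup (fst p) k = Poly_Mapping.lookup (fst q) k" using eq[of "2 * k"] by (simp add: interleave.rep_eq)
    show "Poly_Mapping.lookup (snd p) k = Poly_Mapping.lookup (snd q) k" using eq[of "2 * k + 1"] by (simp add: interleave.rep_eq)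
  qed
qed

text \<open>
  The commutative monoid of combinatorial polytopes is written additively, as required by
  \<^typ>\<open>'a \<Rightarrow>\<^sub>0 'b\<close>: its addition is the \<^emph>\<open>Cartesian product\<close> of polytopes and its zero is the
  \<^emph>\<open>point\<close>.
\<close>

instantiation cpolytope :: comm_monoid_add
begin

definition plus_cpolytope :: "cpolytope \<Rightarrow> cpolytope \<Rightarrow> cpolytope"
  where "c + c' = ctype (rep_cpolytope c \<times> rep_cpolytope c')"

definition zero_cpolytope :: cpolytope
  where "0 = ctype {0 :: nat \<Rightarrow>\<^sub>0 real}"

lemma comb_equiv_rep_plus:
  "comb_equiv (rep_cpolytope c \<times> rep_cpolytope c') (rep_cpolytope (c + c'))"
  unfolding plus_cpolytope_def
  by (rule comb_equiv_rep_ctype[OF _ linear_interleave inj_interleave])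
    (intro simple_polytope_Times simple_rep_cpolytope)

lemma comb_equiv_rep_zero: "comb_equiv {0 :: nat \<Rightarrow>\<^sub>0 real} (rep_cpolytope 0)"
  unfolding zero_cpolytope_def
  by (rule comb_equiv_rep_ctype[OF simple_polytope_point linear_id inj_on_id])

lemma convex_rep_cpolytope: "convex (rep_cpolytope c)"
  using simple_rep_cpolytope[of c] by (simp add: simple_polytope_def polytope_imp_convex)

instance
proof
  fix a b c :: cpolytope
  let ?r = rep_cpolytope
  note cv = convex_rep_cpolytope convex_Times
  have "comb_equiv (?r (a + b + c)) (?r (a + b) \<times> ?r c)"
    by (rule comb_equiv_sym[OF comb_equiv_rep_plus])
  also have "comb_equiv \<dots> ((?r a \<times> ?r b) \<times> ?r c)"
    by (intro comb_equiv_Times comb_equiv_sym[OF comb_equiv_rep_plus] comb_equiv_refl cv)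
  also have "comb_equiv \<dots> ((\<lambda>p. (fst (fst p), snd (fst p), snd p)) ` ((?r a \<times> ?r b) \<times> ?r c))"
    by (rule comb_equiv_linear_image) (auto intro!: linearI injI)
  also have "(\<lambda>p. (fst (fst p), snd (fst p), snd p)) ` ((?r a \<times> ?r b) \<times> ?r c) = ?r a \<times> ?r b \<times> ?r c"
    by force
  also have "comb_equiv \<dots> (?r a \<times> ?r (b + c))"
    by (intro comb_equiv_Times comb_equiv_rep_plus comb_equiv_refl cv)
  also have "comb_equiv \<dots> (?r (a + (b + c)))"
    by (rule comb_equiv_rep_plus)
  finally show "a + b + c = a + (b + c)" by (rule cpolytope_eqI)
  have "comb_equiv (?r (a + b)) (?r a \<times> ?r b)"
    by (rule comb_equiv_sym[OF comb_equiv_rep_plus])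
  also have "comb_equiv \<dots> (prod.swap ` (?r a \<times> ?r b))"
    by (rule comb_equiv_linear_image) (auto intro!: linearI)
  also have "prod.swap ` (?r a \<times> ?r b) = ?r b \<times> ?r a" by force
  also have "comb_equiv \<dots> (?r (b + a))"
    by (rule comb_equiv_rep_plus)
  finally show "a + b = b + a" by (rule cpolytope_eqI)
  have "comb_equiv (?r (0 + a)) (?r 0 \<times> ?r a)"
    by (rule comb_equiv_sym[OF comb_equiv_rep_plus])
  also have "comb_equiv \<dots> ({0 :: nat \<Rightarrow>\<^sub>0 real} \<times> ?r a)"
    by (intro comb_equiv_Times comb_equiv_sym[OF comb_equiv_rep_zero] comb_equiv_refl cv convex_singleton)
  also have "{0 :: nat \<Rightarrow>\<^sub>0 real} \<times> ?r a = Pair 0 ` ?r a" by auto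
  also have "comb_equiv \<dots> (?r a)"
    by (intro comb_equiv_sym[OF comb_equiv_linear_image]) (auto intro!: linearI injI)
  finally show "0 + a = a" by (rule cpolytope_eqI)
qed

end


section \<open>The ring of simple polytopes and the operator \<open>d\<close>\<close>

type_synonym polytope_ring = "cpolytope \<Rightarrow>\<^sub>0 int"

text \<open>
  Dimension and facets are read off from an arbitrary representative; both depend on the face
  poset only.
\<close>

definition cdim :: "cpolytope \<Rightarrow> nat"
  where "cdim c = pdim (rep_cpolytope c)"

definition boundary :: "cpolytope \<Rightarrow> polytope_ring"
  where "boundary c = (\<Sum>F\<in>facets (rep_cpolytope c). frag_of (ctype F))"

definition d_op :: "polytope_ring \<Rightarrow> polytope_ring"
  where "d_op = frag_extend boundary"


section \<open>Nestohedra\<close>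

definition building_set :: "nat \<Rightarrow> nat set set \<Rightarrow> bool"
  where "building_set n B \<longleftrightarrow> (\<forall>S\<in>B. S \<noteq> {} \<and> S \<subseteq> {1..n+1}) \<and> (\<forall>i\<in>{1..n+1}. {i} \<in> B) \<and>
    (\<forall>S\<in>B. \<forall>T\<in>B. S \<inter> T \<noteq> {} \<longrightarrow> S \<union> T \<in> B)"

abbreviation connected_building_set :: "nat \<Rightarrow> nat set set \<Rightarrow> bool"
  where "connected_building_set n B \<equiv> building_set n B \<and> {1..n+1} \<in> B"

text \<open>The outer sum is the Minkowski sum of \<^theory>\<open>HOL-Library.Set_Algebras\<close>.\<close>

definition nestohedron :: "nat set set \<Rightarrow> (nat \<Rightarrow>\<^sub>0 real) set"
  where "nestohedron B = (\<Sum>S\<in>B. convex hull {Poly_Mapping.single i 1 |i. i \<in> S})"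

text \<open>Graphs on \<open>{1..n+1}\<close> are given by their symmetric, irreflexive adjacency relation.\<close>

definition graphical_building_set :: "nat \<Rightarrow> (nat \<times> nat) set \<Rightarrow> nat set set"
  where "graphical_building_set n E =
    {S. S \<noteq> {} \<and> S \<subseteq> {1..n+1} \<and> (\<forall>u\<in>S. \<forall>v\<in>S. (u, v) \<in> (Restr E S)\<^sup>*)}"

definition complete_graph :: "nat \<Rightarrow> (nat \<times> nat) set"
  where "complete_graph n = {(i, j). i \<in> {1..n+1} \<and> j \<in> {1..n+1} \<and> i \<noteq> j}"

definition star_graph :: "nat \<Rightarrow> (nat \<times> nat) set"
  where "star_graph n = {(i, j). i \<in> {1..n+1} \<and> j \<in> {1..n+1} \<and> i \<noteq> j \<and> (i = 1 \<or> j = 1)}"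

definition Pe :: "nat \<Rightarrow> cpolytope"
  where "Pe n = ctype (nestohedron (graphical_building_set n (complete_graph n)))"

definition St :: "nat \<Rightarrow> cpolytope"
  where "St n = ctype (nestohedron (graphical_building_set n (star_graph n)))"

definition B_Mas :: "nat \<Rightarrow> nat set set"
  where "B_Mas n = {{i} |i. i \<in> {1..n+1}} \<union> {{1, 2} \<union> I |I. I \<subseteq> {3..n+1}} \<union>
    {{1} \<union> J |J. J \<noteq> {} \<and> J \<subseteq> {3..n}}"

definition B_Gamma :: "nat \<Rightarrow> nat set set"
  where "B_Gamma n = {{i} |i. i \<in> {1..n+1}} \<union> {S. S \<subseteq> {1..n} \<and> card S \<ge> 2} \<union>
    {{1, n+1} \<union> J |J. J \<subseteq> {2..n}}"

lemma connected_building_set_B_Mas: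
  assumes "n \<ge> 2" shows "connected_building_set n (B_Mas n)"
proof -
  have "{1..n+1} = {1, 2} \<union> {3..n+1}" using assms by auto
  then have "{1..n+1} \<in> B_Mas n" unfolding B_Mas_def by blast
  moreover have mem: "S \<in> B_Mas n \<longleftrightarrow> S \<subseteq> {1..n+1} \<and> S \<noteq> {} \<and>
      (is_singleton S \<or> 1 \<in> S \<and> (2 \<in> S \<or> n + 1 \<notin> S))" for S
  proof
    assume "S \<in> B_Mas n"
    then show "S \<subseteq> {1..n+1} \<and> S \<noteq> {} \<and> (is_singleton S \<or> 1 \<in> S \<and> (2 \<in> S \<or> n + 1 \<notin> S))"
      using assms unfolding B_Mas_def by auto
  next
    assume S: "S \<subseteq> {1..n+1} \<and> S \<noteq> {} \<and> (is_singleton S \<or> 1 \<in> S \<and> (2 \<in> S \<or> n + 1 \<notin> S))"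
    consider i where "S = {i}" | "\<not> is_singleton S" "2 \<in> S" | "\<not> is_singleton S" "2 \<notin> S"
      by (auto simp: is_singleton_def)
    then show "S \<in> B_Mas n"
    proof cases
      case 1
      then show ?thesis using S unfolding B_Mas_def by auto
    next
      case 2
      then have S2: "1 \<in> S" "2 \<in> S" using S by auto
      have "i \<in> {3..n+1}" if "i \<in> S - {1, 2}" for i
      proof -
        have "i \<noteq> 1" "i \<noteq> 2" "i \<ge> 1" "i \<le> n + 1" using S that by auto
        then show ?thesis by auto
      qed
      moreover have "S = {1, 2} \<union> (S - {1, 2})" using S2 by auto
      ultimately show ?thesis unfolding B_Mas_def by blast
    next
      case 3
      then have "S = {1} \<union> (S - {1})" using S by auto
      moreover have "S - {1} \<noteq> {}" using 3 S by (metis is_singletonI is_singleton_def insert_Diff)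
      moreover have "i \<in> {3..n}" if "i \<in> S - {1}" for i
      proof -
        have "i \<noteq> 1" "i \<noteq> 2" "i \<noteq> n + 1" "i \<ge> 1" "i \<le> n + 1" using 3 S that by auto
        then show ?thesis by auto
      qed
      ultimately have "S = {1} \<union> (S - {1}) \<and> S - {1} \<noteq> {} \<and> S - {1} \<subseteq> {3..n}"
        by (simp add: subset_iff)
      then have "S \<in> {{1} \<union> J |J. J \<noteq> {} \<and> J \<subseteq> {3..n}}"
        by (intro CollectI exI[of _ "S - {1}"])
      then show ?thesis unfolding B_Mas_def by simp
    qed
  qed
  have "S \<union> T \<in> B_Mas n" if "S \<in> B_Mas n" "T \<in> B_Mas n" "S \<inter> T \<noteq> {}" for S T
  proof (cases "is_singleton S \<or> is_singleton T")
    case True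
    then have "S \<subseteq> T \<or> T \<subseteq> S" using that(3) by (auto simp: is_singleton_def)
    then show ?thesis using that by (auto simp: Un_absorb1 Un_absorb2)
  next
    case False
    then show ?thesis using that unfolding mem by auto
  qed
  ultimately show ?thesis
    unfolding building_set_def by (auto simp: mem)
qed

lemma connected_building_set_B_Gamma:
  assumes "n \<ge> 2" shows "connected_building_set n (B_Gamma n)"
proof -
  have "{1..n+1} = {1, n+1} \<union> {2..n}" using assms by auto
  then have "{1..n+1} \<in> B_Gamma n" unfolding B_Gamma_def by blast
  moreover have mem: "S \<in> B_Gamma n \<longleftrightarrow> S \<subseteq> {1..n+1} \<and> S \<noteq> {} \<and>
      (is_singleton S \<or> 1 \<in> S \<or> n + 1 \<notin> S)" for S
  proof
    assume "S \<in> B_Gamma n"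
    then show "S \<subseteq> {1..n+1} \<and> S \<noteq> {} \<and> (is_singleton S \<or> 1 \<in> S \<or> n + 1 \<notin> S)"
      using assms unfolding B_Gamma_def by fastforce
  next
    assume S: "S \<subseteq> {1..n+1} \<and> S \<noteq> {} \<and> (is_singleton S \<or> 1 \<in> S \<or> n + 1 \<notin> S)"
    consider i where "S = {i}" | "\<not> is_singleton S" "n + 1 \<in> S" | "\<not> is_singleton S" "n + 1 \<notin> S"
      by (auto simp: is_singleton_def)
    then show "S \<in> B_Gamma n"
    proof cases
      case 1
      then show ?thesis using S unfolding B_Gamma_def by auto
    next
      case 2
      then have "S = {1, n+1} \<union> (S - {1, n+1})" "S - {1, n+1} \<subseteq> {2..n}" using S by force+
      then show ?thesis unfolding B_Gamma_def by blast
    next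
      case 3
      have "finite S" using S finite_subset by blast
      then have "card S \<noteq> 0" "card S \<noteq> 1" using 3 S by (auto simp: is_singleton_altdef)
      moreover have "i \<in> {1..n}" if "i \<in> S" for i
      proof -
        have "i \<noteq> n + 1" "i \<ge> 1" "i \<le> n + 1" using 3 S that by auto
        then show ?thesis by auto
      qed
      ultimately show ?thesis unfolding B_Gamma_def by auto
    qed
  qed
  have "S \<union> T \<in> B_Gamma n" if "S \<in> B_Gamma n" "T \<in> B_Gamma n" "S \<inter> T \<noteq> {}" for S T
  proof (cases "is_singleton S \<or> is_singleton T")
    case True
    then have "S \<subseteq> T \<or> T \<subseteq> S" using that(3) by (auto simp: is_singleton_def)
    then show ?thesis using that by (auto simp: Un_absorb1 Un_absorb2)
  next
    case False
    then show ?thesis using that unfolding mem by auto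
  qed
  ultimately show ?thesis
    unfolding building_set_def by (auto simp: mem)
qed

definition segment :: cpolytope
  where "segment = ctype {0..1::real}"

definition P_Mas :: "nat \<Rightarrow> cpolytope"
  where "P_Mas n = (if n = 0 then 0 else if n = 1 then segment else ctype (nestohedron (B_Mas n)))"

definition P_Gamma :: "nat \<Rightarrow> cpolytope"
  where "P_Gamma n = (if n = 0 then 0 else if n = 1 then segment else ctype (nestohedron (B_Gamma n)))"


section \<open>Families and complexity\<close>

definition family :: "cpolytope set \<Rightarrow> bool"
  where "family F \<longleftrightarrow> (\<forall>n. {c \<in> F. cdim c = n} \<noteq> {} \<and> finite {c \<in> F. cdim c = n})"

definition linear_family :: "cpolytope set \<Rightarrow> bool"
  where "linear_family F \<longleftrightarrow> (\<forall>n. \<exists>!c. c \<in> F \<and> cdim c = n)"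

inductive_set subring_generated :: "'a::comm_ring_1 set \<Rightarrow> 'a set" for S
  where
    base: "x \<in> S \<Longrightarrow> x \<in> subring_generated S"
  | one: "1 \<in> subring_generated S"
  | diff: "x \<in> subring_generated S \<Longrightarrow> y \<in> subring_generated S \<Longrightarrow> x - y \<in> subring_generated S"
  | mult: "x \<in> subring_generated S \<Longrightarrow> y \<in> subring_generated S \<Longrightarrow> x * y \<in> subring_generated S"

definition d_family :: "cpolytope set \<Rightarrow> bool"
  where "d_family F \<longleftrightarrow> family F \<and>
    (\<forall>x \<in> subring_generated (frag_of ` F). d_op x \<in> subring_generated (frag_of ` F))"

definition d_closure :: "cpolytope set \<Rightarrow> cpolytope set \<Rightarrow> bool"
  where "d_closure F G \<longleftrightarrow> F \<subseteq> G \<and> d_family G \<and>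
    (\<forall>H. F \<subseteq> H \<and> d_family H \<and> H \<subseteq> G \<longrightarrow> H = G)"

text \<open>
  Complexity is a relation: the \<open>k\<close> linear families are distinct as sets, but they may overlap, and
  \<open>k\<close> is not required to be the least possible number.
\<close>

definition has_complexity :: "cpolytope set \<Rightarrow> nat \<Rightarrow> bool"
  where "has_complexity F k \<longleftrightarrow> family F \<and> k \<ge> 1 \<and>
    (\<exists>G. d_closure F G \<and> (\<exists>\<L>. finite \<L> \<and> card \<L> = k \<and> (\<forall>L\<in>\<L>. linear_family L) \<and> G = \<Union>\<L>))"

end

theory Submission
  imports Defs
begin

text \<open>
  A nestohedron consists of the points \<open>x\<close> supported on the ground set with \<open>x(S) \<ge> f(S)\<close> for all
  \<open>S\<close> in the building set, with equality for the ground set, where \<open>f(S)\<close> is the number (for positive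
  weights: the total weight) of members contained in \<open>S\<close>. The sets of constraints that are tight at
  some point are exactly the nested sets. So the face poset depends only on the building set up to
  relabelling, all facets are the \<open>{x. x(S) = f(S)}\<close>, and such a facet is the product of the
  polytopes of the restriction to \<open>S\<close> and, with weights, of the contraction by \<open>S\<close>. For the four
  families these restrictions and contractions belong to the four families again, which gives the
  formula for \<open>d\<close> and shows that their union is a \<open>d\<close>-family. It is minimal: all facets of
  \<open>P_Mas (n + 1)\<close> are products of members of any smaller \<open>d\<close>-family containing \<open>range P_Mas\<close>, and
  \<open>St n\<close> and \<open>P_Gamma n\<close> are indecomposable facets of it, while \<open>Pe n\<close> is an indecomposable facet of
  \<open>P_Gamma (n + 1)\<close>.
\<close>


section \<open>Faces of polytopes in real vector spaces\<close>

text \<open>\<open>cdim\<close> and \<open>boundary\<close> inspect an arbitrary representative of a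
  combinatorial type, so a computation on a concrete nestohedron counts only once dimension and
  facets are known to be determined by the face poset. Chains of faces bound the dimension from
  below; simplicity bounds it from above, since the facets through a vertex are maximal faces.
  Weights arise because removing \<open>S\<close> from the summands of a Minkowski sum makes several
  of them coincide: the second factor of a facet is the polytope of the contraction with
  multiplicities. The nested sets are the same for all positive weights, so the weights may be reset
  to 1. The ring is the monoid ring of polytopes under product, so the subring generated by
  \<open>H\<close> consists of the elements supported on finite products of members of
  \<open>H\<close>. The coefficients of a boundary are nonnegative, hence facets cannot cancel, and
  every facet type of a member of a d-family is such a product.\<close>

lemma face_of_convex_hull_Int:
  assumes "finite W" "F face_of convex hull W"
  shows "F = convex hull (F \<inter> W)"
proof
  show "convex hull (F \<inter> W) \<subseteq> F"
    using assms(2) by (intro hull_minimal) (auto dest: face_of_imp_convex)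
  \<comment> \<open>One generator is peeled off at a time: a point of \<open>F\<close> strictly
    between \<open>w\<close> and a point \<open>b\<close> of the remaining hull forces both into
    \<open>F\<close>, and the induction applies to \<open>b\<close>.\<close>
  have "x \<in> convex hull (F \<inter> V)" if "finite V" "V \<subseteq> W" "x \<in> F" "x \<in> convex hull V" for V x
    using that
  proof (induction V arbitrary: x rule: finite_induct)
    case empty
    then show ?case by simp
  next
    case (insert w V)
    have wW: "w \<in> convex hull W" using insert.prems(1) by (simp add: hull_inc)
    show ?case
    proof (cases "V = {}")
      case True
      then show ?thesis using insert.prems by simp
    next
      case False
      obtain u v b where x: "u \<ge> 0" "v \<ge> 0" "u + v = 1" "b \<in> convex hull V" "x = u *\<^sub>R w + v *\<^sub>R b"
        using insert.prems(3) unfolding convex_hull_insert[OF False] by blast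
      have mono: "convex hull (F \<inter> V) \<subseteq> convex hull (F \<inter> insert w V)"
        by (intro hull_mono) auto
      show ?thesis
      proof (cases "u = 0 \<or> v = 0 \<or> w = b")
        case True
        then consider "x = b" | "x = w"
          using x by (auto simp flip: scaleR_add_left)
        then show ?thesis
        proof cases
          case 1
          then show ?thesis using insert x mono by blast
        next
          case 2
          then show ?thesis using insert.prems by (simp add: hull_inc)
        qed
      next
        case False
        have "b \<in> convex hull W"
          using x(4) insert.prems(1) hull_mono[of V W convex] by auto
        moreover have "x \<in> open_segment b w"
          unfolding in_segment using False x
          by (intro conjI exI[of _ u]) (auto simp: add.commute eq_diff_eq[symmetric])
        ultimately have wb: "w \<in> F" "b \<in> F"
          using face_ofD[OF assms(2)] wW insert.prems(2) by blast+
        then have "b \<in> convex hull (F \<inter> insert w V)"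
          using insert.IH[of b] insert.prems(1) x(4) mono by auto
        moreover have "w \<in> convex hull (F \<inter> insert w V)" using wb by (simp add: hull_inc)
        ultimately show ?thesis
          unfolding x(5) using x by (intro convexD convex_convex_hull)
      qed
    qed
  qed
  from this[OF assms(1) order_refl] show "F \<subseteq> convex hull (F \<inter> W)"
    using face_of_imp_subset[OF assms(2)] by blast
qed

lemma polytope_face_of:
  assumes "polytope P" "F face_of P"
  shows "polytope F"
  using assms face_of_convex_hull_Int unfolding polytope_def by (metis finite_Int)

text \<open>A generating set of least size has no redundant point, and a generator outside the hull
  of the others is extreme.\<close>

lemma polytope_extreme_point_exists:
  assumes "polytope P" "P \<noteq> {}"
  obtains x where "x extreme_point_of P"
proof -
  obtain W0 where "finite W0" "P = convex hull W0" using assms(1) by (auto simp: polytope_def)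
  then obtain W where W: "finite W" "P = convex hull W"
    and min: "\<And>V. finite V \<Longrightarrow> P = convex hull V \<Longrightarrow> card W \<le> card V"
    using ex_has_least_nat[of "\<lambda>W. finite W \<and> P = convex hull W" W0 card] by metis
  obtain w where w: "w \<in> W" using W(2) assms(2) by fastforce
  have "w \<notin> convex hull (W - {w})"
  proof
    assume "w \<in> convex hull (W - {w})"
    then have "P = convex hull (W - {w})"
      unfolding W(2) using w by (metis hull_redundant insert_Diff)
    then have "card W \<le> card (W - {w})" using min W(1) by blast
    then show False using card_Diff1_less[OF W(1) w] by simp
  qed
  then have "w extreme_point_of P"
    unfolding W(2) using extreme_point_of_convex_hull_insert[of "W - {w}" w] W(1) w
    by (simp add: insert_absorb)
  then show thesis by (rule that)
qed

lemma pdim_singleton [simp]: "pdim {x} = 0"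
proof -
  have "dim {0 :: 'a::real_vector} = 0"
    by (rule real_vector.dim_unique[of "{}"]) (auto simp: independent_empty)
  then show ?thesis by (simp add: pdim_def)
qed

lemma pdim_strict_mono:
  assumes "polytope P" "F face_of P" "G face_of P" "F \<subset> G" "F \<noteq> {}"
  shows "pdim F < pdim G"
proof -
  have G: "polytope G" using polytope_face_of assms by blast
  have "F face_of G" using face_of_subset[OF assms(2)] assms(3,4) face_of_imp_subset by blast
  then have "pdim F \<noteq> pdim G" using face_of_same_pdim[OF G] assms by blast
  then show ?thesis using pdim_mono[OF G, of F] assms by auto
qed

section \<open>Isomorphisms of face posets\<close>

definition face_iso :: "('a::real_vector set \<Rightarrow> 'b::real_vector set) \<Rightarrow> 'a set \<Rightarrow> 'b set \<Rightarrow> bool"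
  where "face_iso f P Q \<longleftrightarrow> bij_betw f {F. F face_of P} {G. G face_of Q} \<and>
    (\<forall>F F'. F face_of P \<longrightarrow> F' face_of P \<longrightarrow> (f F \<subseteq> f F' \<longleftrightarrow> F \<subseteq> F'))"

lemma comb_equiv_face_iso: "comb_equiv P Q \<longleftrightarrow> (\<exists>f. face_iso f P Q)"
  unfolding comb_equiv_def face_iso_def ..

lemma face_iso_face: "face_iso f P Q \<Longrightarrow> F face_of P \<Longrightarrow> f F face_of Q"
  unfolding face_iso_def by (auto dest: bij_betwE)

lemma face_iso_surj: "face_iso f P Q \<Longrightarrow> G face_of Q \<Longrightarrow> \<exists>F. F face_of P \<and> f F = G"
  unfolding face_iso_def bij_betw_def by (metis (mono_tags, lifting) imageE mem_Collect_eq)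

lemma face_iso_subset:
  "face_iso f P Q \<Longrightarrow> F face_of P \<Longrightarrow> F' face_of P \<Longrightarrow> f F \<subseteq> f F' \<longleftrightarrow> F \<subseteq> F'"
  unfolding face_iso_def by blast

lemma face_iso_eq:
  "face_iso f P Q \<Longrightarrow> F face_of P \<Longrightarrow> F' face_of P \<Longrightarrow> f F = f F' \<longleftrightarrow> F = F'"
  using face_iso_subset by (metis subset_antisym order_refl)

lemma face_iso_empty [simp]:
  assumes "face_iso f P Q" shows "f {} = {}"
proof -
  obtain E where E: "E face_of P" "f E = {}" using face_iso_surj[OF assms empty_face_of] by blast
  then show ?thesis using face_iso_subset[OF assms empty_face_of E(1)] by simp
qed

lemma face_iso_empty_iff:
  "face_iso f P Q \<Longrightarrow> F face_of P \<Longrightarrow> f F = {} \<longleftrightarrow> F = {}"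
  by (metis face_iso_empty face_iso_eq empty_face_of)

lemma face_iso_top:
  assumes "face_iso f P Q" "convex P" "convex Q" shows "f P = Q"
proof -
  have P: "P face_of P" and Q: "Q face_of Q" using assms by (simp_all add: face_of_refl)
  obtain E where E: "E face_of P" "f E = Q" using face_iso_surj[OF assms(1) Q] by blast
  have "Q \<subseteq> f P"
    using face_iso_subset[OF assms(1) E(1) P] E face_of_imp_subset[OF E(1)] by simp
  then show ?thesis using face_of_imp_subset[OF face_iso_face[OF assms(1) P]] by blast
qed

text \<open>Isomorphisms have to identify facets as polytopes, not only the whole polytopes. The
  faces of a face \<open>F\<close> are exactly the faces of \<open>P\<close> inside
  \<open>F\<close>, so \<open>f\<close> restricts.\<close>

lemma comb_equiv_face:
  assumes f: "face_iso f P Q" and F: "F face_of P"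
  shows "comb_equiv F (f F)"
proof -
  have fF: "f F face_of Q" by (rule face_iso_face[OF f F])
  have "face_iso f F (f F)"
    unfolding face_iso_def
  proof (intro conjI allI impI)
    show "bij_betw f {G. G face_of F} {G. G face_of f F}"
      unfolding bij_betw_def
    proof
      show "inj_on f {G. G face_of F}"
        using face_iso_eq[OF f] face_of_trans[OF _ F] by (intro inj_onI) blast
      show "f ` {G. G face_of F} = {G. G face_of f F}"
      proof (intro equalityI subsetI)
        fix G assume "G \<in> f ` {G. G face_of F}"
        then obtain H where H: "G = f H" "H face_of P" "H \<subseteq> F"
          using face_of_face[OF F] by auto
        then show "G \<in> {G. G face_of f F}"
          using face_of_face[OF fF] face_iso_face[OF f H(2)] face_iso_subset[OF f H(2) F] by simp
      next
        fix G assume "G \<in> {G. G face_of f F}"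
        then have G: "G face_of Q" "G \<subseteq> f F" using face_of_face[OF fF] by auto
        then obtain H where H: "H face_of P" "f H = G" using face_iso_surj[OF f] by blast
        then have "H face_of F" using G face_iso_subset[OF f H(1) F] face_of_face[OF F] by auto
        then show "G \<in> f ` {G. G face_of F}" using H by auto
      qed
    qed
  next
    fix G G' assume "G face_of F" "G' face_of F"
    then show "f G \<subseteq> f G' \<longleftrightarrow> G \<subseteq> G'"
      using face_iso_subset[OF f] face_of_trans[OF _ F] by blast
  qed
  then show ?thesis unfolding comb_equiv_face_iso by blast
qed

section \<open>Dimension and facets as notions of the face poset\<close>

definition maxface :: "'a::real_vector set \<Rightarrow> 'a set \<Rightarrow> bool"
  where "maxface P M \<longleftrightarrow> M face_of P \<and> M \<noteq> {} \<and> M \<noteq> P \<and>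
    (\<forall>M'. M' face_of P \<longrightarrow> M \<subseteq> M' \<longrightarrow> M' \<noteq> P \<longrightarrow> M' = M)"

text \<open>The chain starts at a nonempty face and has \<open>k\<close> strict steps, so
  \<open>k\<close> is a lower bound for the dimension of a polytope that every isomorphism
  preserves.\<close>

definition face_chain :: "'a::real_vector set \<Rightarrow> nat \<Rightarrow> bool"
  where "face_chain P k \<longleftrightarrow> (\<exists>g::nat \<Rightarrow> 'a set. (\<forall>i\<le>k. g i face_of P \<and> g i \<noteq> {}) \<and> (\<forall>i<k. g i \<subset> g (Suc i)))"

text \<open>Dimension grows strictly along faces, which leaves no room between a facet and the
  polytope.\<close>

lemma facets_maxface:
  assumes "polytope P" "M \<in> facets P"
  shows "maxface P M"
proof -
  have M: "M face_of P" "M \<noteq> {}" "Suc (pdim M) = pdim P" using assms(2) by (auto simp: facets_def)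
  have P: "P face_of P" using assms(1) by (simp add: face_of_refl polytope_imp_convex)
  have "M' = M" if "M' face_of P" "M \<subseteq> M'" "M' \<noteq> P" for M'
  proof (rule ccontr)
    assume "M' \<noteq> M"
    then have "pdim M < pdim M'" using pdim_strict_mono[OF assms(1) M(1) that(1)] that M by blast
    moreover have "pdim M' < pdim P"
      using pdim_strict_mono[OF assms(1) that(1) P] that M face_of_imp_subset[OF that(1)] by blast
    ultimately show False using M by simp
  qed
  then show ?thesis using M unfolding maxface_def by auto
qed

lemma face_chain_pdim:
  assumes "polytope P" "face_chain P k"
  shows "k \<le> pdim P"
proof -
  obtain g where g: "\<And>i. i \<le> k \<Longrightarrow> g i face_of P \<and> g i \<noteq> {}" "\<And>i. i < k \<Longrightarrow> g i \<subset> g (Suc i)"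
    using assms(2) unfolding face_chain_def by blast
  have "i \<le> k \<Longrightarrow> i \<le> pdim (g i)" for i
  proof (induction i)
    case (Suc i)
    then have "pdim (g i) < pdim (g (Suc i))"
      using pdim_strict_mono[OF assms(1)] g[of i] g(1)[of "Suc i"] by simp
    then show ?case using Suc by simp
  qed simp
  then have "k \<le> pdim (g k)" by simp
  also have "\<dots> \<le> pdim P" using g(1)[of k] by (intro pdim_mono assms face_of_imp_subset) auto
  finally show ?thesis .
qed

lemma face_chain_iso:
  assumes f: "face_iso f P Q" and "face_chain P k"
  shows "face_chain Q k"
proof -
  obtain g where g: "\<And>i. i \<le> k \<Longrightarrow> g i face_of P \<and> g i \<noteq> {}" "\<And>i. i < k \<Longrightarrow> g i \<subset> g (Suc i)"
    using assms(2) unfolding face_chain_def by blast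
  have "f (g i) \<subset> f (g (Suc i))" if "i < k" for i
    using face_iso_subset[OF f] g(1)[of i] g(1)[of "Suc i"] g(2)[OF that] that
    by (simp add: psubset_eq face_iso_eq[OF f])
  then show ?thesis
    unfolding face_chain_def using g(1)
    by (intro exI[of _ "\<lambda>i. f (g i)"]) (simp add: face_iso_face[OF f] face_iso_empty_iff[OF f])
qed

lemma maxface_iso:
  assumes f: "face_iso f P Q" and cv: "convex P" "convex Q" and F: "F face_of P"
  shows "maxface Q (f F) \<longleftrightarrow> maxface P F"
proof -
  have top: "f P = Q" by (rule face_iso_top[OF f cv])
  have P: "P face_of P" using cv by (simp add: face_of_refl)
  have "(\<forall>M'. M' face_of Q \<longrightarrow> f F \<subseteq> M' \<longrightarrow> M' \<noteq> Q \<longrightarrow> M' = f F) \<longleftrightarrow>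
    (\<forall>M'. M' face_of P \<longrightarrow> f F \<subseteq> f M' \<longrightarrow> f M' \<noteq> Q \<longrightarrow> f M' = f F)"
    using face_iso_surj[OF f] face_iso_face[OF f] by metis
  also have "\<dots> \<longleftrightarrow> (\<forall>M'. M' face_of P \<longrightarrow> F \<subseteq> M' \<longrightarrow> M' \<noteq> P \<longrightarrow> M' = F)"
    using face_iso_subset[OF f F] face_iso_eq[OF f _ F] face_iso_eq[OF f _ P] top by auto
  finally show ?thesis
    unfolding maxface_def using face_iso_face[OF f F] F face_iso_empty_iff[OF f F]
      face_iso_eq[OF f F P] top by auto
qed

text \<open>
  Simple polytopes whose dimension and facets can be read off from the face poset. All of them are
  of this kind, but the theory of polyhedra is only available in Euclidean spaces.
\<close>

definition graded_simple :: "'a::real_vector set \<Rightarrow> bool"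
  where "graded_simple P \<longleftrightarrow> simple_polytope P \<and> (\<forall>M. maxface P M \<longrightarrow> M \<in> facets P) \<and>
    face_chain P (pdim P)"

lemma graded_simple_facets: "graded_simple P \<Longrightarrow> facets P = {M. maxface P M}"
  unfolding graded_simple_def simple_polytope_def using facets_maxface by blast

text \<open>Recognises vertices inside the poset: an extreme point of a minimal nonempty face is
  itself a face below it.\<close>

lemma minimal_face_singleton:
  assumes "polytope P" "V face_of P" "V \<noteq> {}"
    and "\<And>U. U face_of P \<Longrightarrow> U \<subseteq> V \<Longrightarrow> U \<noteq> {} \<Longrightarrow> U = V"
  obtains v where "V = {v}" "v extreme_point_of P"
proof -
  obtain v where v: "v extreme_point_of V"
    using polytope_extreme_point_exists[OF polytope_face_of[OF assms(1,2)] assms(3)] .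
  then have "v extreme_point_of P" "v \<in> V" using extreme_point_of_face[OF assms(2)] by auto
  moreover from this have "V = {v}" using assms(4)[of "{v}"] by (simp add: face_of_singleton)
  ultimately show thesis using that by blast
qed

text \<open>At a vertex of \<open>R\<close> the facets, \<open>pdim R\<close> many, are among the
  maximal faces, whose number is transported from \<open>P\<close> and equals \<open>pdim P\<close>.
  The transported chain gives the reverse inequality of dimensions. Equality then turns every
  maximal face at the vertex into a facet.\<close>

lemma graded_simple_iso:
  assumes f: "face_iso f P R" and P: "graded_simple P" and R: "simple_polytope R"
  shows "pdim R = pdim P" "graded_simple R" "facets R = f ` facets P"
proof -
  have pol: "polytope P" "polytope R" "P \<noteq> {}" "R \<noteq> {}"
    using P R by (auto simp: simple_polytope_def graded_simple_def)
  have cv: "convex P" "convex R" using pol polytope_imp_convex by auto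
  have maxR: "{M. maxface R M} = f ` {M. maxface P M}"
  proof (intro equalityI subsetI)
    fix M assume M: "M \<in> {M. maxface R M}"
    then obtain F where "F face_of P" "f F = M"
      using face_iso_surj[OF f, of M] by (auto simp: maxface_def)
    then show "M \<in> f ` {M. maxface P M}" using maxface_iso[OF f cv] M by blast
  next
    fix M assume "M \<in> f ` {M. maxface P M}"
    then show "M \<in> {M. maxface R M}" using maxface_iso[OF f cv] by (auto simp: maxface_def)
  qed
  have chain: "face_chain R (pdim P)"
    using face_chain_iso[OF f] P by (auto simp: graded_simple_def)
  have key: "pdim R = pdim P \<and> {M \<in> facets R. x \<in> M} = {M. maxface R M \<and> x \<in> M}"
    if x: "x extreme_point_of R" for x
  proof -
    have X: "{x} face_of R" using x by (simp add: face_of_singleton)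
    obtain V where V: "V face_of P" "f V = {x}" using face_iso_surj[OF f X] by blast
    have V0: "V \<noteq> {}" using V face_iso_empty[OF f] by auto
    have "U = V" if "U face_of P" "U \<subseteq> V" "U \<noteq> {}" for U
    proof -
      have "f U \<subseteq> {x}" "f U \<noteq> {}"
        using that face_iso_subset[OF f that(1) V(1)] face_iso_empty_iff[OF f that(1)] V by auto
      then have "f U = f V" using V by auto
      then show ?thesis using face_iso_eq[OF f that(1) V(1)] by simp
    qed
    then obtain v where v: "V = {v}" "v extreme_point_of P"
      using minimal_face_singleton[OF pol(1) V(1) V0] by metis
    have mem: "x \<in> f F \<longleftrightarrow> v \<in> F" if "F face_of P" for F
      using face_iso_subset[OF f V(1) that] V(2) v(1) by simp
    have "{M. maxface R M \<and> x \<in> M} = {M \<in> {M. maxface R M}. x \<in> M}" by simp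
    also have "\<dots> = f ` {F \<in> facets P. v \<in> F}"
      unfolding maxR graded_simple_facets[OF P] using mem by (auto simp: maxface_def)
    finally have eq: "{M. maxface R M \<and> x \<in> M} = f ` {F \<in> facets P. v \<in> F}" .
    have fin: "finite {F \<in> facets P. v \<in> F}"
      using P v by (intro finite_facets_at_vertex) (auto simp: graded_simple_def)
    have "inj_on f {F \<in> facets P. v \<in> F}"
      using face_iso_eq[OF f] by (auto simp: inj_on_def facets_def)
    then have card: "card {M. maxface R M \<and> x \<in> M} = pdim P"
      unfolding eq using P v by (simp add: card_image graded_simple_def simple_polytope_def)
    have finR: "finite {M. maxface R M \<and> x \<in> M}" unfolding eq using fin by simp
    have sub: "{M \<in> facets R. x \<in> M} \<subseteq> {M. maxface R M \<and> x \<in> M}"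
      using facets_maxface[OF pol(2)] by blast
    have cR: "card {M \<in> facets R. x \<in> M} = pdim R" using R x by (auto simp: simple_polytope_def)
    have "pdim R \<le> pdim P" using card_mono[OF finR sub] card cR by simp
    then have "pdim R = pdim P" using face_chain_pdim[OF pol(2) chain] by simp
    then show ?thesis using card_subset_eq[OF finR sub] card cR by simp
  qed
  show 1: "pdim R = pdim P"
    using key polytope_extreme_point_exists[OF pol(2,4)] by metis
  \<comment> \<open>Every nonempty face contains a vertex, so the vertexwise statement
    \<open>key\<close> reaches all maximal faces.\<close>
  have "M \<in> facets R" if "maxface R M" for M
  proof -
    have M: "M face_of R" "M \<noteq> {}" using that by (auto simp: maxface_def)
    obtain x where "x extreme_point_of M"
      using polytope_extreme_point_exists[OF polytope_face_of[OF pol(2) M(1)] M(2)] .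
    then have "x extreme_point_of R" "x \<in> M" using extreme_point_of_face[OF M(1)] by auto
    then show ?thesis using key that by blast
  qed
  then show 2: "graded_simple R" unfolding graded_simple_def 1 using R chain by auto
  show "facets R = f ` facets P"
    unfolding graded_simple_facets[OF P] graded_simple_facets[OF 2] maxR ..
qed

text \<open>If the first factor of the face is proper, filling up the second one gives a larger face
  that is still proper, so by maximality the second factor was full already.\<close>

lemma maxface_Times:
  assumes cv: "convex P" "convex Q" and C: "maxface (P \<times> Q) C"
  shows "(\<exists>F. maxface P F \<and> C = F \<times> Q) \<or> (\<exists>G. maxface Q G \<and> C = P \<times> G)"
proof -
  have C': "C face_of P \<times> Q" "C \<noteq> {}" "C \<noteq> P \<times> Q"
    and max: "\<And>M. M face_of P \<times> Q \<Longrightarrow> C \<subseteq> M \<Longrightarrow> M \<noteq> P \<times> Q \<Longrightarrow> M = C"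
    using C unfolding maxface_def by auto
  obtain F G where FG: "F face_of P" "G face_of Q" "C = F \<times> G" "F \<noteq> {}" "G \<noteq> {}"
    using face_of_Times_cases[OF C'(1) cv] C'(2) by (metis image_is_empty)
  have sub: "F \<subseteq> P" "G \<subseteq> Q" using FG face_of_imp_subset by auto
  have ne: "P \<noteq> {}" "Q \<noteq> {}" using FG sub by auto
  show ?thesis
  proof (cases "F = P")
    case False
    have "F \<times> Q = C"
      using FG sub False by (intro max) (auto simp: face_of_Times face_of_refl cv times_eq_iff)
    moreover have "maxface P F" unfolding maxface_def
    proof (intro conjI allI impI)
      fix M assume M: "M face_of P" "F \<subseteq> M" "M \<noteq> P"
      have "M \<times> Q = C"
        using M FG sub by (intro max) (auto simp: face_of_Times face_of_refl cv times_eq_iff)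
      then show "M = F" using \<open>F \<times> Q = C\<close> ne FG by (metis times_eq_iff)
    qed (use FG False in auto)
    ultimately show ?thesis by blast
  next
    case True
    then have GQ: "G \<noteq> Q" using C' FG by auto
    have "maxface Q G" unfolding maxface_def
    proof (intro conjI allI impI)
      fix M assume M: "M face_of Q" "G \<subseteq> M" "M \<noteq> Q"
      have "P \<times> M = C"
        using M FG sub True by (intro max) (auto simp: face_of_Times face_of_refl cv times_eq_iff)
      then show "M = G" using True ne FG by (metis times_eq_iff)
    qed (use FG GQ in auto)
    then show ?thesis using True FG by blast
  qed
qed

lemma face_chain_Times:
  assumes "convex P" "convex Q" "face_chain P j" "face_chain Q k"
  shows "face_chain (P \<times> Q) (j + k)"
proof -
  obtain g where g: "\<And>i. i \<le> j \<Longrightarrow> g i face_of P \<and> g i \<noteq> {}" "\<And>i. i < j \<Longrightarrow> g i \<subset> g (Suc i)"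
    using assms(3) unfolding face_chain_def by blast
  obtain h where h: "\<And>i. i \<le> k \<Longrightarrow> h i face_of Q \<and> h i \<noteq> {}" "\<And>i. i < k \<Longrightarrow> h i \<subset> h (Suc i)"
    using assms(4) unfolding face_chain_def by blast
  \<comment> \<open>First a climb in \<open>P\<close> above \<open>h 0\<close>, then a climb in
    \<open>Q\<close> above \<open>g j\<close>; truncated subtraction puts both phases into one
    formula.\<close>
  define c where "c i = g (min i j) \<times> h (i - j)" for i
  have "c i face_of P \<times> Q" "c i \<noteq> {}" if "i \<le> j + k" for i
    using g(1)[of "min i j"] h(1)[of "i - j"] that by (auto simp: c_def face_of_Times)
  moreover have "c i \<subset> c (Suc i)" if "i < j + k" for i
  proof (cases "i < j")
    case True
    then have "c i = g i \<times> h 0" "c (Suc i) = g (Suc i) \<times> h 0" by (auto simp: c_def)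
    then show ?thesis using g(2)[OF True] h(1)[of 0] by (auto simp: psubset_eq times_eq_iff)
  next
    case False
    then have "c i = g j \<times> h (i - j)" "c (Suc i) = g j \<times> h (Suc (i - j))"
      by (auto simp: c_def Suc_diff_le)
    moreover have "h (i - j) \<subset> h (Suc (i - j))" using h(2)[of "i - j"] that False by linarith
    ultimately show ?thesis using g(1)[of j] by (auto simp: psubset_eq times_eq_iff)
  qed
  ultimately show ?thesis unfolding face_chain_def by blast
qed

lemma graded_simple_Times:
  assumes P: "graded_simple P" and Q: "graded_simple Q"
  shows "graded_simple (P \<times> Q)"
proof -
  have pq: "polytope P" "polytope Q" "P \<noteq> {}" "Q \<noteq> {}"
    using assms by (auto simp: simple_polytope_def graded_simple_def)
  have cv: "convex P" "convex Q" using pq polytope_imp_convex by auto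
  have dim: "pdim (P \<times> Q) = pdim P + pdim Q"
    by (rule pdim_Times_subset[OF pq(1,2) order_refl order_refl pq(3,4)])
  show ?thesis
    unfolding graded_simple_def dim
  proof (intro conjI allI impI)
    show "simple_polytope (P \<times> Q)"
      using assms by (simp add: simple_polytope_Times graded_simple_def)
    show "face_chain (P \<times> Q) (pdim P + pdim Q)"
      using assms by (intro face_chain_Times cv) (simp_all add: graded_simple_def)
    fix C assume "maxface (P \<times> Q) C"
    then show "C \<in> facets (P \<times> Q)"
      using maxface_Times[OF cv, of C] graded_simple_facets[OF P] graded_simple_facets[OF Q]
      unfolding facets_Times[OF pq] by blast
  qed
qed


section \<open>Face posets from tight constraints\<close>

text \<open>
  \<open>N x\<close> plays the role of the set of constraints of a system of linear inequalities with solution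
  set \<open>P\<close> that are tight at \<open>x\<close>.
\<close>

definition tight_system :: "'a::real_vector set \<Rightarrow> ('a \<Rightarrow> 'i set) \<Rightarrow> bool"
  where "tight_system P N \<longleftrightarrow> convex P \<and> (\<forall>x\<in>P. finite (N x)) \<and>
    (\<forall>a\<in>P. \<forall>b\<in>P. \<forall>x\<in>open_segment a b. N x = N a \<inter> N b) \<and>
    (\<forall>x\<in>P. \<forall>y\<in>P. x \<noteq> y \<longrightarrow> N x \<subseteq> N y \<longrightarrow> (\<exists>z\<in>P. x \<in> open_segment y z))"

definition tight_face :: "'a::real_vector set \<Rightarrow> ('a \<Rightarrow> 'i set) \<Rightarrow> 'i set \<Rightarrow> 'a set"
  where "tight_face P N J = {y \<in> P. J \<subseteq> N y}"

lemma tight_systemD: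
  assumes "tight_system P N"
  shows "convex P" "x \<in> P \<Longrightarrow> finite (N x)"
    and "a \<in> P \<Longrightarrow> b \<in> P \<Longrightarrow> x \<in> open_segment a b \<Longrightarrow> N x = N a \<inter> N b"
    and "x \<in> P \<Longrightarrow> y \<in> P \<Longrightarrow> x \<noteq> y \<Longrightarrow> N x \<subseteq> N y \<Longrightarrow> \<exists>z\<in>P. x \<in> open_segment y z"
  using assms unfolding tight_system_def by simp_all

text \<open>Inside an open segment exactly the constraints tight at both ends are tight. This yields
  convexity in one direction and the face property in the other.\<close>

lemma tight_face_face_of:
  assumes "tight_system P N"
  shows "tight_face P N J face_of P"
proof -
  have N: "N x = N a \<inter> N b" if "a \<in> P" "b \<in> P" "x \<in> open_segment a b" for a b x
    using tight_systemD(3)[OF assms] that by blast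
  have cv: "convex P" using assms by (simp add: tight_system_def)
  have "convex (tight_face P N J)"
    unfolding convex_contains_open_segment
  proof (intro ballI subsetI)
    fix a b x assume ab: "a \<in> tight_face P N J" "b \<in> tight_face P N J" and x: "x \<in> open_segment a b"
    then have "x \<in> P" using cv by (auto simp: convex_contains_open_segment tight_face_def)
    then show "x \<in> tight_face P N J" using ab N[OF _ _ x] by (auto simp: tight_face_def)
  qed
  then show ?thesis
    unfolding face_of_def using N by (auto simp: tight_face_def)
qed

text \<open>A point \<open>x\<close> of \<open>F\<close> with fewest tight constraints behaves like
  a relative interior point: its midpoint with any \<open>y\<close> in \<open>F\<close> cannot lose
  a constraint, so \<open>N x \<subseteq> N y\<close>. Conversely, from a \<open>y\<close> with
  \<open>N x \<subseteq> N y\<close> the segment can be prolonged beyond \<open>x\<close> inside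
  \<open>P\<close>, and the face property at \<open>x\<close> gives \<open>y\<close>.\<close>

lemma face_of_tight_face:
  assumes ts: "tight_system P N" and F: "F face_of P" "F \<noteq> {}"
  obtains x where "x \<in> F" "F = tight_face P N (N x)"
proof -
  have FP: "F \<subseteq> P" using F face_of_imp_subset by blast
  obtain x where x: "x \<in> F" and min: "\<And>y. y \<in> F \<Longrightarrow> card (N x) \<le> card (N y)"
    using ex_has_least_nat[of "\<lambda>x. x \<in> F" _ "\<lambda>x. card (N x)"] F(2) by blast
  have "y \<in> tight_face P N (N x)" if y: "y \<in> F" for y
  proof (cases "y = x")
    case True
    then show ?thesis using x FP by (auto simp: tight_face_def)
  next
    case False
    let ?m = "midpoint x y"
    have m: "?m \<in> open_segment x y" using False by simp
    have "convex F" using F face_of_imp_convex by blast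
    then have "open_segment x y \<subseteq> F" using x y by (simp add: convex_contains_open_segment)
    then have "?m \<in> F" using m by (rule subsetD)
    moreover have "N ?m = N x \<inter> N y"
    proof -
      have "x \<in> P" "y \<in> P" using x y FP by auto
      then show ?thesis using tight_systemD(3)[OF ts] m by blast
    qed
    moreover have "finite (N x)" using ts x FP by (auto simp: tight_system_def)
    ultimately have "N ?m = N x" using min by (metis card_seteq inf_le1)
    then show ?thesis using \<open>N ?m = N x \<inter> N y\<close> y FP by (auto simp: tight_face_def)
  qed
  moreover have "y \<in> F" if y: "y \<in> tight_face P N (N x)" for y
  proof (cases "y = x")
    case False
    then obtain z where "z \<in> P" "x \<in> open_segment y z"
      using tight_systemD(4)[OF ts, of x y] y x FP by (auto simp: tight_face_def)
    then show ?thesis using face_ofD[OF F(1)] x y by (auto simp: tight_face_def)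
  qed (use x in simp)
  ultimately show thesis using that[OF x] by blast
qed

lemma tight_face_subset_iff:
  assumes "x \<in> P"
  shows "tight_face P N (N x) \<subseteq> tight_face P N J \<longleftrightarrow> J \<subseteq> N x"
  using assms by (auto simp: tight_face_def)

text \<open>Nonempty faces correspond to the sets of the form \<open>N x\<close> with inclusion
  reversed, so it suffices to match these families of sets as ordered sets.\<close>

lemma comb_equiv_tight_systems:
  assumes P: "tight_system P N" and Q: "tight_system Q M"
    and h: "bij_betw h (N ` P) (M ` Q)"
    and mono: "\<And>x y. x \<in> P \<Longrightarrow> y \<in> P \<Longrightarrow> h (N x) \<subseteq> h (N y) \<longleftrightarrow> N x \<subseteq> N y"
  shows "comb_equiv P Q"
proof -
  \<comment> \<open>The intersection over the points of a face recovers its generic tight set. The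
    empty face has no such set and is treated apart.\<close>
  define f where "f F = (if F = {} then {} else tight_face Q M (h (\<Inter>x\<in>F. N x)))" for F
  have f: "f (tight_face P N (N x)) = tight_face Q M (h (N x))" if "x \<in> P" for x
  proof -
    have x: "x \<in> tight_face P N (N x)" using that by (simp add: tight_face_def)
    then have "(\<Inter>y\<in>tight_face P N (N x). N y) = N x" by (auto simp: tight_face_def)
    then show ?thesis using x by (auto simp: f_def)
  qed
  have hx: "\<exists>y\<in>Q. h (N x) = M y" if "x \<in> P" for x
    using bij_betwE[OF h] that by (auto simp: image_iff)
  have ne: "f F \<noteq> {}" if F: "F face_of P" "F \<noteq> {}" for F
  proof -
    obtain x where x: "x \<in> F" "F = tight_face P N (N x)" using face_of_tight_face[OF P F] .
    then have xP: "x \<in> P" using F face_of_imp_subset by blast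
    have "f F = tight_face Q M (h (N x))" using f[OF xP] x(2) by simp
    then show ?thesis using hx[OF xP] by (auto simp: tight_face_def)
  qed
  have sub: "f F \<subseteq> f F' \<longleftrightarrow> F \<subseteq> F'" if FF: "F face_of P" "F' face_of P" for F F'
  proof (cases "F = {} \<or> F' = {}")
    case True
    then show ?thesis using ne FF by (auto simp: f_def)
  next
    case False
    from False have ne: "F \<noteq> {}" "F' \<noteq> {}" by auto
    obtain x where x: "x \<in> F" "F = tight_face P N (N x)"
      using face_of_tight_face[OF P FF(1) ne(1)] .
    obtain y where y: "y \<in> F'" "F' = tight_face P N (N y)"
      using face_of_tight_face[OF P FF(2) ne(2)] .
    have xy: "x \<in> P" "y \<in> P" using x(1) y(1) FF face_of_imp_subset by blast+
    obtain u where u: "u \<in> Q" "h (N x) = M u" using hx xy by blast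
    have "f F \<subseteq> f F' \<longleftrightarrow> h (N y) \<subseteq> h (N x)"
      using f[OF xy(1)] f[OF xy(2)] x(2)[symmetric] y(2)[symmetric] tight_face_subset_iff[OF u(1)]
      by (simp add: u(2))
    also have "\<dots> \<longleftrightarrow> F \<subseteq> F'"
      unfolding x(2) y(2) mono[OF xy(2,1)] tight_face_subset_iff[OF xy(1)] ..
    finally show ?thesis .
  qed
  have "bij_betw f {F. F face_of P} {G. G face_of Q}"
    unfolding bij_betw_def
  proof
    show "inj_on f {F. F face_of P}"
      using sub by (intro inj_onI) (metis mem_Collect_eq order_refl subset_antisym)
    show "f ` {F. F face_of P} = {G. G face_of Q}"
    proof (intro equalityI subsetI)
      fix G assume "G \<in> f ` {F. F face_of P}"
      then show "G \<in> {G. G face_of Q}"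
        using tight_face_face_of[OF Q] by (auto simp: f_def)
    next
      fix G assume G: "G \<in> {G. G face_of Q}"
      show "G \<in> f ` {F. F face_of P}"
      proof (cases "G = {}")
        case True
        then show ?thesis by (intro image_eqI[of _ _ "{}"]) (auto simp: f_def)
      next
        case False
        obtain u where u: "u \<in> G" "G = tight_face Q M (M u)"
          using face_of_tight_face[OF Q _ False] G by blast
        have "u \<in> Q" using u G face_of_imp_subset by blast
        then have "M u \<in> h ` N ` P" using bij_betw_imp_surj_on[OF h] by blast
        then obtain x where x: "x \<in> P" "h (N x) = M u" by auto
        then have "f (tight_face P N (N x)) = G" using f u by simp
        then show ?thesis using tight_face_face_of[OF P] by blast
      qed
    qed
  qed
  then show ?thesis unfolding comb_equiv_def using sub by blast
qed

text \<open>A version of \<open>comb_equiv_linear_image\<close> for maps that are injective only on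
  \<open>P\<close>, such as addition of vectors with disjoint supports. Faces are governed by open
  segments, and \<open>f\<close> preserves and reflects these between points of
  \<open>P\<close>.\<close>

lemma comb_equiv_linear_image_on:
  assumes f: "linear f" "inj_on f P" and cv: "convex P"
  shows "comb_equiv P (f ` P)"
proof -
  have seg: "f x \<in> open_segment (f a) (f b) \<longleftrightarrow> x \<in> open_segment a b"
    if "a \<in> P" "b \<in> P" "x \<in> P" for a b x
  proof -
    have "f x = (1 - u) *\<^sub>R f a + u *\<^sub>R f b \<longleftrightarrow> x = (1 - u) *\<^sub>R a + u *\<^sub>R b" if "0 < u" "u < 1" for u
    proof -
      have "(1 - u) *\<^sub>R a + u *\<^sub>R b \<in> P" using cv \<open>a \<in> P\<close> \<open>b \<in> P\<close> that by (intro convexD) auto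
      then have "f x = f ((1 - u) *\<^sub>R a + u *\<^sub>R b) \<longleftrightarrow> x = (1 - u) *\<^sub>R a + u *\<^sub>R b"
        using inj_onD[OF f(2)] \<open>x \<in> P\<close> by metis
      then show ?thesis by (simp add: linear_add[OF f(1)] linear_scale[OF f(1)])
    qed
    moreover have "f a = f b \<longleftrightarrow> a = b" using inj_onD[OF f(2)] that by metis
    ultimately show ?thesis unfolding in_segment by metis
  qed
  have cvi: "convex F" if "convex (f ` F)" "F \<subseteq> P" for F
    unfolding convex_contains_open_segment
  proof (intro ballI subsetI)
    fix a b x assume *: "a \<in> F" "b \<in> F" "x \<in> open_segment a b"
    then have "x \<in> P" using cv that(2) by (auto simp: convex_contains_open_segment)
    have "open_segment (f a) (f b) \<subseteq> f ` F"
      using that(1) *(1,2) by (simp add: convex_contains_open_segment)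
    moreover have "f x \<in> open_segment (f a) (f b)"
      using seg[OF _ _ \<open>x \<in> P\<close>] * that(2) by blast
    ultimately have "f x \<in> f ` F" by (rule subsetD)
    then show "x \<in> F" using inj_onD[OF f(2)] \<open>x \<in> P\<close> that(2) by blast
  qed
  have mem: "f x \<in> f ` F \<longleftrightarrow> x \<in> F" if "x \<in> P" "F \<subseteq> P" for x F
    using inj_onD[OF f(2)] that by blast
  have face: "f ` F face_of f ` P \<longleftrightarrow> F face_of P" if F: "F \<subseteq> P" for F
  proof -
    have "convex (f ` F) \<longleftrightarrow> convex F" using cvi[OF _ F] convex_linear_image[OF f(1)] by blast
    moreover have "(\<forall>a\<in>f ` P. \<forall>b\<in>f ` P. \<forall>x\<in>f ` F. x \<in> open_segment a b \<longrightarrow> a \<in> f ` F \<and> b \<in> f ` F)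
      \<longleftrightarrow> (\<forall>a\<in>P. \<forall>b\<in>P. \<forall>x\<in>F. x \<in> open_segment a b \<longrightarrow> a \<in> F \<and> b \<in> F)"
    proof -
      have "(f x \<in> open_segment (f a) (f b) \<longrightarrow> f a \<in> f ` F \<and> f b \<in> f ` F) \<longleftrightarrow>
        (x \<in> open_segment a b \<longrightarrow> a \<in> F \<and> b \<in> F)" if "a \<in> P" "b \<in> P" "x \<in> F" for a b x
        using seg[OF that(1,2)] mem[OF _ F] that F by (metis (no_types) subsetD)
      then show ?thesis by (simp only: Ball_image_comp o_def cong: ball_cong)
    qed
    ultimately show ?thesis unfolding face_of_def using F by (auto simp: image_mono)
  qed
  have "bij_betw ((`) f) {F. F face_of P} {G. G face_of f ` P}"
    unfolding bij_betw_def
  proof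
    show "inj_on ((`) f) {F. F face_of P}"
    proof (rule inj_onI)
      fix F G assume "F \<in> {F. F face_of P}" "G \<in> {F. F face_of P}" "f ` F = f ` G"
      then show "F = G"
        using inj_on_image_eq_iff[OF f(2) face_of_imp_subset face_of_imp_subset] by simp
    qed
    show "(`) f ` {F. F face_of P} = {G. G face_of f ` P}"
    proof (intro equalityI subsetI)
      fix G assume "G \<in> {G. G face_of f ` P}"
      then have G: "G face_of f ` P" by simp
      then obtain F where "F \<subseteq> P" "G = f ` F" using face_of_imp_subset[OF G] by (auto simp: subset_image_iff)
      then show "G \<in> (`) f ` {F. F face_of P}" using face G by auto
    next
      fix G assume "G \<in> (`) f ` {F. F face_of P}"
      then obtain F where "F face_of P" "G = f ` F" by auto
      then show "G \<in> {G. G face_of f ` P}" using face[OF face_of_imp_subset] by simp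
    qed
  qed
  moreover have "f ` F \<subseteq> f ` F' \<longleftrightarrow> F \<subseteq> F'" if "F face_of P" "F' face_of P" for F F'
    using mem face_of_imp_subset[OF that(1)] face_of_imp_subset[OF that(2)] by blast
  ultimately show ?thesis unfolding comb_equiv_def by blast
qed


section \<open>Building sets and nested sets\<close>

text \<open>Connected building sets on an arbitrary finite ground set, because restrictions and
  contractions live on \<open>S\<close> and \<open>A - S\<close>.\<close>

locale building_set_on =
  fixes A :: "'i set" and B :: "'i set set"
  assumes finite_ground: "finite A"
    and subset_ground: "S \<in> B \<Longrightarrow> S \<subseteq> A"
    and nonempty: "S \<in> B \<Longrightarrow> S \<noteq> {}"
    and singleton: "i \<in> A \<Longrightarrow> {i} \<in> B"
    and union: "S \<in> B \<Longrightarrow> T \<in> B \<Longrightarrow> S \<inter> T \<noteq> {} \<Longrightarrow> S \<union> T \<in> B"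
    and ground: "A \<in> B"
begin

lemma finite_building_set: "finite B"
  using finite_ground subset_ground by (auto intro: finite_subset[of B "Pow A"])

lemma finite_member: "S \<in> B \<Longrightarrow> finite S"
  using finite_ground subset_ground finite_subset by blast

lemma union_family:
  assumes "T \<in> B" "\<C> \<subseteq> B" "\<And>C. C \<in> \<C> \<Longrightarrow> C \<inter> T \<noteq> {}"
  shows "T \<union> \<Union>\<C> \<in> B"
proof -
  have "finite \<C>" using assms(2) finite_building_set finite_subset by blast
  then show ?thesis using assms(2,3)
  proof (induction \<C> rule: finite_induct)
    case (insert C \<C>)
    have "C \<union> (T \<union> \<Union>\<C>) \<in> B"
    proof (rule union)
      show "T \<union> \<Union>\<C> \<in> B" using insert.IH insert.prems by simp
    qed (use insert.prems in auto)
    moreover have "C \<union> (T \<union> \<Union>\<C>) = T \<union> \<Union>(insert C \<C>)" by auto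
    ultimately show ?case by simp
  qed (use assms in simp)
qed

text \<open>The component is the union of all members through \<open>i\<close> inside
  \<open>S\<close>: they share \<open>i\<close>, so the union is a member, and it absorbs every
  member inside \<open>S\<close> that meets it.\<close>

lemma component_exists:
  assumes "S \<subseteq> A" "i \<in> S"
  obtains C where "C \<in> B" "i \<in> C" "C \<subseteq> S" "\<And>T. T \<in> B \<Longrightarrow> T \<subseteq> S \<Longrightarrow> T \<inter> C \<noteq> {} \<Longrightarrow> T \<subseteq> C"
proof -
  let ?C = "{T \<in> B. i \<in> T \<and> T \<subseteq> S}"
  have i: "{i} \<in> B" using assms singleton by auto
  then have "{i} \<union> \<Union>?C \<in> B" by (intro union_family) auto
  moreover have "{i} \<union> \<Union>?C = \<Union>?C" using i assms(2) by auto
  ultimately have C: "\<Union>?C \<in> B" by simp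
  moreover have "i \<in> \<Union>?C" using i assms(2) by auto
  moreover have "T \<subseteq> \<Union>?C" if "T \<in> B" "T \<subseteq> S" "T \<inter> \<Union>?C \<noteq> {}" for T
  proof -
    have "T \<union> \<Union>?C \<in> B" using that C by (intro union)
    then have "T \<union> \<Union>?C \<in> ?C" using \<open>i \<in> \<Union>?C\<close> that by blast
    then show ?thesis by blast
  qed
  ultimately show thesis using that[of "\<Union>?C"] by blast
qed

end

text \<open>One condition replaces the usual two. Two members that meet have their union in
  \<open>B\<close>, which makes them comparable; two or more pairwise disjoint members cannot have
  their union in \<open>B\<close>. \<open>A\<close> is left out since its constraint is an
  equality.\<close>

definition nested :: "'i set \<Rightarrow> 'i set set \<Rightarrow> 'i set set \<Rightarrow> bool"
  where "nested A B N \<longleftrightarrow> N \<subseteq> B - {A} \<and> (\<forall>\<C>\<subseteq>N. \<C> \<noteq> {} \<longrightarrow> \<Union>\<C> \<in> B \<longrightarrow> \<Union>\<C> \<in> \<C>)"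

lemma nested_subset: "nested A B N \<Longrightarrow> M \<subseteq> N \<Longrightarrow> nested A B M"
  unfolding nested_def by blast

lemma nestedD: "nested A B N \<Longrightarrow> \<C> \<subseteq> N \<Longrightarrow> \<C> \<noteq> {} \<Longrightarrow> \<Union>\<C> \<in> B \<Longrightarrow> \<Union>\<C> \<in> \<C>"
  unfolding nested_def by blast

lemma nested_pair: "nested A B N \<Longrightarrow> S \<in> N \<Longrightarrow> T \<in> N \<Longrightarrow> S \<union> T \<in> B \<Longrightarrow> S \<subseteq> T \<or> T \<subseteq> S"
  using nestedD[of A B N "{S, T}"] by auto

text \<open>In the forest that a nested set forms under inclusion, this is the label of the node
  \<open>R\<close>: the points of \<open>R\<close> in no smaller node.\<close>

definition core :: "'i set set \<Rightarrow> 'i set \<Rightarrow> 'i set"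
  where "core N R = R - \<Union>{C \<in> N. C \<subset> R}"

context building_set_on
begin

lemma nested_empty: "nested A B {}"
  by (auto simp: nested_def)

lemma nested_single: "S \<in> B \<Longrightarrow> S \<noteq> A \<Longrightarrow> nested A B {S}"
  unfolding nested_def by (auto dest!: subset_singletonD)

lemma nested_finite: "nested A B N \<Longrightarrow> finite N"
  unfolding nested_def using finite_building_set by (metis Diff_subset finite_subset)

lemma nested_member: "nested A B N \<Longrightarrow> S \<in> N \<Longrightarrow> S \<in> B \<and> S \<noteq> A"
  unfolding nested_def by blast

lemma minimal_above:
  assumes "nested A B N" "T \<subseteq> A"
  obtains R where "R \<in> insert A N" "T \<subseteq> R" "\<And>C. C \<in> N \<Longrightarrow> T \<subseteq> C \<Longrightarrow> \<not> C \<subset> R"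
proof -
  have "finite {R \<in> insert A N. T \<subseteq> R}" using nested_finite[OF assms(1)] by auto
  moreover have "A \<in> {R \<in> insert A N. T \<subseteq> R}" using assms(2) by simp
  ultimately obtain R where R: "R \<in> {R \<in> insert A N. T \<subseteq> R}"
    "\<forall>C\<in>{R \<in> insert A N. T \<subseteq> R}. C \<subseteq> R \<longrightarrow> R = C"
    using finite_has_minimal2[of "{R \<in> insert A N. T \<subseteq> R}" A] by blast
  show thesis
  proof (rule that[of R])
    fix C assume "C \<in> N" "T \<subseteq> C"
    then show "\<not> C \<subset> R" using R(2) by auto
  qed (use R(1) in auto)
qed

text \<open>
  The members of \<open>N\<close> that meet \<open>T\<close> and lie properly below \<open>R\<close> would cover \<open>T\<close>, hence their
  union would belong to \<open>B\<close> and nestedness would make one of them contain \<open>T\<close>.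
\<close>

lemma core_meets:
  assumes N: "nested A B N" and T: "T \<in> B" "T \<subseteq> R" and min: "\<And>C. C \<in> N \<Longrightarrow> T \<subseteq> C \<Longrightarrow> \<not> C \<subset> R"
  shows "T \<inter> core N R \<noteq> {}"
proof
  assume *: "T \<inter> core N R = {}"
  let ?C = "{C \<in> N. C \<subset> R \<and> C \<inter> T \<noteq> {}}"
  have sub: "T \<subseteq> \<Union>?C"
  proof
    fix i assume "i \<in> T"
    then have "i \<in> \<Union>{C \<in> N. C \<subset> R}" using * T(2) by (auto simp: core_def)
    then show "i \<in> \<Union>?C" using \<open>i \<in> T\<close> by auto
  qed
  then have ne: "?C \<noteq> {}" using nonempty[OF T(1)] by auto
  have "T \<union> \<Union>?C \<in> B"
  proof (rule union_family[OF T(1)])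
    show "?C \<subseteq> B" using nested_member[OF N] by auto
  qed simp
  then have "\<Union>?C \<in> B" using sub by (simp add: Un_absorb1)
  then have "\<Union>?C \<in> ?C" using nestedD[OF N _ ne] by simp
  then show False using min sub by blast
qed

text \<open>If \<open>S\<close> meets \<open>R\<close> without containing it, nestedness puts
  \<open>S\<close> strictly below \<open>R\<close>, and then \<open>S\<close> has been removed from
  the core.\<close>

lemma nested_comparable_core:
  assumes N: "nested A B N" and "S \<in> N" "R \<in> insert A N" "\<not> R \<subseteq> S"
  shows "S \<inter> core N R = {}"
proof (cases "S \<inter> R = {}")
  case False
  have S: "S \<in> B" "S \<subseteq> A" using assms nested_member[OF N] subset_ground by auto
  have "S \<subset> R"
  proof (cases "R = A")
    case False
    then have R: "R \<in> N" "R \<in> B" using assms nested_member[OF N] by auto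
    have "S \<subseteq> R \<or> R \<subseteq> S"
      using nested_pair[OF N assms(2) R(1) union[OF S(1) R(2) \<open>S \<inter> R \<noteq> {}\<close>]] .
    then show ?thesis using assms(4) by blast
  qed (use S assms in blast)
  then show ?thesis using assms(2) unfolding core_def by blast
qed (auto simp: core_def)

text \<open>Every point of \<open>A\<close> lies in the core of some \<open>R\<close> in
  \<open>insert A N\<close>. If there are more points than such sets, one core contains two points
  \<open>i\<close> and \<open>j\<close>, and the component \<open>S\<close> of \<open>j\<close> in
  \<open>R - {i}\<close> is a new set that can be added.\<close>

lemma nested_extend:
  assumes N: "nested A B N" and card: "card N + 1 < card A"
  obtains M where "nested A B M" "N \<subseteq> M" "card M = card N + 1"
proof -
  have "\<exists>R. R \<in> insert A N \<and> i \<in> core N R" if i: "i \<in> A" for i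
  proof -
    obtain R where R: "R \<in> insert A N" "{i} \<subseteq> R" "\<And>C. C \<in> N \<Longrightarrow> {i} \<subseteq> C \<Longrightarrow> \<not> C \<subset> R"
      using minimal_above[OF N, of "{i}"] i by auto
    then show ?thesis using core_meets[OF N singleton[OF i] R(2,3)] by blast
  qed
  then obtain r where r: "\<And>i. i \<in> A \<Longrightarrow> r i \<in> insert A N" "\<And>i. i \<in> A \<Longrightarrow> i \<in> core N (r i)"
    by metis
  have "\<not> inj_on r A"
  proof
    assume "inj_on r A"
    then have "card A = card (r ` A)" by (simp add: card_image)
    also have "\<dots> \<le> card (insert A N)"
      using r(1) nested_finite[OF N] by (intro card_mono) auto
    also have "\<dots> \<le> card N + 1" using nested_finite[OF N] by (simp add: card_insert_if)
    finally show False using card by simp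
  qed
  then obtain i j where ij: "i \<in> A" "j \<in> A" "i \<noteq> j" "r i = r j" by (auto simp: inj_on_def)
  define R where "R = r i"
  have R: "R \<in> insert A N" "i \<in> core N R" "j \<in> core N R" using r ij unfolding R_def by metis+
  then have RB: "R \<in> B" "R \<subseteq> A" using ground nested_member[OF N] subset_ground by auto
  have iR: "i \<in> R" "j \<in> R" using R by (auto simp: core_def)
  obtain S where S: "S \<in> B" "j \<in> S" "S \<subseteq> R - {i}"
    and max: "\<And>T. T \<in> B \<Longrightarrow> T \<subseteq> R - {i} \<Longrightarrow> T \<inter> S \<noteq> {} \<Longrightarrow> T \<subseteq> S"
    using component_exists[of "R - {i}" j] ij iR RB by blast
  have SN: "S \<notin> N"
  proof
    assume "S \<in> N"
    moreover have "S \<subset> R" using S(3) iR by auto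
    ultimately show False using R(3) S(2) unfolding core_def by blast
  qed
  have "nested A B (insert S N)"
    unfolding nested_def
  proof (intro conjI allI impI)
    show "insert S N \<subseteq> B - {A}" using S RB iR N unfolding nested_def by blast
    fix \<C> assume C: "\<C> \<subseteq> insert S N" "\<C> \<noteq> {}" "\<Union>\<C> \<in> B"
    show "\<Union>\<C> \<in> \<C>"
    proof (cases "S \<in> \<C>")
      case False
      then show ?thesis using C by (intro nestedD[OF N]) auto
    next
      case True
      consider C where "C \<in> \<C>" "R \<subseteq> C" | "\<And>C. C \<in> \<C> \<Longrightarrow> \<not> R \<subseteq> C" by blast
      then show ?thesis
      proof cases
        case 1
        then have CS: "S \<subseteq> C" "C \<noteq> S" using S iR by auto
        then have "\<Union>\<C> = \<Union>(\<C> - {S})" using 1 by blast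
        moreover have "\<Union>(\<C> - {S}) \<in> \<C> - {S}"
          using C 1 CS calculation by (intro nestedD[OF N]) auto
        ultimately show ?thesis by simp
      next
        case 2
        have below: "C \<subset> R" if "C \<in> \<C>" "C \<inter> R \<noteq> {}" for C
        proof (cases "C = S")
          case True
          then show ?thesis using S iR by auto
        next
          case False
          then have CN: "C \<in> N" using C that by auto
          then have CB: "C \<in> B" "C \<subseteq> A" using nested_member[OF N] subset_ground by auto
          show ?thesis
          proof (cases "R = A")
            case True
            then show ?thesis using 2 that CB by blast
          next
            case False
            then have "C \<subseteq> R \<or> R \<subseteq> C"
              using R nested_pair[OF N CN _ union[OF CB(1) RB(1) that(2)]] by blast
            then show ?thesis using 2 that by blast
          qed
        qed
        show ?thesis
        proof (cases "\<forall>C\<in>\<C>. C \<inter> R \<noteq> {}")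
          case True
          have "i \<notin> C" if "C \<in> \<C>" for C
          proof (cases "C = S")
            case False
            then have "C \<in> N" using that C by auto
            then show ?thesis using below[OF that] True that R(2) unfolding core_def by blast
          qed (use S in auto)
          then have "\<Union>\<C> \<subseteq> R - {i}" using below True by blast
          then have "\<Union>\<C> \<subseteq> S" using max[OF C(3)] \<open>S \<in> \<C>\<close> S(2) by blast
          then show ?thesis using \<open>S \<in> \<C>\<close> by (metis Union_upper subset_antisym)
        next
          case False
          then obtain C0 where C0: "C0 \<in> \<C>" "C0 \<inter> R = {}" by blast
          \<comment> \<open>Replacing all members inside \<open>R\<close> by \<open>R\<close> itself
            gives a subfamily of \<open>N\<close> with union in \<open>B\<close>. None of its
            members can be that union: \<open>R\<close> misses \<open>C0\<close>, and the others
            miss \<open>R\<close>.\<close>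
          let ?D = "{C \<in> \<C>. C \<inter> R = {}}"
          have "R \<union> \<Union>\<C> \<in> B" using RB C(3) \<open>S \<in> \<C>\<close> S by (intro union) auto
          moreover have "R \<union> \<Union>\<C> = \<Union>(insert R ?D)" using below by blast
          moreover have C0': "C0 \<subseteq> A" "C0 \<noteq> {}"
            using C0 C S nested_member[OF N] subset_ground nonempty by blast+
          moreover have "R \<in> N" using R(1) C0 C0' by blast
          moreover have "insert R ?D \<subseteq> N" using C S iR \<open>R \<in> N\<close> by blast
          ultimately have "\<Union>(insert R ?D) \<in> insert R ?D" by (intro nestedD[OF N]) auto
          then show ?thesis using C0 C0' RB nonempty[OF RB(1)] by auto
        qed
      qed
    qed
  qed
  then show thesis using that[of "insert S N"] SN nested_finite[OF N] by auto
qed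

lemma nested_extend_maximal:
  assumes "nested A B N" "card N < card A"
  obtains M where "nested A B M" "N \<subseteq> M" "card M + 1 = card A"
  using assms
proof (induction "card A - card N" arbitrary: N thesis rule: less_induct)
  case less
  show ?case
  proof (cases "card N + 1 = card A")
    case True
    then show ?thesis using less.prems by blast
  next
    case False
    then obtain M where "nested A B M" "N \<subseteq> M" "card M = card N + 1"
      using nested_extend[OF less.prems(2)] less.prems(3) by auto
    then show ?thesis using less.hyps[of M] less.prems False by force
  qed
qed

end

lemma nested_image:
  assumes \<pi>: "inj_on \<pi> A" and B: "\<And>S. S \<subseteq> A \<Longrightarrow> S \<in> B \<longleftrightarrow> \<pi> ` S \<in> B'"
    and sub: "\<And>S. S \<in> B \<Longrightarrow> S \<subseteq> A" and N: "nested A B N"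
  shows "nested (\<pi> ` A) B' ((`) \<pi> ` N)"
  unfolding nested_def
proof (intro conjI allI impI)
  have NA: "S \<in> B" "S \<noteq> A" "S \<subseteq> A" if "S \<in> N" for S
    using N sub that by (auto simp: nested_def)
  show "(`) \<pi> ` N \<subseteq> B' - {\<pi> ` A}"
    using NA B by (auto simp: inj_on_image_eq_iff[OF \<pi>])
  fix \<C> assume C: "\<C> \<subseteq> (`) \<pi> ` N" "\<C> \<noteq> {}" "\<Union>\<C> \<in> B'"
  then obtain \<D> where D: "\<D> \<subseteq> N" "\<C> = (`) \<pi> ` \<D>" by (auto simp: subset_image_iff)
  have eq: "\<Union>\<C> = \<pi> ` \<Union>\<D>" unfolding D by blast
  have "\<Union>\<D> \<subseteq> A" using D NA by blast
  then have "\<Union>\<D> \<in> B" using B C(3) eq by simp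
  then have "\<Union>\<D> \<in> \<D>" using D C by (intro nestedD[OF N]) auto
  then show "\<Union>\<C> \<in> \<C>" unfolding eq D(2) by blast
qed


section \<open>Base polytopes\<close>

definition mass :: "('i \<Rightarrow>\<^sub>0 real) \<Rightarrow> 'i set \<Rightarrow> real"
  where "mass x S = (\<Sum>i\<in>S. Poly_Mapping.lookup x i)"

lemma lookup_scaleR: "Poly_Mapping.lookup (c *\<^sub>R x) i = c *\<^sub>R Poly_Mapping.lookup x i"
  by (simp add: scaleR_poly_mapping.rep_eq)

lemma mass_add: "mass (x + y) S = mass x S + mass y S"
  by (simp add: mass_def lookup_add sum.distrib)

lemma mass_diff: "mass (x - y) S = mass x S - mass y S"
  by (simp add: mass_def lookup_minus sum_subtractf)

lemma mass_scaleR: "mass (c *\<^sub>R x) S = c * mass x S"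
  by (simp add: mass_def lookup_scaleR sum_distrib_left)

lemma mass_zero: "mass 0 S = 0"
  by (simp add: mass_def)

lemma mass_sum: "mass (sum g I) S = (\<Sum>i\<in>I. mass (g i) S)"
  by (induction I rule: infinite_finite_induct) (auto simp: mass_add mass_zero)

lemma mass_single: "finite S \<Longrightarrow> mass (Poly_Mapping.single i c) S = (if i \<in> S then c else 0)"
  by (simp add: mass_def lookup_single when_def)

lemma mass_Un_Int:
  "finite S \<Longrightarrow> finite T \<Longrightarrow> mass x S + mass x T = mass x (S \<union> T) + mass x (S \<inter> T)"
  unfolding mass_def by (rule sum.union_inter[symmetric])

lemma mass_keys:
  assumes "finite A" "Poly_Mapping.keys x \<subseteq> S" "S \<subseteq> A"
  shows "mass x A = mass x S"
  unfolding mass_def using assms by (intro sum.mono_neutral_right) (auto simp: in_keys_iff)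

lemmas mass_simps = mass_add mass_diff mass_scaleR mass_zero mass_sum

text \<open>For nonnegative weights this is the least value of \<open>mass x S\<close> on the
  Minkowski sum of the simplices on \<open>T\<close> in \<open>B\<close> scaled by
  \<open>m T\<close>: a summand with \<open>T \<subseteq> S\<close> contributes exactly
  \<open>m T\<close>, any other one can contribute 0.\<close>

definition setfun :: "'i set set \<Rightarrow> ('i set \<Rightarrow> real) \<Rightarrow> 'i set \<Rightarrow> real"
  where "setfun B m S = (\<Sum>T | T \<in> B \<and> T \<subseteq> S. m T)"

text \<open>Members inside one of the sets lie in the union, members inside both lie in the
  intersection. The surplus on the right comes from members of the union that lie in neither
  set.\<close>

lemma setfun_supermodular:
  assumes "finite B" "\<And>T. T \<in> B \<Longrightarrow> m T \<ge> 0"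
  shows "setfun B m S + setfun B m T \<le> setfun B m (S \<union> T) + setfun B m (S \<inter> T)"
proof -
  let ?P = "\<lambda>S. {T \<in> B. T \<subseteq> S}"
  have "setfun B m S + setfun B m T = sum m (?P S \<union> ?P T) + sum m (?P S \<inter> ?P T)"
    unfolding setfun_def using assms(1) by (intro sum.union_inter[symmetric]) auto
  moreover have "sum m (?P S \<union> ?P T) \<le> setfun B m (S \<union> T)"
    unfolding setfun_def using assms by (intro sum_mono2) auto
  moreover have "?P S \<inter> ?P T = ?P (S \<inter> T)" by auto
  ultimately show ?thesis by (simp add: setfun_def)
qed

text \<open>Inequalities are imposed for members of \<open>B\<close> only, so that they correspond
  to the facets; \<open>base_all\<close> derives those for all other subsets.\<close>

definition base_polytope :: "'i set \<Rightarrow> 'i set set \<Rightarrow> ('i set \<Rightarrow> real) \<Rightarrow> ('i \<Rightarrow>\<^sub>0 real) set"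
  where "base_polytope A B m = {x. Poly_Mapping.keys x \<subseteq> A \<and> mass x A = setfun B m A \<and>
    (\<forall>S\<in>B. setfun B m S \<le> mass x S)}"

definition tight :: "'i set \<Rightarrow> 'i set set \<Rightarrow> ('i set \<Rightarrow> real) \<Rightarrow> ('i \<Rightarrow>\<^sub>0 real) \<Rightarrow> 'i set set"
  where "tight A B m x = {S \<in> B - {A}. mass x S = setfun B m S}"

lemma tight_Union:
  assumes "finite B" "\<And>T. T \<in> B \<Longrightarrow> m T \<ge> 0" "finite A"
    and ge: "\<And>S. S \<subseteq> A \<Longrightarrow> setfun B m S \<le> mass x S"
    and C: "finite \<C>" "\<C> \<noteq> {}" "\<And>S. S \<in> \<C> \<Longrightarrow> S \<subseteq> A \<and> mass x S = setfun B m S"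
  shows "mass x (\<Union>\<C>) = setfun B m (\<Union>\<C>)"
  using C
proof (induction \<C> rule: finite_ne_induct)
  case (insert S \<C>)
  let ?U = "\<Union>\<C>"
  have S: "S \<subseteq> A" "?U \<subseteq> A" "mass x S = setfun B m S" "mass x ?U = setfun B m ?U"
    using insert by auto
  have fin: "finite S" "finite ?U"
    using finite_subset[OF S(1) assms(3)] finite_subset[OF S(2) assms(3)] by auto
  have "S \<union> ?U \<subseteq> A" "S \<inter> ?U \<subseteq> A" using S by auto
  then have "setfun B m (S \<union> ?U) \<le> mass x (S \<union> ?U)" "setfun B m (S \<inter> ?U) \<le> mass x (S \<inter> ?U)"
    using ge by simp_all
  moreover have "setfun B m S + setfun B m ?U \<le> setfun B m (S \<union> ?U) + setfun B m (S \<inter> ?U)"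
    using assms(1,2) by (rule setfun_supermodular)
  ultimately show ?case
    using S mass_Un_Int[OF fin, of x] by simp
qed simp

locale weighted_building_set = building_set_on A B for A :: "'i set" and B +
  fixes m :: "'i set \<Rightarrow> real"
  assumes weight_pos: "S \<in> B \<Longrightarrow> m S > 0"
begin

abbreviation "P \<equiv> base_polytope A B m"

lemma baseD:
  assumes "x \<in> P"
  shows "Poly_Mapping.keys x \<subseteq> A" "mass x A = setfun B m A" "S \<in> B \<Longrightarrow> setfun B m S \<le> mass x S"
  using assms by (auto simp: base_polytope_def)

text \<open>Members inside \<open>S\<close> lie either inside a component \<open>C\<close> or inside
  \<open>S - C\<close>, so \<open>setfun\<close> splits additively like \<open>mass\<close>; the
  component is a member and the rest is smaller.\<close>

lemma base_all:
  assumes x: "x \<in> P" and S: "S \<subseteq> A"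
  shows "setfun B m S \<le> mass x S"
proof -
  have "finite S" using S finite_ground finite_subset by blast
  then show ?thesis using S
  proof (induction S rule: finite_psubset_induct)
    case (psubset S)
    show ?case
    proof (cases "S = {}")
      case True
      have e: "{T \<in> B. T \<subseteq> S} = {}" using nonempty True by auto
      show ?thesis unfolding setfun_def e by (simp add: True mass_def)
    next
      case False
      then obtain i where i: "i \<in> S" by auto
      obtain C where C: "C \<in> B" "i \<in> C" "C \<subseteq> S" "\<And>T. T \<in> B \<Longrightarrow> T \<subseteq> S \<Longrightarrow> T \<inter> C \<noteq> {} \<Longrightarrow> T \<subseteq> C"
        by (rule component_exists[OF psubset.prems i]) meson
      have "{T \<in> B. T \<subseteq> S} = {T \<in> B. T \<subseteq> C} \<union> {T \<in> B. T \<subseteq> S - C}" using C by blast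
      moreover have "{T \<in> B. T \<subseteq> C} \<inter> {T \<in> B. T \<subseteq> S - C} = {}" using nonempty by blast
      ultimately have "setfun B m S = setfun B m C + setfun B m (S - C)"
        unfolding setfun_def using finite_building_set by (simp add: sum.union_disjoint)
      also have "\<dots> \<le> mass x C + mass x (S - C)"
        using C i psubset.prems by (intro add_mono baseD[OF x] psubset.IH) auto
      also have "\<dots> = mass x S"
        unfolding mass_def using C psubset.hyps
        by (metis add.commute sum.subset_diff)
      finally show ?thesis .
    qed
  qed
qed

text \<open>
  If a union \<open>U\<close> of tight sets belongs to \<open>B\<close> without being one of them, then all of them stay
  tight, but \<open>U\<close> does not, when the weight of \<open>U\<close> is set to zero.
\<close>

lemma nested_tight:
  assumes x: "x \<in> P"
  shows "nested A B (tight A B m x)"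
  unfolding nested_def
proof (intro conjI allI impI)
  show "tight A B m x \<subseteq> B - {A}" by (auto simp: tight_def)
  fix \<C> assume C: "\<C> \<subseteq> tight A B m x" "\<C> \<noteq> {}" "\<Union>\<C> \<in> B"
  show "\<Union>\<C> \<in> \<C>"
  proof (rule ccontr)
    assume U: "\<Union>\<C> \<notin> \<C>"
    define w where "w = m(\<Union>\<C> := 0)"
    have w: "w T \<ge> 0" "w T \<le> m T" if "T \<in> B" for T
      using weight_pos[OF that] by (auto simp: w_def)
    have "setfun B w S \<le> setfun B m S" for S
      unfolding setfun_def using w by (intro sum_mono) auto
    then have ge: "setfun B w S \<le> mass x S" if "S \<subseteq> A" for S
      using base_all[OF x that] by (meson order_trans)
    have "mass x S = setfun B w S" if S: "S \<in> \<C>" for S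
    proof -
      have "\<not> \<Union>\<C> \<subseteq> S" using S U by (metis Union_upper subset_antisym)
      then have "setfun B w S = setfun B m S"
        unfolding setfun_def by (intro sum.cong) (auto simp: w_def)
      then show ?thesis using S C by (auto simp: tight_def)
    qed
    moreover have "finite \<C>"
    proof (rule finite_subset[OF _ finite_building_set])
      show "\<C> \<subseteq> B" using C(1) by (auto simp: tight_def)
    qed
    moreover have "S \<subseteq> A" if "S \<in> \<C>" for S using that C subset_ground by (auto simp: tight_def)
    ultimately have "mass x (\<Union>\<C>) = setfun B w (\<Union>\<C>)"
      using w ge C by (intro tight_Union[of B w A]) (auto simp: finite_building_set finite_ground)
    also have "\<dots> < setfun B m (\<Union>\<C>)"
      unfolding setfun_def
    proof (rule sum_strict_mono_ex1)
      show "\<exists>T\<in>{T \<in> B. T \<subseteq> \<Union>\<C>}. w T < m T"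
        using C(3) weight_pos by (intro bexI[of _ "\<Union>\<C>"]) (auto simp: w_def)
    qed (use finite_building_set w in auto)
    also have "\<dots> \<le> mass x (\<Union>\<C>)" using baseD(3)[OF x C(3)] .
    finally show False by simp
  qed
qed

end

text \<open>The barycentre of the simplex on \<open>D\<close>: a point with positive mass on every
  set that meets \<open>D\<close>.\<close>

definition uniform :: "'i set \<Rightarrow> ('i \<Rightarrow>\<^sub>0 real)"
  where "uniform D = (1 / card D) *\<^sub>R (\<Sum>i\<in>D. Poly_Mapping.single i 1)"

lemma mass_uniform:
  assumes "finite D" "finite S"
  shows "mass (uniform D) S = card (D \<inter> S) / card D"
proof -
  have "(\<Sum>i\<in>D. mass (Poly_Mapping.single i (1::real)) S) = (\<Sum>i\<in>D. if i \<in> S then 1 else 0)"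
    using assms by (simp add: mass_single)
  also have "\<dots> = card (D \<inter> S)" using assms by (simp add: sum.If_cases)
  finally show ?thesis unfolding uniform_def by (simp add: mass_simps)
qed

lemma keys_uniform: "Poly_Mapping.keys (uniform D) \<subseteq> D"
proof -
  have "Poly_Mapping.keys (\<Sum>i\<in>D. Poly_Mapping.single i (1::real)) \<subseteq> D"
    using keys_sum[of "\<lambda>i. Poly_Mapping.single i (1::real)" D] by auto
  then show ?thesis by (auto simp: uniform_def lookup_scaleR in_keys_iff)
qed

context weighted_building_set
begin

text \<open>Each summand \<open>T\<close> spreads its weight over the part of \<open>T\<close> in
  the core of a minimal \<open>R\<close> in \<open>insert A N\<close> containing \<open>T\<close>. A
  summand not inside \<open>S\<close> in \<open>N\<close> has \<open>R\<close> not inside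
  \<open>S\<close>, so its mass avoids \<open>S\<close>, and \<open>S\<close> is tight. A set
  outside \<open>N\<close> receives extra mass from the summand \<open>R\<close> itself. The
  explicit sum also exhibits the point as an element of the Minkowski sum.\<close>

lemma nested_realization:
  assumes N: "nested A B N"
  obtains D where "\<And>T. T \<in> B \<Longrightarrow> D T \<noteq> {} \<and> D T \<subseteq> T"
    "(\<Sum>T\<in>B. m T *\<^sub>R uniform (D T)) \<in> P" "tight A B m (\<Sum>T\<in>B. m T *\<^sub>R uniform (D T)) = N"
proof -
  have "\<exists>R. R \<in> insert A N \<and> T \<subseteq> R \<and> (\<forall>C\<in>N. T \<subseteq> C \<longrightarrow> \<not> C \<subset> R)" if "T \<in> B" for T
    using minimal_above[OF N subset_ground[OF that]] by metis
  then obtain R where R: "\<And>T. T \<in> B \<Longrightarrow> R T \<in> insert A N" "\<And>T. T \<in> B \<Longrightarrow> T \<subseteq> R T"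
    and min: "\<And>T C. T \<in> B \<Longrightarrow> C \<in> N \<Longrightarrow> T \<subseteq> C \<Longrightarrow> \<not> C \<subset> R T" by metis
  define D where "D T = T \<inter> core N (R T)" for T
  have D: "D T \<noteq> {}" "D T \<subseteq> T" if "T \<in> B" for T
    using core_meets[OF N that R(2)[OF that] min[OF that]] by (auto simp: D_def)
  have Dfin: "finite (D T)" if "T \<in> B" for T
    using D(2)[OF that] finite_member[OF that] finite_subset by blast
  define y where "y = (\<Sum>T\<in>B. m T *\<^sub>R uniform (D T))"
  have my: "mass y S = (\<Sum>T\<in>B. m T * (card (D T \<inter> S) / card (D T)))" if "S \<subseteq> A" for S
    unfolding y_def mass_simps
    using that Dfin finite_ground by (intro sum.cong refl) (simp add: mass_uniform finite_subset)
  have pos: "m T * (card (D T \<inter> S) / card (D T)) \<ge> 0" if "T \<in> B" for T S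
    using weight_pos[OF that] by simp
  have in_S: "m T * (card (D T \<inter> S) / card (D T)) = m T" if "T \<in> B" "T \<subseteq> S" for T S
  proof -
    have "D T \<inter> S = D T" using D(2) that by blast
    moreover have "card (D T) \<noteq> 0" using D(1) Dfin that by simp
    ultimately show ?thesis by simp
  qed
  have split: "mass y S = setfun B m S + (\<Sum>T | T \<in> B \<and> \<not> T \<subseteq> S. m T * (card (D T \<inter> S) / card (D T)))"
    if "S \<subseteq> A" for S
  proof -
    have "mass y S = (\<Sum>T | T \<in> B \<and> T \<subseteq> S. m T * (card (D T \<inter> S) / card (D T)))
      + (\<Sum>T | T \<in> B \<and> \<not> T \<subseteq> S. m T * (card (D T \<inter> S) / card (D T)))"
      unfolding my[OF that] using finite_building_set
      by (subst sum.union_disjoint[symmetric]) (auto intro!: sum.cong)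
    moreover have "(\<Sum>T | T \<in> B \<and> T \<subseteq> S. m T * (card (D T \<inter> S) / card (D T))) = setfun B m S"
      unfolding setfun_def using in_S by (intro sum.cong) auto
    ultimately show ?thesis by simp
  qed
  have "Poly_Mapping.keys y \<subseteq> A"
  proof -
    have "Poly_Mapping.keys (m T *\<^sub>R uniform (D T)) \<subseteq> A" if "T \<in> B" for T
    proof -
      have "Poly_Mapping.keys (m T *\<^sub>R uniform (D T)) \<subseteq> Poly_Mapping.keys (uniform (D T))"
        by (auto simp: lookup_scaleR in_keys_iff)
      also have "\<dots> \<subseteq> A"
        using keys_uniform[of "D T"] D(2)[OF that] subset_ground[OF that] by simp
      finally show ?thesis .
    qed
    then show ?thesis
      unfolding y_def using keys_sum[of "\<lambda>T. m T *\<^sub>R uniform (D T)" B] by blast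
  qed
  moreover have "mass y A = setfun B m A"
  proof -
    have e: "{T \<in> B. \<not> T \<subseteq> A} = {}" using subset_ground by auto
    show ?thesis using split[OF order_refl] unfolding e by simp
  qed
  moreover have "setfun B m S \<le> mass y S" if "S \<in> B" for S
  proof -
    have "0 \<le> (\<Sum>T | T \<in> B \<and> \<not> T \<subseteq> S. m T * (card (D T \<inter> S) / card (D T)))"
      using pos by (intro sum_nonneg) auto
    then show ?thesis using split[OF subset_ground[OF that]] by simp
  qed
  ultimately have yP: "y \<in> P" by (auto simp: base_polytope_def)
  moreover have "tight A B m y = N"
  proof (intro equalityI subsetI)
    fix S assume S: "S \<in> N"
    then have SB: "S \<in> B" "S \<noteq> A" using nested_member[OF N] by auto
    have "D T \<inter> S = {}" if T: "T \<in> B" "\<not> T \<subseteq> S" for T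
    proof -
      have "\<not> R T \<subseteq> S" using T R(2)[OF T(1)] by blast
      then show ?thesis
        using nested_comparable_core[OF N S R(1)[OF T(1)]] by (auto simp: D_def)
    qed
    then show "S \<in> tight A B m y"
      using SB split[OF subset_ground[OF SB(1)]] by (simp add: tight_def)
  next
    fix S assume S: "S \<in> tight A B m y"
    then have SB: "S \<in> B" "S \<noteq> A" and eq: "mass y S = setfun B m S" by (auto simp: tight_def)
    show "S \<in> N"
    proof (rule ccontr)
      assume SN: "S \<notin> N"
      let ?R = "R S"
      have RB: "?R \<in> B" using R(1)[OF SB(1)] ground nested_member[OF N] by auto
      have nR: "\<not> ?R \<subseteq> S" using R[OF SB(1)] SN SB by (metis insertE subset_antisym)
      \<comment> \<open>\<open>?R\<close> is its own minimal set, so this summand is spread over its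
        entire core, which meets \<open>S\<close> although \<open>?R\<close> is not inside
        \<open>S\<close>.\<close>
      have "R ?R = ?R"
      proof (cases "?R = A")
        case True
        then show ?thesis using R[OF ground] nested_member[OF N] subset_ground by auto
      next
        case False
        then have "?R \<in> N" using R(1)[OF SB(1)] by simp
        then show ?thesis using min[OF RB, of ?R] R(2)[OF RB] by blast
      qed
      then have "D ?R = core N ?R" by (auto simp: D_def core_def)
      then have "D ?R \<inter> S \<noteq> {}"
        using core_meets[OF N SB(1) R(2)[OF SB(1)] min[OF SB(1)]] by (simp add: Int_commute)
      then have "card (D ?R \<inter> S) > 0" "card (D ?R) > 0" using Dfin[OF RB] by (auto simp: card_gt_0_iff)
      then have "0 < m ?R * (card (D ?R \<inter> S) / card (D ?R))" using weight_pos[OF RB] by simp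
      also have "\<dots> \<le> (\<Sum>T | T \<in> B \<and> \<not> T \<subseteq> S. m T * (card (D T \<inter> S) / card (D T)))"
        using RB nR finite_building_set pos by (intro member_le_sum) auto
      finally show False using split[OF subset_ground[OF SB(1)]] eq by simp
    qed
  qed
  ultimately show thesis using that[of D] D unfolding y_def by blast
qed

lemma tight_image: "tight A B m ` P = {N. nested A B N}"
  using nested_tight nested_realization by (auto simp: image_iff) metis

text \<open>Follow the ray from \<open>y\<close> through \<open>x\<close> to the last point of the polytope.\<close>

lemma base_ray:
  assumes x: "x \<in> P" and y: "y \<in> P" and neq: "x \<noteq> y" and sub: "tight A B m x \<subseteq> tight A B m y"
  obtains z where "z \<in> P" "x \<in> open_segment y z" "tight A B m x \<subset> tight A B m z"
proof -
  \<comment> \<open>\<open>\<sigma>\<close> is the slack of a constraint at \<open>x\<close>, and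
    \<open>\<delta>\<close> the rate at which it shrinks along \<open>x + t (x - y)\<close>. Only
    the constraints in \<open>?I\<close> can stop the ray.\<close>
  define \<delta> where "\<delta> S = mass y S - mass x S" for S
  define \<sigma> where "\<sigma> S = mass x S - setfun B m S" for S
  let ?I = "{S \<in> B. \<delta> S > 0}"
  have fin: "finite ?I" using finite_building_set by simp
  \<comment> \<open>The ray is stopped by some singleton: total masses agree and
    \<open>x \<noteq> y\<close>, so a coordinate of \<open>x\<close> is below that of
    \<open>y\<close>.\<close>
  have "\<exists>i\<in>A. Poly_Mapping.lookup x i < Poly_Mapping.lookup y i"
  proof (rule ccontr)
    assume *: "\<not> ?thesis"
    then have le: "\<And>i. i \<in> A \<Longrightarrow> Poly_Mapping.lookup y i \<le> Poly_Mapping.lookup x i"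
      by (simp add: not_less)
    have "mass y A = mass x A" using baseD(2) x y by simp
    then have "Poly_Mapping.lookup y i = Poly_Mapping.lookup x i" if "i \<in> A" for i
      using sum_mono_inv[of "Poly_Mapping.lookup y" A "Poly_Mapping.lookup x" i] le that finite_ground
      by (simp add: mass_def)
    moreover have "Poly_Mapping.lookup y i = Poly_Mapping.lookup x i" if "i \<notin> A" for i
      using baseD(1)[OF x] baseD(1)[OF y] that by (metis in_keys_iff subset_iff)
    ultimately have "y = x" by (intro poly_mapping_eqI) blast
    then show False using neq by simp
  qed
  then obtain i where "i \<in> A" "Poly_Mapping.lookup x i < Poly_Mapping.lookup y i" by blast
  then have "{i} \<in> ?I" using singleton by (simp add: \<delta>_def mass_def)
  then have ne: "?I \<noteq> {}" by blast
  have \<delta>0: "\<delta> A = 0" using baseD(2) x y by (simp add: \<delta>_def)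
  have \<sigma>pos: "\<sigma> S > 0" if S: "S \<in> ?I" for S
  proof -
    have "S \<noteq> A" using S \<delta>0 by auto
    have "\<sigma> S \<noteq> 0"
    proof
      assume "\<sigma> S = 0"
      then have "S \<in> tight A B m x" using S \<open>S \<noteq> A\<close> by (simp add: tight_def \<sigma>_def)
      then have "mass x S = setfun B m S" "mass y S = setfun B m S" using sub by (auto simp: tight_def)
      then show False using S by (simp add: \<delta>_def)
    qed
    then show ?thesis using baseD(3)[OF x, of S] S by (simp add: \<sigma>_def)
  qed
  define t where "t = Min ((\<lambda>S. \<sigma> S / \<delta> S) ` ?I)"
  have "t \<in> (\<lambda>S. \<sigma> S / \<delta> S) ` ?I" unfolding t_def using fin ne by (intro Min_in) auto
  then obtain S0 where S0: "S0 \<in> ?I" "t = \<sigma> S0 / \<delta> S0" by blast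
  have t: "t > 0" using \<sigma>pos[OF S0(1)] S0 by simp
  have tle: "t * \<delta> S \<le> \<sigma> S" if "S \<in> ?I" for S
  proof -
    have "t \<le> \<sigma> S / \<delta> S" unfolding t_def using that fin by (intro Min_le) auto
    then show ?thesis using that by (simp add: pos_le_divide_eq)
  qed
  define z where "z = x + t *\<^sub>R (x - y)"
  have mz: "mass z S = setfun B m S + (\<sigma> S - t * \<delta> S)" for S
    by (simp add: z_def mass_simps \<sigma>_def \<delta>_def algebra_simps)
  have "z \<in> P"
    unfolding base_polytope_def
  proof (intro CollectI conjI ballI)
    have "Poly_Mapping.lookup z i = 0" if "i \<notin> A" for i
    proof -
      have "Poly_Mapping.lookup x i = 0" "Poly_Mapping.lookup y i = 0"
        using baseD(1)[OF x] baseD(1)[OF y] that by (metis in_keys_iff subset_iff)+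
      then show ?thesis by (simp add: z_def lookup_add lookup_minus lookup_scaleR)
    qed
    then show "Poly_Mapping.keys z \<subseteq> A" by (auto simp: in_keys_iff)
    show "mass z A = setfun B m A" unfolding mz using \<delta>0 baseD(2)[OF x] by (simp add: \<sigma>_def)
    fix S assume S: "S \<in> B"
    have "t * \<delta> S \<le> \<sigma> S"
    proof (cases "\<delta> S > 0")
      case True
      then show ?thesis using tle S by simp
    next
      case False
      then have "t * \<delta> S \<le> 0" using t by (simp add: mult_nonneg_nonpos)
      then show ?thesis using baseD(3)[OF x S] by (simp add: \<sigma>_def)
    qed
    then show "setfun B m S \<le> mass z S" unfolding mz by simp
  qed
  moreover have "x \<in> open_segment y z"
  proof -
    have "z \<noteq> y"
    proof
      assume "z = y"
      then have "(1 + t) *\<^sub>R (x - y) = 0" by (simp add: z_def algebra_simps)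
      then show False using t neq by simp
    qed
    moreover have "x = (1 - 1 / (1 + t)) *\<^sub>R y + (1 / (1 + t)) *\<^sub>R z"
    proof -
      have "(1 + t) *\<^sub>R ((1 - 1 / (1 + t)) *\<^sub>R y + (1 / (1 + t)) *\<^sub>R z) = t *\<^sub>R y + z"
        using t by (simp add: scaleR_add_right right_diff_distrib)
      also have "\<dots> = (1 + t) *\<^sub>R x" by (simp add: z_def algebra_simps)
      finally show ?thesis using t by simp
    qed
    ultimately show ?thesis
      unfolding in_segment using t by (intro conjI exI[of _ "1 / (1 + t)"]) auto
  qed
  moreover have "tight A B m x \<subset> tight A B m z"
  proof -
    have "S \<in> tight A B m z" if S: "S \<in> tight A B m x" for S
    proof -
      have "mass x S = setfun B m S" "mass y S = setfun B m S" using S sub by (auto simp: tight_def)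
      then have "\<sigma> S = 0" "\<delta> S = 0" by (auto simp: \<sigma>_def \<delta>_def)
      then show ?thesis using S mz[of S] by (simp add: tight_def)
    qed
    moreover have "S0 \<in> tight A B m z"
      using S0 \<delta>0 mz[of S0] by (auto simp: tight_def)
    moreover have "S0 \<notin> tight A B m x" using \<sigma>pos[OF S0(1)] by (simp add: tight_def \<sigma>_def)
    ultimately show ?thesis by blast
  qed
  ultimately show thesis by (rule that)
qed

lemma convex_base: "convex P"
proof (rule convexI)
  fix x y and u v :: real
  assume xy: "x \<in> P" "y \<in> P" and uv: "0 \<le> u" "0 \<le> v" "u + v = 1"
  let ?z = "u *\<^sub>R x + v *\<^sub>R y"
  have "Poly_Mapping.lookup ?z i = 0" if "i \<notin> A" for i
  proof -
    have "Poly_Mapping.lookup x i = 0" "Poly_Mapping.lookup y i = 0"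
      using baseD(1)[OF xy(1)] baseD(1)[OF xy(2)] that by (metis in_keys_iff subset_iff)+
    then show ?thesis by (simp add: lookup_add lookup_scaleR)
  qed
  moreover have "mass ?z A = setfun B m A"
    using baseD(2)[OF xy(1)] baseD(2)[OF xy(2)] uv
    by (simp add: mass_simps flip: distrib_right)
  moreover have "setfun B m S \<le> mass ?z S" if "S \<in> B" for S
  proof -
    have "u * setfun B m S + v * setfun B m S \<le> u * mass x S + v * mass y S"
      using baseD(3)[OF xy(1) that] baseD(3)[OF xy(2) that] uv by (intro add_mono mult_left_mono)
    then show ?thesis using uv by (simp add: mass_simps flip: distrib_right)
  qed
  ultimately show "?z \<in> P" by (auto simp: base_polytope_def in_keys_iff)
qed

lemma tight_system_base: "tight_system P (tight A B m)"
  unfolding tight_system_def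
proof (intro conjI ballI impI)
  show "convex P" by (rule convex_base)
next
  fix x assume "x \<in> P"
  then show "finite (tight A B m x)" using nested_finite[OF nested_tight] by blast
next
  fix a b x assume ab: "a \<in> P" "b \<in> P" and "x \<in> open_segment a b"
  then obtain u where u: "0 < u" "u < 1" "x = (1 - u) *\<^sub>R a + u *\<^sub>R b" by (auto simp: in_segment)
  have "mass x S = setfun B m S \<longleftrightarrow> mass a S = setfun B m S \<and> mass b S = setfun B m S"
    if S: "S \<in> B" for S
  proof -
    let ?p = "mass a S - setfun B m S" and ?q = "mass b S - setfun B m S"
    have "mass x S - setfun B m S = (1 - u) * ?p + u * ?q"
      by (simp add: u(3) mass_simps algebra_simps)
    moreover have "?p \<ge> 0" "?q \<ge> 0" using baseD(3)[OF ab(1) S] baseD(3)[OF ab(2) S] by auto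
    ultimately have "mass x S - setfun B m S = 0 \<longleftrightarrow> ?p = 0 \<and> ?q = 0"
      using u by (simp add: add_nonneg_eq_0_iff)
    then show ?thesis by simp
  qed
  then show "tight A B m x = tight A B m a \<inter> tight A B m b" by (auto simp: tight_def)
next
  fix x y assume "x \<in> P" "y \<in> P" "x \<noteq> y" "tight A B m x \<subseteq> tight A B m y"
  then show "\<exists>z\<in>P. x \<in> open_segment y z" using base_ray by metis
qed

end

text \<open>The tight sets that occur are the nested sets, whatever the positive weights. With the
  identity as \<open>\<pi>\<close> this discards weights; otherwise it relabels the ground
  set.\<close>

lemma comb_equiv_base:
  assumes "weighted_building_set A B m" "weighted_building_set A' B' m'"
    and \<pi>: "bij_betw \<pi> A A'" and B: "\<And>S. S \<subseteq> A \<Longrightarrow> S \<in> B \<longleftrightarrow> \<pi> ` S \<in> B'"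
  shows "comb_equiv (base_polytope A B m) (base_polytope A' B' m')"
proof -
  interpret w: weighted_building_set A B m by fact
  interpret w': weighted_building_set A' B' m' by fact
  have inj: "inj_on \<pi> A" and A': "\<pi> ` A = A'" using \<pi> by (auto simp: bij_betw_def)
  define \<rho> where "\<rho> = the_inv_into A \<pi>"
  have \<rho>: "\<rho> ` \<pi> ` S = S" if "S \<subseteq> A" for S
  proof -
    have "\<rho> (\<pi> i) = i" if "i \<in> S" for i
      unfolding \<rho>_def using \<open>S \<subseteq> A\<close> that by (intro the_inv_into_f_f[OF inj]) auto
    then show ?thesis by (force simp: image_iff)
  qed
  have \<rho>inj: "inj_on \<rho> A'" and \<rho>A: "\<rho> ` A' = A"
    using bij_betw_the_inv_into[OF \<pi>] by (auto simp: bij_betw_def \<rho>_def)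
  have \<pi>\<rho>: "\<pi> ` \<rho> ` S = S" if "S \<subseteq> A'" for S
  proof -
    have "\<pi> (\<rho> i) = i" if "i \<in> S" for i
      unfolding \<rho>_def using \<open>S \<subseteq> A'\<close> that A' by (intro f_the_inv_into_f[OF inj]) auto
    then show ?thesis by (force simp: image_iff)
  qed
  have B\<rho>: "S \<in> B' \<longleftrightarrow> \<rho> ` S \<in> B" if "S \<subseteq> A'" for S
    using B[of "\<rho> ` S"] \<pi>\<rho>[OF that] that \<rho>A by auto
  let ?h = "\<lambda>N. (`) \<pi> ` N" and ?k = "\<lambda>N. (`) \<rho> ` N"
  have hn: "nested A' B' (?h N)" if "nested A B N" for N
    using nested_image[OF inj B w.subset_ground that] A' by simp
  have kn: "nested A B (?k N)" if "nested A' B' N" for N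
    using nested_image[OF \<rho>inj B\<rho> w'.subset_ground that] \<rho>A by simp
  have kh: "?k (?h N) = N" if "nested A B N" for N
  proof -
    have "(\<lambda>S. \<rho> ` \<pi> ` S) ` N = (\<lambda>S. S) ` N"
      using w.nested_member[OF that] w.subset_ground by (intro image_cong refl \<rho>) auto
    then show ?thesis by (simp add: image_image)
  qed
  have hk: "?h (?k N) = N" if "nested A' B' N" for N
  proof -
    have "(\<lambda>S. \<pi> ` \<rho> ` S) ` N = (\<lambda>S. S) ` N"
      using w'.nested_member[OF that] w'.subset_ground by (intro image_cong refl \<pi>\<rho>) auto
    then show ?thesis by (simp add: image_image)
  qed
  show ?thesis
  proof (rule comb_equiv_tight_systems[OF w.tight_system_base w'.tight_system_base])
    show "bij_betw ?h (tight A B m ` w.P) (tight A' B' m' ` w'.P)"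
      unfolding w.tight_image w'.tight_image
      using hn kn kh hk by (intro bij_betw_byWitness[of _ ?k]) auto
    fix x y assume "x \<in> w.P" "y \<in> w.P"
    then have n: "nested A B (tight A B m x)" "nested A B (tight A B m y)"
      by (auto intro: w.nested_tight)
    show "?h (tight A B m x) \<subseteq> ?h (tight A B m y) \<longleftrightarrow> tight A B m x \<subseteq> tight A B m y"
      using kh[OF n(1)] kh[OF n(2)] image_mono by metis
  qed
qed


section \<open>The faces of nestohedra\<close>

lemma weighted_building_set_one:
  assumes "building_set_on A B" shows "weighted_building_set A B (\<lambda>_. 1)"
proof -
  interpret building_set_on A B by fact
  show ?thesis by unfold_locales simp
qed

lemma simplex_point:
  fixes x :: "nat \<Rightarrow>\<^sub>0 real"
  assumes S: "finite S" and x: "x \<in> convex hull {Poly_Mapping.single i 1 |i. i \<in> S}"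
  shows "Poly_Mapping.keys x \<subseteq> S" "Poly_Mapping.lookup x i \<ge> 0" "mass x S = 1"
proof -
  let ?K = "{x. (\<forall>i. Poly_Mapping.lookup x i \<ge> (0::real)) \<and> (\<forall>i. i \<notin> S \<longrightarrow> Poly_Mapping.lookup x i = 0) \<and> mass x S = 1}"
  have "convex ?K"
  proof (rule convexI)
    fix x y and u v :: real
    assume "x \<in> ?K" "y \<in> ?K" "0 \<le> u" "0 \<le> v" "u + v = 1"
    then show "u *\<^sub>R x + v *\<^sub>R y \<in> ?K" by (simp add: mass_simps lookup_add lookup_scaleR)
  qed
  moreover have "{Poly_Mapping.single i 1 |i. i \<in> S} \<subseteq> ?K"
    using S by (auto simp: mass_single lookup_single when_def)
  ultimately have "convex hull {Poly_Mapping.single i 1 |i. i \<in> S} \<subseteq> ?K" by (rule hull_minimal[rotated])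
  then have "x \<in> ?K" using x by blast
  then show "Poly_Mapping.keys x \<subseteq> S" "Poly_Mapping.lookup x i \<ge> 0" "mass x S = 1"
    by (auto simp: in_keys_iff)
qed

lemma uniform_in_simplex:
  assumes "finite D" "D \<noteq> {}" "D \<subseteq> S"
  shows "uniform D \<in> convex hull {Poly_Mapping.single i 1 |i. i \<in> S}"
proof -
  have "uniform D = (\<Sum>i\<in>D. (1 / card D) *\<^sub>R Poly_Mapping.single i 1)"
    by (simp add: uniform_def scaleR_sum_right)
  also have "\<dots> \<in> convex hull {Poly_Mapping.single i 1 |i. i \<in> S}"
    using assms by (intro convex_sum convex_convex_hull) (auto intro: hull_inc)
  finally show ?thesis .
qed

lemma convex_nestohedron: "convex (nestohedron B)"
  unfolding nestohedron_def by (intro convex_set_sum convex_convex_hull)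

text \<open>Convex hulls commute with Minkowski sums, so finitely many sums of vertices generate.
  Base polytopes, given by inequalities, inherit this from
  \<open>nestohedron_eq_base_polytope\<close>.\<close>

lemma polytope_nestohedron:
  assumes "finite B" "\<And>S. S \<in> B \<Longrightarrow> finite S"
  shows "polytope (nestohedron B)"
proof -
  have "finite (\<Sum>S\<in>B. {Poly_Mapping.single i (1::real) |i. i \<in> S})"
    using assms
  proof (induction B rule: finite_induct)
    case (insert T B)
    have "finite {Poly_Mapping.single i (1::real) |i. i \<in> T}"
      using insert.prems[of T] by (simp add: Setcompr_eq_image)
    moreover have "finite (\<Sum>S\<in>B. {Poly_Mapping.single i (1::real) |i. i \<in> S})"
      using insert.prems by (intro insert.IH) simp
    ultimately show ?case
      unfolding sum.insert[OF insert.hyps] by (rule finite_set_plus)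
  qed (simp add: set_zero)
  then show ?thesis
    unfolding nestohedron_def convex_hull_set_sum[symmetric] by (rule polytope_convex_hull)
qed

text \<open>For the inclusion of the base polytope, induct on the number of constraints that are not
  tight at \<open>x\<close>. \<open>nested_realization\<close> provides a \<open>y\<close> in the
  Minkowski sum with the same tight set; the ray from \<open>y\<close> through \<open>x\<close> ends
  in a \<open>z\<close> with more tight constraints, which is in the sum by induction, and convexity
  gives \<open>x\<close>.\<close>

lemma nestohedron_eq_base_polytope:
  assumes "building_set_on A B"
  shows "nestohedron B = base_polytope A B (\<lambda>_. 1)"
proof -
  interpret weighted_building_set A B "\<lambda>_. 1"
    by (rule weighted_building_set_one[OF assms])
  let ?\<Delta> = "\<lambda>S. convex hull {Poly_Mapping.single i (1::real) |i. i \<in> S}"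
  have mem: "x \<in> nestohedron B \<longleftrightarrow> (\<exists>s. x = sum s B \<and> (\<forall>T\<in>B. s T \<in> ?\<Delta> T))" for x
    unfolding nestohedron_def set_sum_alt[OF finite_building_set] by blast
  show ?thesis
  proof (intro equalityI subsetI)
    fix x assume "x \<in> nestohedron B"
    then obtain s where s: "x = sum s B" "\<And>T. T \<in> B \<Longrightarrow> s T \<in> ?\<Delta> T" using mem by blast
    note sT = simplex_point[OF finite_member s(2)]
    have one: "mass (s T) S = 1" if "T \<in> B" "T \<subseteq> S" "S \<subseteq> A" for T S
      using mass_keys[of S "s T" T] sT(1,3)[OF that(1) that(1)] that finite_ground finite_subset by metis
    have nonneg: "mass (s T) S \<ge> 0" if "T \<in> B" for T S
      unfolding mass_def using sT(2)[OF that that] by (simp add: sum_nonneg)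
    have split: "mass x S = setfun B (\<lambda>_. 1) S + (\<Sum>T | T \<in> B \<and> \<not> T \<subseteq> S. mass (s T) S)"
      if "S \<subseteq> A" for S
    proof -
      have "mass x S = (\<Sum>T | T \<in> B \<and> T \<subseteq> S. mass (s T) S) + (\<Sum>T | T \<in> B \<and> \<not> T \<subseteq> S. mass (s T) S)"
        unfolding s(1) mass_simps using finite_building_set
        by (subst sum.union_disjoint[symmetric]) (auto intro!: sum.cong)
      moreover have "(\<Sum>T | T \<in> B \<and> T \<subseteq> S. mass (s T) S) = setfun B (\<lambda>_. 1) S"
        unfolding setfun_def using one that by (intro sum.cong) auto
      ultimately show ?thesis by simp
    qed
    show "x \<in> P"
      unfolding base_polytope_def
    proof (intro CollectI conjI ballI)
      have "Poly_Mapping.keys (s T) \<subseteq> A" if "T \<in> B" for T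
        using sT(1)[OF that that] subset_ground[OF that] by simp
      then show "Poly_Mapping.keys x \<subseteq> A" unfolding s(1) using keys_sum[of s B] by blast
      have e: "{T \<in> B. \<not> T \<subseteq> A} = {}" using subset_ground by auto
      show "mass x A = setfun B (\<lambda>_. 1) A" using split[OF order_refl] unfolding e by simp
      fix S assume "S \<in> B"
      moreover have "0 \<le> (\<Sum>T | T \<in> B \<and> \<not> T \<subseteq> S. mass (s T) S)" using nonneg by (intro sum_nonneg) auto
      ultimately show "setfun B (\<lambda>_. 1) S \<le> mass x S" using split[OF subset_ground] by simp
    qed
  next
    fix x assume "x \<in> P"
    then show "x \<in> nestohedron B"
    proof (induction "card B - card (tight A B (\<lambda>_. 1) x)" arbitrary: x rule: less_induct)
      case less
      have N: "nested A B (tight A B (\<lambda>_. 1) x)" by (rule nested_tight[OF less.prems])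
      obtain D where D: "\<And>T. T \<in> B \<Longrightarrow> D T \<noteq> {} \<and> D T \<subseteq> T"
        and y: "(\<Sum>T\<in>B. 1 *\<^sub>R uniform (D T)) \<in> P"
          "tight A B (\<lambda>_. 1) (\<Sum>T\<in>B. 1 *\<^sub>R uniform (D T)) = tight A B (\<lambda>_. 1) x"
        by (rule nested_realization[OF N]) meson
      define y where "y = (\<Sum>T\<in>B. 1 *\<^sub>R uniform (D T))"
      have "\<forall>T\<in>B. 1 *\<^sub>R uniform (D T) \<in> ?\<Delta> T"
        using D finite_member by (auto intro!: uniform_in_simplex intro: finite_subset)
      then have yn: "y \<in> nestohedron B" unfolding mem y_def by blast
      show ?case
      proof (cases "x = y")
        case False
        obtain z where z: "z \<in> P" "x \<in> open_segment y z" "tight A B (\<lambda>_. 1) x \<subset> tight A B (\<lambda>_. 1) z"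
          by (rule base_ray[OF less.prems, of y]) (use False y in \<open>simp_all add: y_def\<close>)
        have tB: "tight A B (\<lambda>_. 1) z \<subseteq> B" by (auto simp: tight_def)
        have "card (tight A B (\<lambda>_. 1) x) < card (tight A B (\<lambda>_. 1) z)"
          using z(3) finite_subset[OF tB finite_building_set] by (rule psubset_card_mono[rotated])
        moreover have "card (tight A B (\<lambda>_. 1) z) \<le> card B" using tB finite_building_set by (rule card_mono[rotated])
        ultimately have "z \<in> nestohedron B" using less.hyps z(1) by simp
        then have "open_segment y z \<subseteq> nestohedron B"
          using convex_nestohedron yn by (simp add: convex_contains_open_segment)
        then show ?thesis using z(2) by blast
      qed (use yn in simp)
    qed
  qed
qed

section \<open>Faces, dimension and facets in terms of nested sets\<close>

context weighted_building_set
begin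

abbreviation face :: "'i set set \<Rightarrow> ('i \<Rightarrow>\<^sub>0 real) set"
  where "face N \<equiv> tight_face P (tight A B m) N"

lemma face_face_of: "face N face_of P"
  by (rule tight_face_face_of[OF tight_system_base])

lemma nested_point:
  assumes "nested A B N" obtains x where "x \<in> P" "tight A B m x = N"
  using nested_realization[OF assms] by metis

lemma face_subset_iff:
  assumes "nested A B N" shows "face N \<subseteq> face M \<longleftrightarrow> M \<subseteq> N"
  using nested_point[OF assms] tight_face_subset_iff by metis

lemma face_nonempty:
  assumes "nested A B N" shows "face N \<noteq> {}"
  using nested_point[OF assms] by (auto simp: tight_face_def)

lemma face_eq_iff:
  assumes "nested A B N" "nested A B M" shows "face N = face M \<longleftrightarrow> N = M"
  using face_subset_iff[OF assms(1), of M] face_subset_iff[OF assms(2), of N] by auto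

lemma face_psubset:
  assumes "nested A B N" "M \<subset> N" shows "face N \<subset> face M"
proof -
  have "nested A B M" using nested_subset[OF assms(1)] assms(2) by auto
  then show ?thesis using face_subset_iff[OF assms(1)] face_eq_iff[OF assms(1)] assms(2) by auto
qed

lemma face_of_nested:
  assumes "F face_of P" "F \<noteq> {}"
  obtains N where "nested A B N" "F = face N"
proof -
  obtain x where x: "x \<in> F" "F = face (tight A B m x)"
    using face_of_tight_face[OF tight_system_base assms] .
  then have "x \<in> P" using assms face_of_imp_subset by blast
  then show thesis using that nested_tight x(2) by blast
qed

lemma face_empty: "face {} = P"
  by (simp add: tight_face_def)

text \<open>Differences of points are supported on \<open>A\<close> and have total mass 0, so the
  vectors \<open>?e i - ?e a\<close> with \<open>i \<noteq> a\<close> span them.\<close>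

lemma pdim_base_le: "pdim P + 1 \<le> card A"
proof -
  obtain a where a: "a \<in> A" using nonempty[OF ground] by auto
  let ?e = "\<lambda>i. Poly_Mapping.single i (1::real)"
  let ?V = "(\<lambda>i. ?e i - ?e a) ` (A - {a})"
  have "d \<in> span ?V" if d: "Poly_Mapping.keys d \<subseteq> A" "mass d A = 0" for d
  proof -
    let ?l = "Poly_Mapping.lookup d"
    have look: "Poly_Mapping.lookup (\<Sum>i\<in>A. ?l i *\<^sub>R g i) k = (\<Sum>i\<in>A. ?l i * Poly_Mapping.lookup (g i) k)" for g k
      by (simp add: lookup_sum lookup_scaleR)
    have "d = (\<Sum>i\<in>A. ?l i *\<^sub>R (?e i - ?e a))"
    proof (rule poly_mapping_eqI)
      fix k
      have "(\<Sum>i\<in>A. ?l i * Poly_Mapping.lookup (?e i - ?e a) k)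
        = (\<Sum>i\<in>A. if i = k then ?l i else 0) - (\<Sum>i\<in>A. ?l i) * (if a = k then 1 else 0)"
        unfolding sum_distrib_right sum_subtractf[symmetric]
        by (intro sum.cong refl) (simp add: lookup_minus lookup_single when_def algebra_simps)
      also have "\<dots> = ?l k"
        using d finite_ground by (auto simp: mass_def in_keys_iff)
      finally show "?l k = Poly_Mapping.lookup (\<Sum>i\<in>A. ?l i *\<^sub>R (?e i - ?e a)) k"
        unfolding look ..
    qed
    also have "\<dots> = (\<Sum>i\<in>A - {a}. ?l i *\<^sub>R (?e i - ?e a))"
      using finite_ground by (intro sum.mono_neutral_right) auto
    also have "\<dots> \<in> span ?V" by (intro span_sum span_scale span_base) auto
    finally show ?thesis .
  qed
  moreover have "Poly_Mapping.keys (x - y) \<subseteq> A" "mass (x - y) A = 0" if "x \<in> P" "y \<in> P" for x y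
    using baseD(1,2)[OF that(1)] baseD(1,2)[OF that(2)] keys_diff[of x y] by (auto simp: mass_diff)
  ultimately have "{x - y |x y. x \<in> P \<and> y \<in> P} \<subseteq> span ?V" by blast
  then have "pdim P \<le> card ?V"
    unfolding pdim_def using finite_ground by (intro real_vector.dim_le_card) auto
  also have "\<dots> \<le> card (A - {a})" using finite_ground by (intro card_image_le) simp
  also have "\<dots> < card A" using a finite_ground by (intro psubset_card_mono) auto
  finally show ?thesis by simp
qed

context
  assumes polytope: "polytope P"
begin

text \<open>Dropping the members of \<open>M - N\<close> one at a time strictly enlarges the face at
  each step.\<close>

lemma pdim_face_mono:
  assumes M: "nested A B M" and "N \<subseteq> M"
  shows "pdim (face M) + card M \<le> pdim (face N) + card N"
proof -
  have finM: "finite M" using nested_finite[OF M] .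
  have "pdim (face M) + card (M - N) \<le> pdim (face (M - K)) + card (M - N) - card K"
    if "K \<subseteq> M - N" for K
    using finite_subset[OF that finite_Diff[OF finM]] that
  proof (induction K rule: finite_induct)
    case (insert S K)
    have n: "nested A B (M - K)" using nested_subset[OF M] by auto
    have "pdim (face (M - K)) < pdim (face (M - insert S K))"
      using insert by (intro pdim_strict_mono[OF polytope] face_face_of face_psubset face_nonempty n) auto
    moreover have "card (insert S K) \<le> card (M - N)"
      using insert finM by (intro card_mono) auto
    ultimately show ?case using insert by simp
  qed simp
  from this[of "M - N"] have "pdim (face M) + card (M - N) \<le> pdim (face (M - (M - N)))" by simp
  moreover have "M - (M - N) = N" using assms(2) by auto
  moreover have "card (M - N) = card M - card N" "card N \<le> card M"
    using assms(2) finM by (simp_all add: card_Diff_subset finite_subset card_mono)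
  ultimately show ?thesis by simp
qed

text \<open>Comparison with the empty nested set gives the upper bound through
  \<open>pdim_base_le\<close>; comparison with an extension of \<open>N\<close> to
  \<open>card A - 1\<close> members gives the lower bound. Together they fix the dimension of every
  face at once.\<close>

lemma pdim_face:
  assumes N: "nested A B N"
  shows "pdim (face N) + card N + 1 = card A"
proof -
  have le: "pdim (face N) + card N + 1 \<le> card A" if "nested A B N" for N
    using pdim_face_mono[OF that, of "{}"] pdim_base_le by (simp add: face_empty)
  have "card N < card A" using le[OF N] by simp
  then obtain M where M: "nested A B M" "N \<subseteq> M" "card M + 1 = card A"
    using nested_extend_maximal[OF N] by blast
  then show ?thesis using pdim_face_mono[OF M(1,2)] le[OF N] by simp
qed

lemma pdim_base: "pdim P + 1 = card A"
  using pdim_face[OF nested_empty] by (simp add: face_empty)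

lemma facets_base: "facets P = (\<lambda>S. face {S}) ` (B - {A})"
proof (intro equalityI subsetI)
  fix F assume F: "F \<in> facets P"
  then obtain N where N: "nested A B N" "F = face N"
    using face_of_nested by (auto simp: facets_def)
  then have "card N = 1"
    using F pdim_face[OF N(1)] pdim_base by (simp add: facets_def)
  then obtain S where S: "N = {S}" by (auto simp: card_1_singleton_iff)
  then have "S \<in> B - {A}" using nested_member[OF N(1)] by simp
  then show "F \<in> (\<lambda>S. face {S}) ` (B - {A})" using N(2) S by blast
next
  fix F assume "F \<in> (\<lambda>S. face {S}) ` (B - {A})"
  then obtain S where S: "nested A B {S}" "F = face {S}" using nested_single by auto
  then have "Suc (pdim F) = pdim P" using pdim_face[OF S(1)] pdim_base by simp
  then show "F \<in> facets P" using S face_face_of face_nonempty[OF S(1)] by (simp add: facets_def)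
qed

lemma inj_on_face: "inj_on (\<lambda>S. face {S}) (B - {A})"
  using face_eq_iff[OF nested_single nested_single] by (auto simp: inj_on_def)

text \<open>A vertex is the face of a nested set with \<open>pdim P\<close> members, and the facets
  through it are the faces of these members.\<close>

lemma simple_base: "simple_polytope P"
  unfolding simple_polytope_def
proof (intro conjI allI impI)
  show "P \<noteq> {}" using face_nonempty[OF nested_empty] by (simp add: face_empty)
  fix v assume v: "v extreme_point_of P"
  then have "{v} face_of P" by (simp add: face_of_singleton)
  then obtain N where N: "nested A B N" "{v} = face N" using face_of_nested by blast
  then have card: "card N = pdim P" using pdim_face[OF N(1)] pdim_base by (simp flip: N(2))
  obtain x where x: "x \<in> P" "tight A B m x = N" using nested_point[OF N(1)] .
  then have "x \<in> face N" by (simp add: tight_face_def)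
  then have v: "v \<in> P" "tight A B m v = N" using x N(2) by auto
  have NB: "N \<subseteq> B - {A}" using N(1) by (simp add: nested_def)
  have "{F \<in> facets P. v \<in> F} = (\<lambda>S. face {S}) ` N"
    unfolding facets_base using v NB by (auto simp: tight_face_def)
  then show "card {F \<in> facets P. v \<in> F} = pdim P"
    using card inj_on_subset[OF inj_on_face NB] by (simp add: card_image)
qed (rule polytope)

lemma graded_simple_base: "graded_simple P"
  unfolding graded_simple_def
proof (intro conjI allI impI)
  show "simple_polytope P" by (rule simple_base)
  fix M assume M: "maxface P M"
  then obtain N where N: "nested A B N" "M = face N"
    using face_of_nested by (auto simp: maxface_def)
  have "N \<noteq> {}" using M N by (auto simp: maxface_def face_empty)
  then obtain S where S: "S \<in> N" by auto
  then have SB: "S \<in> B" "S \<noteq> A" "nested A B {S}"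
    using nested_member[OF N(1)] nested_subset[OF N(1), of "{S}"] by auto
  have "M \<subseteq> face {S}" using S N by (auto simp: tight_face_def)
  moreover have "face {S} \<noteq> P" using face_eq_iff[OF SB(3) nested_empty] by (simp add: face_empty)
  ultimately have "M = face {S}" using M face_face_of unfolding maxface_def by metis
  then show "M \<in> facets P" unfolding facets_base using SB by blast
next
  obtain M where M: "nested A B M" "card M + 1 = card A"
  proof (rule nested_extend_maximal[OF nested_empty])
    show "card {} < card A" using nonempty[OF ground] finite_ground by (simp add: card_gt_0_iff)
  qed
  let ?n = "card M"
  have n: "pdim P = ?n" using M pdim_base by simp
  obtain e where e: "bij_betw e {..<?n} M"
    using ex_bij_betw_nat_finite[OF nested_finite[OF M(1)]] by (auto simp: atLeast0LessThan)
  \<comment> \<open>Members of a maximal nested set are released one by one: \<open>g 0\<close> has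
    dimension 0, and \<open>g ?n\<close> is the whole polytope.\<close>
  define g where "g i = face (e ` {i..<?n})" for i
  have sub: "e ` {i..<?n} \<subseteq> M" for i using bij_betw_imp_surj_on[OF e] by auto
  have nes: "nested A B (e ` {i..<?n})" for i by (rule nested_subset[OF M(1) sub])
  have "g i \<subset> g (Suc i)" if i: "i < ?n" for i
    unfolding g_def
  proof (rule face_psubset[OF nes])
    have "e i \<notin> e ` {Suc i..<?n}"
    proof
      assume "e i \<in> e ` {Suc i..<?n}"
      then obtain j where j: "e i = e j" "Suc i \<le> j" "j < ?n" by auto
      then have "i = j" using inj_onD[OF bij_betw_imp_inj_on[OF e], of i j] i by simp
      then show False using j by simp
    qed
    moreover have "e i \<in> e ` {i..<?n}" using i by auto
    moreover have "e ` {Suc i..<?n} \<subseteq> e ` {i..<?n}" by (intro image_mono) auto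
    ultimately show "e ` {Suc i..<?n} \<subset> e ` {i..<?n}" by blast
  qed
  then show "face_chain P (pdim P)"
    unfolding face_chain_def n using face_face_of face_nonempty[OF nes]
    by (intro exI[of _ g]) (auto simp: g_def)
qed

text \<open>The source of the disjoint pairs in the indecomposability argument: a common point would
  put both sets into one nested set.\<close>

lemma facets_disjoint:
  assumes "S \<in> B" "T \<in> B" "\<not> S \<subseteq> T" "\<not> T \<subseteq> S" "S \<union> T \<in> B"
  shows "face {S} \<inter> face {T} = {}"
proof (rule ccontr)
  assume "\<not> ?thesis"
  then obtain x where "x \<in> P" "S \<in> tight A B m x" "T \<in> tight A B m x" by (auto simp: tight_face_def)
  then show False using nested_pair[OF nested_tight] assms by blast
qed

end

end


section \<open>Facets as products\<close>

definition restriction :: "'i set set \<Rightarrow> 'i set \<Rightarrow> 'i set set"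
  where "restriction B S = {T \<in> B. T \<subseteq> S}"

definition contraction :: "'i set set \<Rightarrow> 'i set \<Rightarrow> 'i set set"
  where "contraction B S = (\<lambda>T. T - S) ` {T \<in> B. \<not> T \<subseteq> S}"

text \<open>Distinct members can leave the same trace \<open>T - S\<close>; adding up their weights
  keeps the lower bounds of the contraction exact.\<close>

definition contracted_weight :: "'i set set \<Rightarrow> ('i set \<Rightarrow> real) \<Rightarrow> 'i set \<Rightarrow> 'i set \<Rightarrow> real"
  where "contracted_weight B m S U = (\<Sum>T | T \<in> B \<and> \<not> T \<subseteq> S \<and> T - S = U. m T)"

lemma (in building_set_on) building_set_restriction:
  assumes S: "S \<in> B"
  shows "building_set_on S (restriction B S)"
proof
  show "finite S" by (rule finite_member[OF S])
  show "{i} \<in> restriction B S" if "i \<in> S" for i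
    using that singleton subset_ground[OF S] by (auto simp: restriction_def)
  show "T \<union> U \<in> restriction B S" if "T \<in> restriction B S" "U \<in> restriction B S" "T \<inter> U \<noteq> {}" for T U
    using that union by (auto simp: restriction_def)
qed (use S nonempty in \<open>auto simp: restriction_def\<close>)

lemma (in building_set_on) building_set_contraction:
  assumes S: "S \<in> B" "S \<noteq> A"
  shows "building_set_on (A - S) (contraction B S)"
proof
  show "finite (A - S)" using finite_ground by simp
  show "{i} \<in> contraction B S" if "i \<in> A - S" for i
    unfolding contraction_def using that singleton by (intro image_eqI[of _ _ "{i}"]) auto
  show "A - S \<in> contraction B S"
    unfolding contraction_def using S subset_ground ground by blast
  fix T assume "T \<in> contraction B S"
  then obtain T' where T: "T' \<in> B" "\<not> T' \<subseteq> S" "T = T' - S" by (auto simp: contraction_def)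
  then show "T \<subseteq> A - S" "T \<noteq> {}" using subset_ground by auto
  fix U assume "U \<in> contraction B S" "T \<inter> U \<noteq> {}"
  then obtain U' where U: "U' \<in> B" "\<not> U' \<subseteq> S" "U = U' - S" "T' \<inter> U' \<noteq> {}"
    using T by (auto simp: contraction_def)
  have "T' \<union> U' \<in> B" by (rule union[OF T(1) U(1,4)])
  moreover have "T \<union> U = (T' \<union> U') - S" "\<not> T' \<union> U' \<subseteq> S" using T U by auto
  ultimately show "T \<union> U \<in> contraction B S" unfolding contraction_def by blast
qed

context weighted_building_set
begin

lemma weighted_restriction: "S \<in> B \<Longrightarrow> weighted_building_set S (restriction B S) m"
  unfolding weighted_building_set_def weighted_building_set_axioms_def
  using building_set_restriction weight_pos by (auto simp: restriction_def)

lemma weighted_contraction: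
  assumes S: "S \<in> B" "S \<noteq> A"
  shows "weighted_building_set (A - S) (contraction B S) (contracted_weight B m S)"
  unfolding weighted_building_set_def weighted_building_set_axioms_def
proof (intro conjI allI impI building_set_contraction[OF S])
  fix U assume "U \<in> contraction B S"
  then obtain T where "T \<in> {T \<in> B. \<not> T \<subseteq> S \<and> T - S = U}" by (auto simp: contraction_def)
  then show "0 < contracted_weight B m S U"
    unfolding contracted_weight_def using finite_building_set weight_pos by (intro sum_pos) auto
qed

lemma setfun_restriction: "T \<subseteq> S \<Longrightarrow> setfun (restriction B S) m T = setfun B m T"
  unfolding setfun_def restriction_def by (intro sum.cong) auto

text \<open>The members inside \<open>U \<union> S\<close> are those inside \<open>S\<close> and the
  remaining ones, which are grouped by their trace outside \<open>S\<close>.\<close>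

lemma setfun_contraction:
  assumes "U \<subseteq> A - S"
  shows "setfun (contraction B S) (contracted_weight B m S) U = setfun B m (U \<union> S) - setfun B m S"
proof -
  let ?X = "{T \<in> B. \<not> T \<subseteq> S \<and> T \<subseteq> U \<union> S}"
  let ?Y = "{V \<in> contraction B S. V \<subseteq> U}"
  have "setfun (contraction B S) (contracted_weight B m S) U
    = (\<Sum>V\<in>?Y. sum m {T \<in> ?X. T - S = V})"
    unfolding setfun_def contracted_weight_def by (intro sum.cong refl) (auto intro: arg_cong[where f = "sum m"])
  also have "\<dots> = sum m ?X"
  proof (rule sum.group)
    show "finite ?X" using finite_building_set by simp
    show "finite ?Y" unfolding contraction_def using finite_building_set by simp
    show "(\<lambda>T. T - S) ` ?X \<subseteq> ?Y" by (auto simp: contraction_def)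
  qed
  also have "\<dots> = setfun B m (U \<union> S) - setfun B m S"
  proof -
    have "{T \<in> B. T \<subseteq> U \<union> S} = ?X \<union> {T \<in> B. T \<subseteq> S}" by auto
    then have "setfun B m (U \<union> S) = sum m ?X + setfun B m S"
      unfolding setfun_def using finite_building_set by (simp add: sum.union_disjoint disjoint_iff)
    then show ?thesis by simp
  qed
  finally show ?thesis .
qed

text \<open>On this facet the mass of \<open>S\<close> is fixed at its minimum, so cutting
  \<open>x\<close> along \<open>S\<close> yields the factors: constraints of the second are those of
  \<open>T \<union> S\<close> minus the equality for \<open>S\<close>. Conversely, supermodularity
  at \<open>T\<close> and \<open>S\<close> combines the constraints of the two parts into that of
  \<open>T\<close>.\<close>

lemma face_single_eq:
  assumes S: "S \<in> B" "S \<noteq> A"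
  shows "face {S} = (\<lambda>p. fst p + snd p) `
    (base_polytope S (restriction B S) m \<times> base_polytope (A - S) (contraction B S) (contracted_weight B m S))"
    (is "_ = ?f ` (?P1 \<times> ?P2)")
proof -
  interpret r: weighted_building_set S "restriction B S" m by (rule weighted_restriction[OF S(1)])
  interpret c: weighted_building_set "A - S" "contraction B S" "contracted_weight B m S"
    by (rule weighted_contraction[OF S])
  have SA: "S \<subseteq> A" by (rule subset_ground[OF S(1)])
  have fin: "finite S" "finite (A - S)" using SA finite_ground finite_subset by auto
  have mS: "mass x T = mass x (T \<inter> S) + mass x (T - S)" if "T \<subseteq> A" for x T
  proof -
    have "finite T" using that finite_ground finite_subset by blast
    then show ?thesis unfolding mass_def by (rule sum.Int_Diff)
  qed
  show ?thesis
  proof (intro equalityI subsetI)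
    fix x assume "x \<in> face {S}"
    then have x: "x \<in> P" "mass x S = setfun B m S" by (auto simp: tight_face_def tight_def)
    define y where "y = (\<Sum>i\<in>S. Poly_Mapping.single i (Poly_Mapping.lookup x i))"
    define z where "z = x - y"
    have ly: "Poly_Mapping.lookup y i = (if i \<in> S then Poly_Mapping.lookup x i else 0)" for i
      unfolding y_def using fin(1) by (simp add: lookup_sum lookup_single when_def)
    have lz: "Poly_Mapping.lookup z i = (if i \<in> S then 0 else Poly_Mapping.lookup x i)" for i
      by (simp add: z_def lookup_minus ly)
    have my: "mass y T = mass x T" if "T \<subseteq> S" for T
      unfolding mass_def using that by (intro sum.cong) (auto simp: ly)
    have mz: "mass z T = mass x T" if "T \<inter> S = {}" for T
      unfolding mass_def using that by (intro sum.cong) (auto simp: lz)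
    have "y \<in> ?P1"
      unfolding base_polytope_def
    proof (intro CollectI conjI ballI)
      show "Poly_Mapping.keys y \<subseteq> S" by (auto simp: in_keys_iff ly split: if_splits)
      show "mass y S = setfun (restriction B S) m S" by (simp add: my setfun_restriction x(2))
      fix T assume "T \<in> restriction B S"
      then have T: "T \<in> B" "T \<subseteq> S" by (auto simp: restriction_def)
      then show "setfun (restriction B S) m T \<le> mass y T"
        using baseD(3)[OF x(1)] by (simp add: my setfun_restriction)
    qed
    moreover have "z \<in> ?P2"
      unfolding base_polytope_def
    proof (intro CollectI conjI ballI)
      show "Poly_Mapping.keys z \<subseteq> A - S"
        using baseD(1)[OF x(1)] by (auto simp: in_keys_iff lz split: if_splits)
      have "mass z (A - S) = mass x A - mass x S"
        using mS[OF order_refl, of x] SA mz[of "A - S"] by (simp add: Int_absorb1 Diff_Int_distrib2)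
      then show "mass z (A - S) = setfun (contraction B S) (contracted_weight B m S) (A - S)"
        using SA baseD(2)[OF x(1)] x(2) by (simp add: setfun_contraction Un_absorb2 Un_commute)
      fix T assume "T \<in> contraction B S"
      then have T: "T \<subseteq> A - S" by (rule c.subset_ground)
      then have "mass x (T \<union> S) = mass x S + mass x T"
        using mS[of "T \<union> S" x] SA by (simp add: Un_Diff Int_Un_distrib2 Diff_triv disjoint_iff Int_absorb1 subset_iff)
      moreover have "mass z T = mass x T" using T by (intro mz) auto
      \<comment> \<open>\<open>T \<union> S\<close> may fail to be a member, when \<open>T\<close>
        comes from a member disjoint from \<open>S\<close>; hence \<open>base_all\<close>.\<close>
      moreover have "setfun B m (T \<union> S) \<le> mass x (T \<union> S)" using T SA by (intro base_all[OF x(1)]) auto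
      ultimately show "setfun (contraction B S) (contracted_weight B m S) T \<le> mass z T"
        unfolding setfun_contraction[OF T] using x(2) by simp
    qed
    ultimately show "x \<in> ?f ` (?P1 \<times> ?P2)"
      by (intro image_eqI[of _ _ "(y, z)"]) (auto simp: z_def)
  next
    fix x assume "x \<in> ?f ` (?P1 \<times> ?P2)"
    then obtain y z where yz: "y \<in> ?P1" "z \<in> ?P2" "x = y + z" by auto
    have ky: "Poly_Mapping.lookup y i = 0" if "i \<notin> S" for i
      using r.baseD(1)[OF yz(1)] that by (metis in_keys_iff subset_iff)
    have kz: "Poly_Mapping.lookup z i = 0" if "i \<notin> A - S" for i
      using c.baseD(1)[OF yz(2)] that by (metis in_keys_iff subset_iff)
    have my: "mass y T = 0" if "T \<inter> S = {}" for T
      unfolding mass_def using that ky by (intro sum.neutral) auto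
    have mz: "mass z T = 0" if "T \<subseteq> S" for T
      unfolding mass_def using that kz by (intro sum.neutral) auto
    have mx: "mass x T = mass y (T \<inter> S) + mass z (T - S)" if "T \<subseteq> A" for T
      using mS[OF that, of x] my[of "T - S"] mz[of "T \<inter> S"] by (simp add: yz(3) mass_add Diff_Int_distrib2)
    have xS: "mass x S = setfun B m S"
      using mx[OF SA] r.baseD(2)[OF yz(1)] by (simp add: setfun_restriction mass_def)
    have xA: "mass x A = setfun B m A"
      using mx[OF order_refl] r.baseD(2)[OF yz(1)] c.baseD(2)[OF yz(2)] SA
      by (simp add: setfun_restriction setfun_contraction Int_absorb1 Un_absorb2 Un_commute)
    have "setfun B m T \<le> mass x T" if T: "T \<in> B" for T
    proof -
      have TA: "T \<subseteq> A" by (rule subset_ground[OF T])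
      have "setfun B m (T \<inter> S) \<le> mass y (T \<inter> S)"
        using r.base_all[OF yz(1), of "T \<inter> S"] by (simp add: setfun_restriction)
      moreover have "setfun B m ((T - S) \<union> S) - setfun B m S \<le> mass z (T - S)"
        using c.base_all[OF yz(2), of "T - S"] TA setfun_contraction[of "T - S" S] by auto
      moreover have "setfun B m T + setfun B m S \<le> setfun B m (T \<union> S) + setfun B m (T \<inter> S)"
        using finite_building_set weight_pos by (intro setfun_supermodular) (auto intro: less_imp_le)
      ultimately show ?thesis unfolding mx[OF TA] by simp
    qed
    moreover have "Poly_Mapping.keys x \<subseteq> A"
    proof
      fix i assume i: "i \<in> Poly_Mapping.keys x"
      show "i \<in> A"
      proof (rule ccontr)
        assume "i \<notin> A"
        then have "Poly_Mapping.lookup x i = 0"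
          using ky[of i] kz[of i] SA by (auto simp: yz(3) lookup_add)
        then show False using i by (simp add: in_keys_iff)
      qed
    qed
    ultimately have "x \<in> P" using xA by (auto simp: base_polytope_def)
    then show "x \<in> face {S}" using xS S by (auto simp: tight_face_def tight_def)
  qed
qed

text \<open>Unit weights give both factors the same nested sets as before, and addition is injective
  on the product because the supports are disjoint.\<close>

lemma comb_equiv_face_single:
  assumes S: "S \<in> B" "S \<noteq> A"
  shows "comb_equiv (base_polytope S (restriction B S) (\<lambda>_. 1) \<times> base_polytope (A - S) (contraction B S) (\<lambda>_. 1))
    (face {S})"
proof -
  interpret r: weighted_building_set S "restriction B S" m by (rule weighted_restriction[OF S(1)])
  interpret c: weighted_building_set "A - S" "contraction B S" "contracted_weight B m S"
    by (rule weighted_contraction[OF S])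
  interpret r1: weighted_building_set S "restriction B S" "\<lambda>_. 1"
    by (intro weighted_building_set_one building_set_restriction S)
  interpret c1: weighted_building_set "A - S" "contraction B S" "\<lambda>_. 1"
    by (intro weighted_building_set_one building_set_contraction S)
  have "comb_equiv (r1.P \<times> c1.P) (r.P \<times> c.P)"
    by (intro comb_equiv_Times comb_equiv_base[where \<pi> = "\<lambda>i. i"] r.weighted_building_set_axioms
        c.weighted_building_set_axioms r1.weighted_building_set_axioms c1.weighted_building_set_axioms
        r.convex_base c.convex_base r1.convex_base c1.convex_base) (auto simp: bij_betw_def)
  also have "comb_equiv (r.P \<times> c.P) ((\<lambda>p. fst p + snd p) ` (r.P \<times> c.P))"
  proof (rule comb_equiv_linear_image_on)
    show "linear (\<lambda>p::('i \<Rightarrow>\<^sub>0 real) \<times> ('i \<Rightarrow>\<^sub>0 real). fst p + snd p)"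
      by (rule linearI) (auto simp: scaleR_add_right)
    show "convex (r.P \<times> c.P)" by (intro convex_Times r.convex_base c.convex_base)
    show "inj_on (\<lambda>p. fst p + snd p) (r.P \<times> c.P)"
    proof (rule inj_onI)
      fix p q assume p: "p \<in> r.P \<times> c.P" and q: "q \<in> r.P \<times> c.P" and eq: "fst p + snd p = fst q + snd q"
      have l: "Poly_Mapping.lookup (fst p) i + Poly_Mapping.lookup (snd p) i
        = Poly_Mapping.lookup (fst q) i + Poly_Mapping.lookup (snd q) i" for i
        using eq by (metis lookup_add)
      have r0: "Poly_Mapping.lookup (fst p) i = 0" "Poly_Mapping.lookup (fst q) i = 0" if "i \<notin> S" for i
        using r.baseD(1)[of "fst p"] r.baseD(1)[of "fst q"] p q that
        by (auto simp: mem_Times_iff simp flip: not_in_keys_iff_lookup_eq_zero)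
      have c0: "Poly_Mapping.lookup (snd p) i = 0" "Poly_Mapping.lookup (snd q) i = 0" if "i \<in> S" for i
        using c.baseD(1)[of "snd p"] c.baseD(1)[of "snd q"] p q that
        by (auto simp: mem_Times_iff simp flip: not_in_keys_iff_lookup_eq_zero)
      show "p = q"
      proof (rule prod_eqI; rule poly_mapping_eqI)
        fix i
        show "Poly_Mapping.lookup (fst p) i = Poly_Mapping.lookup (fst q) i"
          using l[of i] r0[of i] c0[of i] by (cases "i \<in> S") auto
        show "Poly_Mapping.lookup (snd p) i = Poly_Mapping.lookup (snd q) i"
          using l[of i] r0[of i] c0[of i] by (cases "i \<in> S") auto
      qed
    qed
  qed
  finally show ?thesis unfolding face_single_eq[OF S] .
qed

end


section \<open>Combinatorial types of nestohedra\<close>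

text \<open>Equivalent sets admit the same candidates for the choice in \<open>ctype\<close>, simple
  or not.\<close>

lemma ctype_cong:
  assumes "comb_equiv P P'" shows "ctype P = ctype P'"
proof -
  have "comb_equiv P Q \<longleftrightarrow> comb_equiv P' Q" for Q :: "(nat \<Rightarrow>\<^sub>0 real) set"
    using comb_equiv_trans[OF assms] comb_equiv_trans[OF comb_equiv_sym[OF assms]] by metis
  then show ?thesis by (simp add: ctype_def)
qed

lemma comb_equiv_rep:
  fixes P :: "(nat \<Rightarrow>\<^sub>0 real) set"
  assumes "simple_polytope P" shows "comb_equiv P (rep_cpolytope (ctype P))"
  using comb_equiv_rep_ctype[OF assms linear_id] by simp

lemma ctype_rep [simp]: "ctype (rep_cpolytope c) = c"
  using comb_equiv_rep[OF simple_rep_cpolytope] by (rule cpolytope_eqI[symmetric])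

lemma ctype_eqI: "comb_equiv P (rep_cpolytope c) \<Longrightarrow> ctype P = c"
  using ctype_cong ctype_rep by metis

lemma polytope_rep: "polytope (rep_cpolytope c)" "rep_cpolytope c \<noteq> {}"
  using simple_rep_cpolytope[of c] by (auto simp: simple_polytope_def)

lemma ctype_singleton: "ctype {x :: nat \<Rightarrow>\<^sub>0 real} = 0"
proof -
  have "comb_equiv {x} {0 :: nat \<Rightarrow>\<^sub>0 real}"
    by (rule comb_equiv_tight_systems[where N = "\<lambda>_. {} :: nat set" and M = "\<lambda>_. {} :: nat set" and h = id])
      (auto simp: tight_system_def bij_betw_def)
  then show ?thesis unfolding zero_cpolytope_def by (rule ctype_cong)
qed

lemma comb_equiv_Times_rep:
  assumes "comb_equiv P (rep_cpolytope a)" "comb_equiv Q (rep_cpolytope b)" "convex P" "convex Q"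
  shows "comb_equiv (P \<times> Q) (rep_cpolytope (a + b))"
  by (rule comb_equiv_trans[OF comb_equiv_Times[OF assms(1,2)] comb_equiv_rep_plus])
    (intro assms convex_rep_cpolytope)+

text \<open>Carries the data of a concrete polytope over to the representative chosen for its type,
  by \<open>graded_simple_iso\<close>.\<close>

lemma
  fixes P :: "(nat \<Rightarrow>\<^sub>0 real) set"
  assumes P: "graded_simple P"
  shows cdim_ctype: "cdim (ctype P) = pdim P"
    and graded_simple_rep: "graded_simple (rep_cpolytope (ctype P))"
    and boundary_ctype: "boundary (ctype P) = (\<Sum>F\<in>facets P. frag_of (ctype F))"
    and facets_rep: "F \<in> facets (rep_cpolytope (ctype P)) \<Longrightarrow> \<exists>F'\<in>facets P. comb_equiv F F'"
    and card_facets_rep: "card (facets (rep_cpolytope (ctype P))) = card (facets P)"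
proof -
  have "simple_polytope P" using P by (simp add: graded_simple_def)
  then obtain f where f: "face_iso f P (rep_cpolytope (ctype P))"
    using comb_equiv_rep comb_equiv_face_iso by blast
  note gs = graded_simple_iso[OF f P simple_rep_cpolytope]
  show "cdim (ctype P) = pdim P" unfolding cdim_def by (rule gs)
  show "graded_simple (rep_cpolytope (ctype P))" by (rule gs)
  have inj: "inj_on f (facets P)"
    using face_iso_eq[OF f] by (auto simp: inj_on_def facets_def)
  have eq: "comb_equiv F (f F)" if "F \<in> facets P" for F
    using that by (intro comb_equiv_face[OF f]) (simp add: facets_def)
  show "boundary (ctype P) = (\<Sum>F\<in>facets P. frag_of (ctype F))"
    unfolding boundary_def gs(3) sum.reindex[OF inj] using ctype_cong[OF eq] by simp
  show "\<exists>F'\<in>facets P. comb_equiv F F'" if "F \<in> facets (rep_cpolytope (ctype P))"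
    using that eq comb_equiv_sym unfolding gs(3) by blast
  show "card (facets (rep_cpolytope (ctype P))) = card (facets P)"
    unfolding gs(3) by (rule card_image[OF inj])
qed

definition btype :: "nat set \<Rightarrow> nat set set \<Rightarrow> cpolytope"
  where "btype A B = ctype (base_polytope A B (\<lambda>_. 1))"

definition facet_type :: "nat set \<Rightarrow> nat set set \<Rightarrow> nat set \<Rightarrow> cpolytope"
  where "facet_type A B S = btype S (restriction B S) + btype (A - S) (contraction B S)"

lemma btype_cong:
  assumes "building_set_on A B" "building_set_on A' B'"
    and "bij_betw \<pi> A A'" "\<And>S. S \<subseteq> A \<Longrightarrow> S \<in> B \<longleftrightarrow> \<pi> ` S \<in> B'"
  shows "btype A B = btype A' B'"
  unfolding btype_def using assms
  by (intro ctype_cong comb_equiv_base[of _ _ _ _ _ _ \<pi>] weighted_building_set_one)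

lemma ctype_nestohedron: "building_set_on A B \<Longrightarrow> ctype (nestohedron B) = btype A B"
  by (simp add: btype_def nestohedron_eq_base_polytope)

text \<open>Over \<open>nat\<close> with unit weights the base polytope is a nestohedron, hence
  generated by finitely many points; this discharges the assumption \<open>polytope P\<close> of the
  facet results.\<close>

locale nat_building_set = building_set_on A B for A :: "nat set" and B
begin

sublocale weighted_building_set A B "\<lambda>_. 1"
  by (rule weighted_building_set_one[OF building_set_on_axioms])

lemma polytope_base: "polytope P"
  using polytope_nestohedron[OF finite_building_set finite_member]
  by (simp add: nestohedron_eq_base_polytope[OF building_set_on_axioms])

lemmas graded = graded_simple_base[OF polytope_base]

lemma cdim_btype: "cdim (btype A B) + 1 = card A"
  unfolding btype_def cdim_ctype[OF graded] by (rule pdim_base[OF polytope_base])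

lemma graded_simple_btype: "graded_simple (rep_cpolytope (btype A B))"
  unfolding btype_def by (rule graded_simple_rep[OF graded])

lemma comb_equiv_btype: "comb_equiv P (rep_cpolytope (btype A B))"
  unfolding btype_def by (rule comb_equiv_rep[OF simple_base[OF polytope_base]])

lemma comb_equiv_facet:
  assumes S: "S \<in> B - {A}"
  shows "comb_equiv (face {S}) (rep_cpolytope (facet_type A B S))"
proof -
  interpret r: nat_building_set S "restriction B S"
    using building_set_restriction S by (simp add: nat_building_set_def)
  interpret c: nat_building_set "A - S" "contraction B S"
    using building_set_contraction S by (simp add: nat_building_set_def)
  have "comb_equiv (face {S}) (r.P \<times> c.P)"
    using S by (intro comb_equiv_sym[OF comb_equiv_face_single]) auto
  also have "comb_equiv (r.P \<times> c.P) (rep_cpolytope (facet_type A B S))"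
    unfolding facet_type_def
    by (intro comb_equiv_Times_rep r.comb_equiv_btype c.comb_equiv_btype r.convex_base c.convex_base)
  finally show ?thesis .
qed

lemma boundary_btype: "boundary (btype A B) = (\<Sum>S\<in>B - {A}. frag_of (facet_type A B S))"
  unfolding btype_def boundary_ctype[OF graded] facets_base[OF polytope_base]
    sum.reindex[OF inj_on_face[OF polytope_base]]
  using ctype_eqI[OF comb_equiv_facet] by simp

lemma facets_rep_btype:
  assumes "F \<in> facets (rep_cpolytope (btype A B))"
  obtains S where "S \<in> B - {A}" "comb_equiv F (rep_cpolytope (facet_type A B S))"
proof -
  obtain F' where F': "F' \<in> facets P" "comb_equiv F F'"
    using facets_rep[OF graded assms[unfolded btype_def]] by (rule bexE)
  then obtain S where S: "S \<in> B - {A}" "F' = face {S}"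
    unfolding facets_base[OF polytope_base] by auto
  show thesis
    by (rule that[OF S(1) comb_equiv_trans[OF F'(2)]]) (simp only: S(2) comb_equiv_facet[OF S(1)])
qed

lemma card_facets_btype: "card (facets (rep_cpolytope (btype A B))) = card B - 1"
proof -
  have "card (facets (rep_cpolytope (btype A B))) = card (B - {A})"
    unfolding btype_def card_facets_rep[OF graded] facets_base[OF polytope_base]
    by (rule card_image[OF inj_on_face[OF polytope_base]])
  then show ?thesis using ground finite_building_set by simp
qed

text \<open>
  In a product of two polytopes of positive dimension the facets are of two kinds, and facets of
  different kinds meet. Hence a polytope whose facets are connected through disjoint pairs is not
  such a product.
\<close>

lemma btype_indecomposable:
  assumes eq: "btype A B = a + b"
    and connected: "\<And>\<kappa> S T. (\<And>S T. S \<in> B - {A} \<Longrightarrow> T \<in> B - {A} \<Longrightarrow> \<not> S \<subseteq> T \<Longrightarrow> \<not> T \<subseteq> S \<Longrightarrow>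
        S \<union> T \<in> B \<Longrightarrow> \<kappa> S = \<kappa> T) \<Longrightarrow> S \<in> B - {A} \<Longrightarrow> T \<in> B - {A} \<Longrightarrow> \<kappa> S = (\<kappa> T :: bool)"
  shows "a = 0 \<or> b = 0"
proof (rule ccontr)
  assume neq: "\<not> ?thesis"
  let ?X = "rep_cpolytope a" and ?Y = "rep_cpolytope b"
  have cv: "convex ?X" "convex ?Y" by (rule convex_rep_cpolytope)+
  have ne: "?X \<noteq> {}" "?Y \<noteq> {}" by (rule polytope_rep)+
  have proper: "\<exists>F. F face_of rep_cpolytope c \<and> F \<noteq> {} \<and> F \<noteq> rep_cpolytope c" if c: "c \<noteq> 0" for c
  proof -
    obtain x where x: "x extreme_point_of rep_cpolytope c"
      using polytope_extreme_point_exists[OF polytope_rep] .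
    moreover have "{x} \<noteq> rep_cpolytope c"
      using c ctype_rep[of c] ctype_singleton[of x] by metis
    ultimately show ?thesis by (metis face_of_singleton insert_not_empty)
  qed
  have "comb_equiv (?X \<times> ?Y) P"
    using comb_equiv_trans[OF comb_equiv_rep_plus, of a b P] comb_equiv_sym[OF comb_equiv_btype]
    by (simp add: eq)
  then obtain f where f: "face_iso f (?X \<times> ?Y) P" using comb_equiv_face_iso by blast
  have cvXY: "convex (?X \<times> ?Y)" by (intro convex_Times cv)
  have top: "f (?X \<times> ?Y) = P" by (rule face_iso_top[OF f cvXY convex_base])
  have full: "?X face_of ?X" "?Y face_of ?Y" "?X \<times> ?Y face_of ?X \<times> ?Y"
    using cv cvXY by (simp_all add: face_of_refl)
  have kinds: "(\<exists>F. maxface ?X F \<and> f (F \<times> ?Y) = face {S}) \<or> (\<exists>G. maxface ?Y G \<and> f (?X \<times> G) = face {S})"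
    if S: "S \<in> B - {A}" for S
  proof -
    have "face {S} \<in> facets P" unfolding facets_base[OF polytope_base] using S by blast
    then have max: "maxface P (face {S})" by (rule facets_maxface[OF polytope_base])
    obtain C where C: "C face_of ?X \<times> ?Y" "f C = face {S}"
      using face_iso_surj[OF f face_face_of] by blast
    then have "maxface (?X \<times> ?Y) C" using maxface_iso[OF f cvXY convex_base C(1)] max by simp
    then show ?thesis using maxface_Times[OF cv] C(2) by blast
  qed
  \<comment> \<open>\<open>\<kappa>\<close> marks the facets of the first kind. The hypothesis
    \<open>connected\<close> states connectivity through colourings: a two-colouring constant on
    linked pairs is constant.\<close>
  define \<kappa> where "\<kappa> S \<longleftrightarrow> (\<exists>F. maxface ?X F \<and> f (F \<times> ?Y) = face {S})" for S
  have diff: "face {S} \<inter> face {T} \<noteq> {}" if S: "\<kappa> S" and T: "\<not> \<kappa> T" "T \<in> B - {A}" for S T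
  proof -
    obtain F where F: "maxface ?X F" "f (F \<times> ?Y) = face {S}" using S by (auto simp: \<kappa>_def)
    obtain G where G: "maxface ?Y G" "f (?X \<times> G) = face {T}" using T(1) kinds[OF T(2)] unfolding \<kappa>_def by blast
    have FG: "F face_of ?X" "F \<noteq> {}" "G face_of ?Y" "G \<noteq> {}" using F G by (auto simp: maxface_def)
    then have faces: "F \<times> G face_of ?X \<times> ?Y" "F \<times> ?Y face_of ?X \<times> ?Y" "?X \<times> G face_of ?X \<times> ?Y"
      using full by (simp_all add: face_of_Times)
    have "f (F \<times> G) \<subseteq> face {S}" "f (F \<times> G) \<subseteq> face {T}"
      using face_iso_subset[OF f faces(1,2)] face_iso_subset[OF f faces(1,3)] F(2) G(2)
        face_of_imp_subset[OF FG(1)] face_of_imp_subset[OF FG(3)] by auto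
    moreover have "f (F \<times> G) \<noteq> {}" using face_iso_empty_iff[OF f faces(1)] FG by auto
    ultimately show ?thesis by blast
  qed
  have const: "\<kappa> S = \<kappa> T" if "S \<in> B - {A}" "T \<in> B - {A}" for S T
  proof (rule connected[OF _ that])
    fix S T assume "S \<in> B - {A}" "T \<in> B - {A}" "\<not> S \<subseteq> T" "\<not> T \<subseteq> S" "S \<union> T \<in> B"
    then have "face {S} \<inter> face {T} = {}" by (intro facets_disjoint[OF polytope_base]) auto
    then show "\<kappa> S = \<kappa> T"
      using diff[of S T] diff[of T S] \<open>S \<in> B - {A}\<close> \<open>T \<in> B - {A}\<close> by (auto simp: Int_commute)
  qed
  \<comment> \<open>Every proper nonempty face lies in a facet, being the face of a nonempty nested
    set.\<close>
  have above: "\<exists>S\<in>B - {A}. f C \<subseteq> face {S}" if C: "C face_of ?X \<times> ?Y" "C \<noteq> {}" "C \<noteq> ?X \<times> ?Y" for C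
  proof -
    have "f C face_of P" "f C \<noteq> {}"
      using face_iso_face[OF f C(1)] face_iso_empty_iff[OF f C(1)] C(2) by auto
    then obtain N where N: "nested A B N" "f C = face N" using face_of_nested by blast
    have "f C \<noteq> P" using face_iso_eq[OF f C(1) full(3)] C(3) top by simp
    then have "N \<noteq> {}" using N(2) face_empty by metis
    then obtain S where S: "S \<in> N" by auto
    show ?thesis
    proof (rule bexI)
      show "f C \<subseteq> face {S}" unfolding N(2) using S by (auto simp: tight_face_def)
    qed (use nested_member[OF N(1) S] in simp)
  qed
  from neq have ab: "a \<noteq> 0" "b \<noteq> 0" by auto
  obtain F where F: "F face_of ?X" "F \<noteq> {}" "F \<noteq> ?X" using proper[OF ab(1)] by auto
  obtain G where G: "G face_of ?Y" "G \<noteq> {}" "G \<noteq> ?Y" using proper[OF ab(2)] by auto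
  have XG: "?X \<times> G face_of ?X \<times> ?Y" and FY: "F \<times> ?Y face_of ?X \<times> ?Y"
    using F G full by (simp_all add: face_of_Times)
  obtain S where S: "S \<in> B - {A}" "f (?X \<times> G) \<subseteq> face {S}"
    using above[OF XG] G ne by (auto simp: times_eq_iff)
  obtain T where T: "T \<in> B - {A}" "f (F \<times> ?Y) \<subseteq> face {T}"
    using above[OF FY] F ne by (auto simp: times_eq_iff)
  \<comment> \<open>All facets are of one kind. If it is the first, the facet above
    \<open>?X \<times> G\<close> has a proper first factor containing \<open>?X\<close>; if it is
    the second, the same happens with \<open>F \<times> ?Y\<close> and \<open>?Y\<close>.\<close>
  show False
  proof (cases "\<kappa> S")
    case True
    then obtain F' where F': "maxface ?X F'" "f (F' \<times> ?Y) = face {S}" by (auto simp: \<kappa>_def)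
    then have "F' face_of ?X" "F' \<noteq> ?X" by (auto simp: maxface_def)
    moreover from this have "F' \<times> ?Y face_of ?X \<times> ?Y" using full by (simp add: face_of_Times)
    then have "?X \<times> G \<subseteq> F' \<times> ?Y" using face_iso_subset[OF f XG] S(2) F'(2) by metis
    ultimately show False using G(2) face_of_imp_subset by (auto simp: times_subset_iff)
  next
    case False
    then have "\<not> \<kappa> T" using const S T by blast
    then obtain G' where G': "maxface ?Y G'" "f (?X \<times> G') = face {T}" using kinds[OF T(1)] unfolding \<kappa>_def by blast
    then have "G' face_of ?Y" "G' \<noteq> ?Y" by (auto simp: maxface_def)
    moreover from this have "?X \<times> G' face_of ?X \<times> ?Y" using full by (simp add: face_of_Times)
    then have "F \<times> ?Y \<subseteq> ?X \<times> G'" using face_iso_subset[OF f FY] T(2) G'(2) by metis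
    ultimately show False using F(2) face_of_imp_subset by (auto simp: times_subset_iff)
  qed
qed

end


section \<open>The four families of building sets\<close>

text \<open>All four families are given by a condition on the sets with at least two elements.
  Restriction keeps the condition and contraction replaces it by another one, so facets can be found
  by manipulating conditions.\<close>

definition bfam :: "('i set \<Rightarrow> bool) \<Rightarrow> 'i set \<Rightarrow> 'i set set"
  where "bfam \<phi> A = {S. S \<subseteq> A \<and> S \<noteq> {} \<and> (is_singleton S \<or> \<phi> S)}"

lemma building_set_bfam:
  assumes "finite A" "A \<noteq> {}" "is_singleton A \<or> \<phi> A"
    and "\<And>S T. \<phi> S \<Longrightarrow> \<phi> T \<Longrightarrow> \<phi> (S \<union> T)"
  shows "building_set_on A (bfam \<phi> A)"
proof
  fix S T assume "S \<in> bfam \<phi> A" "T \<in> bfam \<phi> A" and meet: "S \<inter> T \<noteq> {}"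
  then have ST: "S \<subseteq> A" "S \<noteq> {}" "is_singleton S \<or> \<phi> S" "T \<subseteq> A" "is_singleton T \<or> \<phi> T"
    by (auto simp: bfam_def)
  show "S \<union> T \<in> bfam \<phi> A"
  proof (cases "is_singleton S \<or> is_singleton T")
    case True
    then have "S \<union> T = S \<or> S \<union> T = T" using meet by (auto simp: is_singleton_def)
    then show ?thesis using \<open>S \<in> bfam \<phi> A\<close> \<open>T \<in> bfam \<phi> A\<close> by auto
  next
    case False
    then show ?thesis using ST assms(4) by (auto simp: bfam_def)
  qed
qed (use assms in \<open>auto simp: bfam_def\<close>)

lemma restriction_bfam: "S \<subseteq> A \<Longrightarrow> restriction (bfam \<phi> A) S = bfam \<phi> S"
  by (auto simp: restriction_def bfam_def)

text \<open>\<open>V\<close> is the part of a member that the contraction removes. Singleton members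
  outside \<open>S\<close> leave themselves, so the form \<open>bfam\<close> persists.\<close>

lemma contraction_bfam:
  assumes "S \<subseteq> A"
  shows "contraction (bfam \<phi> A) S = bfam (\<lambda>U. \<exists>V\<subseteq>S. \<phi> (U \<union> V)) (A - S)"
proof (intro equalityI subsetI)
  fix U assume "U \<in> contraction (bfam \<phi> A) S"
  then obtain T where T: "T \<subseteq> A" "is_singleton T \<or> \<phi> T" "\<not> T \<subseteq> S" "U = T - S"
    by (auto simp: contraction_def bfam_def)
  have "is_singleton U \<or> (\<exists>V\<subseteq>S. \<phi> (U \<union> V))"
  proof (cases "is_singleton T")
    case True
    then show ?thesis using T by (auto simp: is_singleton_def)
  next
    case False
    have "U \<union> (T \<inter> S) = T" using T by auto
    then show ?thesis using T False by (metis Int_lower2)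
  qed
  then show "U \<in> bfam (\<lambda>U. \<exists>V\<subseteq>S. \<phi> (U \<union> V)) (A - S)" using T by (auto simp: bfam_def)
next
  fix U assume "U \<in> bfam (\<lambda>U. \<exists>V\<subseteq>S. \<phi> (U \<union> V)) (A - S)"
  then have U: "U \<subseteq> A - S" "U \<noteq> {}" "is_singleton U \<or> (\<exists>V\<subseteq>S. \<phi> (U \<union> V))" by (auto simp: bfam_def)
  then obtain V where V: "V \<subseteq> S" "is_singleton (U \<union> V) \<or> \<phi> (U \<union> V)"
    by (metis empty_subsetI sup_bot_right)
  have "U = (U \<union> V) - S" using U V by auto
  moreover have "U \<union> V \<in> {T \<in> bfam \<phi> A. \<not> T \<subseteq> S}" using U V assms by (auto simp: bfam_def)
  ultimately show "U \<in> contraction (bfam \<phi> A) S" unfolding contraction_def by blast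
qed

lemma bfam_cong:
  assumes "A = A'" "\<And>S. S \<subseteq> A \<Longrightarrow> S \<noteq> {} \<Longrightarrow> \<not> is_singleton S \<Longrightarrow> \<phi> S \<longleftrightarrow> \<psi> S"
  shows "bfam \<phi> A = bfam \<psi> A'"
  using assms by (auto simp: bfam_def)

lemma btype_bfam_cong:
  assumes "building_set_on A (bfam \<phi> A)" "building_set_on A' (bfam \<psi> A')"
    and \<pi>: "bij_betw \<pi> A A'" and eq: "\<And>S. S \<subseteq> A \<Longrightarrow> \<phi> S \<longleftrightarrow> \<psi> (\<pi> ` S)"
  shows "btype A (bfam \<phi> A) = btype A' (bfam \<psi> A')"
proof (rule btype_cong[OF assms(1,2) \<pi>])
  fix S assume S: "S \<subseteq> A"
  have "is_singleton (\<pi> ` S) \<longleftrightarrow> is_singleton S"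
    using card_image[OF inj_on_subset[OF bij_betw_imp_inj_on[OF \<pi>] S]] by (simp add: is_singleton_altdef)
  moreover have "\<pi> ` S \<subseteq> A'" using S bij_betw_imp_surj_on[OF \<pi>] by blast
  ultimately show "S \<in> bfam \<phi> A \<longleftrightarrow> \<pi> ` S \<in> bfam \<psi> A'" using S eq[OF S] by (auto simp: bfam_def)
qed

text \<open>Supplies relabellings of a ground set with prescribed images of the distinguished
  points; as \<open>xs\<close> is distinct, the index chosen for \<open>h\<close> is unique.\<close>

lemma bij_betw_extending:
  assumes "finite A" "finite A'" "card A = card A'" "distinct xs" "distinct ys" "length xs = length ys"
    "set xs \<subseteq> A" "set ys \<subseteq> A'"
  obtains \<pi> where "bij_betw \<pi> A A'" "map \<pi> xs = ys"
proof -
  have fin: "finite (A - set xs)" "finite (A' - set ys)" using assms by auto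
  have "card (A - set xs) = card (A' - set ys)"
    using assms by (simp add: card_Diff_subset distinct_card)
  then obtain g where g: "bij_betw g (A - set xs) (A' - set ys)"
    using finite_same_card_bij[OF fin] by blast
  define h where "h x = ys ! (SOME i. i < length xs \<and> xs ! i = x)" for x
  have h: "h (xs ! i) = ys ! i" if "i < length xs" for i
  proof -
    have "j = i" if "j < length xs \<and> xs ! j = xs ! i" for j
      using that \<open>i < length xs\<close> nth_eq_iff_index_eq[OF assms(4), of j i] by blast
    then have "(SOME j. j < length xs \<and> xs ! j = xs ! i) = i" using that by (intro some_equality) auto
    then show ?thesis by (simp add: h_def)
  qed
  then have map: "map h xs = ys" using assms(6) by (intro nth_equalityI) auto
  then have "inj_on h (set xs)" using assms(5) distinct_map by blast
  moreover have "h ` set xs = set ys" using map by (metis set_map)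
  ultimately have hb: "bij_betw h (set xs) (set ys)" by (simp add: bij_betw_def)
  define \<pi> where "\<pi> x = (if x \<in> set xs then h x else g x)" for x
  have "bij_betw \<pi> (set xs \<union> (A - set xs)) (set ys \<union> (A' - set ys))"
  proof (rule bij_betw_combine)
    show "bij_betw \<pi> (set xs) (set ys)"
      using hb by (subst bij_betw_cong[of _ _ h]) (auto simp: \<pi>_def)
    show "bij_betw \<pi> (A - set xs) (A' - set ys)"
      using g by (subst bij_betw_cong[of _ _ g]) (auto simp: \<pi>_def)
  qed auto
  then have "bij_betw \<pi> A A'" using assms by (simp add: Un_absorb1)
  moreover have "map \<pi> xs = ys" using map by (metis (no_types, lifting) \<pi>_def map_eq_conv)
  ultimately show thesis by (rule that)
qed


abbreviation (input) "full_cond \<equiv> (\<lambda>S. True)"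
abbreviation (input) "star_cond a \<equiv> (\<lambda>S. a \<in> S)"
abbreviation (input) "gamma_cond p q \<equiv> (\<lambda>S. p \<in> S \<or> q \<notin> S)"
abbreviation (input) "mas_cond a b z \<equiv> (\<lambda>S. a \<in> S \<and> (b \<in> S \<or> z \<notin> S))"

lemma building_full: "finite A \<Longrightarrow> A \<noteq> {} \<Longrightarrow> building_set_on A (bfam full_cond A)"
  by (rule building_set_bfam) auto

lemma building_star: "finite A \<Longrightarrow> a \<in> A \<Longrightarrow> building_set_on A (bfam (star_cond a) A)"
  by (rule building_set_bfam) auto

lemma building_gamma: "finite A \<Longrightarrow> p \<in> A \<Longrightarrow> building_set_on A (bfam (gamma_cond p q) A)"
  by (rule building_set_bfam) auto

lemma building_mas: "finite A \<Longrightarrow> a \<in> A \<Longrightarrow> b \<in> A \<Longrightarrow> building_set_on A (bfam (mas_cond a b z) A)"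
  by (rule building_set_bfam) auto

section \<open>The given building sets in the form \<open>bfam\<close>\<close>

lemma graphical_complete: "graphical_building_set n (complete_graph n) = bfam full_cond {1..n+1}"
proof -
  have "(u, v) \<in> (Restr (complete_graph n) S)\<^sup>*" if "S \<subseteq> {1..n+1}" "u \<in> S" "v \<in> S" for S u v
  proof (cases "u = v")
    case False
    then have "(u, v) \<in> Restr (complete_graph n) S" using that by (auto simp: complete_graph_def)
    then show ?thesis by (rule r_into_rtrancl)
  qed simp
  then show ?thesis unfolding graphical_building_set_def bfam_def by blast
qed

lemma graphical_star: "graphical_building_set n (star_graph n) = bfam (star_cond 1) {1..n+1}"
proof -
  have "(\<forall>u\<in>S. \<forall>v\<in>S. (u, v) \<in> (Restr (star_graph n) S)\<^sup>*) \<longleftrightarrow> is_singleton S \<or> 1 \<in> S"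
    if S: "S \<subseteq> {1..n+1}" "S \<noteq> {}" for S
  proof
    assume *: "\<forall>u\<in>S. \<forall>v\<in>S. (u, v) \<in> (Restr (star_graph n) S)\<^sup>*"
    show "is_singleton S \<or> 1 \<in> S"
    proof (rule disjCI)
      assume "1 \<notin> S"
      then have "Restr (star_graph n) S = {}" by (auto simp: star_graph_def)
      then have "u = v" if "u \<in> S" "v \<in> S" for u v using * that by auto
      then show "is_singleton S" using S(2) by (intro is_singletonI') auto
    qed
  next
    assume "is_singleton S \<or> 1 \<in> S"
    then show "\<forall>u\<in>S. \<forall>v\<in>S. (u, v) \<in> (Restr (star_graph n) S)\<^sup>*"
    proof
      assume 1: "1 \<in> S"
      have "(u, 1) \<in> (Restr (star_graph n) S)\<^sup>*" "(1, u) \<in> (Restr (star_graph n) S)\<^sup>*" if "u \<in> S" for u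
      proof -
        have "u = 1 \<or> (u, 1) \<in> Restr (star_graph n) S \<and> (1, u) \<in> Restr (star_graph n) S"
          using that 1 S by (auto simp: star_graph_def)
        then show "(u, 1) \<in> (Restr (star_graph n) S)\<^sup>*" "(1, u) \<in> (Restr (star_graph n) S)\<^sup>*" by auto
      qed
      then show ?thesis by (meson rtrancl_trans)
    qed (auto simp: is_singleton_def)
  qed
  then show ?thesis unfolding graphical_building_set_def bfam_def by blast
qed

lemma B_Mas_eq:
  assumes "n \<ge> 2" shows "B_Mas n = bfam (mas_cond 1 2 (n+1)) {1..n+1}"
proof (intro equalityI subsetI)
  fix S assume "S \<in> B_Mas n"
  then show "S \<in> bfam (mas_cond 1 2 (n+1)) {1..n+1}"
    using assms unfolding B_Mas_def bfam_def by auto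
next
  fix S assume "S \<in> bfam (mas_cond 1 2 (n+1)) {1..n+1}"
  then have S: "S \<subseteq> {1..n+1}" "S \<noteq> {}" "is_singleton S \<or> 1 \<in> S \<and> (2 \<in> S \<or> n + 1 \<notin> S)"
    by (auto simp: bfam_def)
  have ge3: "i \<in> {3..n+1}" if "i \<in> S" "i \<noteq> 1" "i \<noteq> 2" for i
  proof -
    have "1 \<le> i" "i \<le> n + 1" using S(1) that(1) by auto
    then show ?thesis using that by auto
  qed
  consider i where "S = {i}" | "\<not> is_singleton S" "2 \<in> S" | "\<not> is_singleton S" "2 \<notin> S"
    by (auto simp: is_singleton_def)
  then show "S \<in> B_Mas n"
  proof cases
    case 1
    then show ?thesis using S unfolding B_Mas_def by auto
  next
    case 2
    then have "S = {1, 2} \<union> (S - {1, 2})" using S by auto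
    moreover have "S - {1, 2} \<subseteq> {3..n+1}" using ge3 by blast
    ultimately show ?thesis unfolding B_Mas_def by blast
  next
    case 3
    then have *: "S = {1} \<union> (S - {1})" "n + 1 \<notin> S" using S by auto
    moreover have "S - {1} \<noteq> {}" using 3 S by (metis is_singletonI insert_Diff_single is_singleton_def insert_absorb Diff_eq_empty_iff subset_singletonD)
    moreover have "S - {1} \<subseteq> {3..n}"
    proof
      fix i assume i: "i \<in> S - {1}"
      then have "i \<noteq> n + 1" "i \<noteq> 2" using * 3 by auto
      then show "i \<in> {3..n}" using ge3[of i] i by auto
    qed
    ultimately have "S \<in> {{1} \<union> J |J. J \<noteq> {} \<and> J \<subseteq> {3..n}}" by blast
    then show ?thesis unfolding B_Mas_def by simp
  qed
qed

lemma B_Gamma_eq: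
  assumes "n \<ge> 2" shows "B_Gamma n = bfam (gamma_cond 1 (n+1)) {1..n+1}"
proof (intro equalityI subsetI)
  fix S assume "S \<in> B_Gamma n"
  then consider i where "S = {i}" "i \<in> {1..n+1}" | "S \<subseteq> {1..n}" "card S \<ge> 2" | J where "S = {1, n+1} \<union> J" "J \<subseteq> {2..n}"
    unfolding B_Gamma_def by auto
  then show "S \<in> bfam (gamma_cond 1 (n+1)) {1..n+1}"
    by cases (use assms in \<open>auto simp: bfam_def\<close>)
next
  fix S assume "S \<in> bfam (gamma_cond 1 (n+1)) {1..n+1}"
  then have S: "S \<subseteq> {1..n+1}" "S \<noteq> {}" "is_singleton S \<or> 1 \<in> S \<or> n + 1 \<notin> S"
    by (auto simp: bfam_def)
  consider i where "S = {i}" | "\<not> is_singleton S" "n + 1 \<in> S" | "\<not> is_singleton S" "n + 1 \<notin> S"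
    by (auto simp: is_singleton_def)
  then show "S \<in> B_Gamma n"
  proof cases
    case 1
    then show ?thesis using S unfolding B_Gamma_def by auto
  next
    case 2
    then have "S = {1, n+1} \<union> (S - {1, n+1})" using S by auto
    moreover have "S - {1, n+1} \<subseteq> {2..n}"
    proof
      fix i assume i: "i \<in> S - {1, n+1}"
      then have "1 \<le> i" "i \<le> n + 1" using S(1) by auto
      then show "i \<in> {2..n}" using i by auto
    qed
    ultimately show ?thesis unfolding B_Gamma_def by blast
  next
    case 3
    have "finite S" using S finite_subset by blast
    then have "card S \<noteq> 0" "card S \<noteq> 1" using 3 S by (auto simp: is_singleton_altdef)
    moreover have "S \<subseteq> {1..n}"
    proof
      fix i assume i: "i \<in> S"
      then have "1 \<le> i" "i \<le> n + 1" "i \<noteq> n + 1" using S(1) 3 by auto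
      then show "i \<in> {1..n}" by auto
    qed
    ultimately show ?thesis unfolding B_Gamma_def by auto
  qed
qed

text \<open>This and its three analogues allow any ground set of the right size with any choice of
  distinguished points; thus factors on \<open>S\<close> and \<open>A - S\<close> are recognised as
  members of the families.\<close>

lemma Pe_eq:
  assumes "finite A" "card A = n + 1"
  shows "Pe n = btype A (bfam full_cond A)"
proof -
  have "A \<noteq> {}" using assms by auto
  obtain \<pi> where \<pi>: "bij_betw \<pi> A {1..n+1}"
    using bij_betw_extending[of A "{1..n+1}" "[]" "[]"] assms by auto
  have "btype A (bfam full_cond A) = btype {1..n+1} (bfam full_cond {1..n+1})"
    using assms \<open>A \<noteq> {}\<close> by (intro btype_bfam_cong[OF _ _ \<pi>] building_full) auto
  then show ?thesis
    unfolding Pe_def graphical_complete by (simp add: ctype_nestohedron[OF building_full])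
qed

lemma St_eq:
  assumes "finite A" "card A = n + 1" "a \<in> A"
  shows "St n = btype A (bfam (star_cond a) A)"
proof -
  obtain \<pi> where \<pi>: "bij_betw \<pi> A {1..n+1}" "map \<pi> [a] = [1]"
    by (rule bij_betw_extending[of A "{1..n+1}" "[a]" "[1]"]) (use assms in auto)
  have "btype A (bfam (star_cond a) A) = btype {1..n+1} (bfam (star_cond 1) {1..n+1})"
    using assms \<pi>(2) inj_on_image_mem_iff[OF bij_betw_imp_inj_on[OF \<pi>(1)], of a]
    by (intro btype_bfam_cong[OF _ _ \<pi>(1)] building_star) auto
  then show ?thesis
    unfolding St_def graphical_star by (simp add: ctype_nestohedron[OF building_star])
qed

lemma comb_equiv_segment: "comb_equiv (base_polytope {2, 3::nat} (bfam full_cond {2, 3}) (\<lambda>_. 1)) {0..1::real}"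
proof -
  interpret nat_building_set "{2, 3::nat}" "bfam full_cond {2, 3}"
    unfolding nat_building_set_def by (rule building_full) auto
  have B: "bfam full_cond {2, 3::nat} = {{2}, {3}, {2, 3}}"
    by (auto simp: bfam_def)
  have s1: "setfun (bfam full_cond {2, 3::nat}) (\<lambda>_. 1) {2} = 1"
  proof -
    have "{T \<in> bfam full_cond {2, 3::nat}. T \<subseteq> {2}} = {{2}}" unfolding B by auto
    then show ?thesis by (simp add: setfun_def)
  qed
  have s2: "setfun (bfam full_cond {2, 3::nat}) (\<lambda>_. 1) {3} = 1"
  proof -
    have "{T \<in> bfam full_cond {2, 3::nat}. T \<subseteq> {3}} = {{3}}" unfolding B by auto
    then show ?thesis by (simp add: setfun_def)
  qed
  have s3: "setfun (bfam full_cond {2, 3::nat}) (\<lambda>_. 1) {2, 3} = 3"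
  proof -
    have "{T \<in> bfam full_cond {2, 3::nat}. T \<subseteq> {2, 3}} = {{2}, {3}, {2, 3}}" unfolding B by auto
    moreover have "card {{2}, {3}, {2, 3::nat}} = 3" by (simp add: doubleton_eq_iff)
    ultimately show ?thesis by (simp add: setfun_def)
  qed
  have P: "P = {x. Poly_Mapping.keys x \<subseteq> {2, 3} \<and> Poly_Mapping.lookup x 2 + Poly_Mapping.lookup x 3 = 3 \<and>
    Poly_Mapping.lookup x 2 \<ge> 1 \<and> Poly_Mapping.lookup x 3 \<ge> 1}"
   
  proof -
    have "(\<forall>S\<in>bfam full_cond {2, 3}. setfun (bfam full_cond {2, 3}) (\<lambda>_. 1) S \<le> mass x S) \<longleftrightarrow>
      1 \<le> mass x {2} \<and> 1 \<le> mass x {3} \<and> 3 \<le> mass x {2, 3}" for x :: "nat \<Rightarrow>\<^sub>0 real"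
      by (subst B) (simp add: s1 s2 s3)
    then show ?thesis unfolding base_polytope_def s3 by (auto simp: mass_def)
  qed
  \<comment> \<open>The coordinate at 2 runs from 1 to 2. Since the total mass is 3 on
    \<open>P\<close>, a third of it equals 1, which realises the shift to \<open>{0..1}\<close> by a
    linear map.\<close>
  let ?f = "\<lambda>x::nat \<Rightarrow>\<^sub>0 real. Poly_Mapping.lookup x 2 - (Poly_Mapping.lookup x 2 + Poly_Mapping.lookup x 3) / 3"
  have "?f ` P = {0..1}"
  proof (intro equalityI subsetI)
    fix t :: real assume t: "t \<in> {0..1}"
    let ?x = "Poly_Mapping.single 2 (1 + t) + Poly_Mapping.single 3 (2 - t) :: nat \<Rightarrow>\<^sub>0 real"
    have l: "Poly_Mapping.lookup ?x i = (if i = 2 then 1 + t else if i = 3 then 2 - t else 0)" for i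
      by (auto simp: lookup_add lookup_single when_def)
    have "?x \<in> P" unfolding P using t by (auto simp: l in_keys_iff split: if_splits)
    moreover have "?f ?x = t" by (simp add: l)
    ultimately show "t \<in> ?f ` P" by (metis (no_types, lifting) image_eqI)
  qed (auto simp: P)
  moreover have "comb_equiv P (?f ` P)"
  proof (rule comb_equiv_linear_image_on[OF _ _ convex_base])
    show "linear ?f" by (rule linearI) (auto simp: lookup_add lookup_scaleR algebra_simps add_divide_distrib)
    show "inj_on ?f P"
    proof (rule inj_onI)
      fix x y assume xy: "x \<in> P" "y \<in> P" "?f x = ?f y"
      then have "Poly_Mapping.lookup x 2 = Poly_Mapping.lookup y 2" "Poly_Mapping.lookup x 3 = Poly_Mapping.lookup y 3"
        by (auto simp: P)
      moreover have "Poly_Mapping.lookup x i = 0 \<and> Poly_Mapping.lookup y i = 0" if "i \<noteq> 2" "i \<noteq> 3" for i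
        using xy that by (auto simp: P subset_iff in_keys_iff)
      ultimately show "x = y" by (intro poly_mapping_eqI) metis
    qed
  qed
  ultimately show ?thesis by simp
qed

lemma segment_eq: "segment = Pe 1"
  using ctype_cong[OF comb_equiv_segment] Pe_eq[of "{2, 3}" 1] by (simp add: segment_def btype_def)

text \<open>The separate definition in dimension 1 fits the pattern: on two points the only
  non-singleton contains \<open>p\<close>, so the condition is vacuous and the segment
  \<open>Pe 1\<close> results.\<close>

lemma P_Gamma_eq:
  assumes "finite A" "card A = n + 1" "p \<in> A" "q \<in> A" "p \<noteq> q"
  shows "P_Gamma n = btype A (bfam (gamma_cond p q) A)"
proof -
  have "card {p, q} \<le> card A" using assms by (intro card_mono) auto
  then have n: "n \<ge> 1" using assms by simp
  show ?thesis
  proof (cases "n = 1")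
    case True
    then have "{p, q} = A" using assms by (intro card_subset_eq) auto
    then have "bfam (gamma_cond p q) A = bfam full_cond A"
      by (intro bfam_cong) (auto simp: is_singleton_def)
    then show ?thesis using True assms by (simp add: P_Gamma_def segment_eq Pe_eq)
  next
    case False
    then have n: "n \<ge> 2" using n by simp
    obtain \<pi> where \<pi>: "bij_betw \<pi> A {1..n+1}" "map \<pi> [p, q] = [1, n + 1]"
      by (rule bij_betw_extending[of A "{1..n+1}" "[p, q]" "[1, n + 1]"]) (use assms n in auto)
    have "btype A (bfam (gamma_cond p q) A) = btype {1..n+1} (bfam (gamma_cond 1 (n+1)) {1..n+1})"
      using assms \<pi>(2) inj_on_image_mem_iff[OF bij_betw_imp_inj_on[OF \<pi>(1)], of p]
        inj_on_image_mem_iff[OF bij_betw_imp_inj_on[OF \<pi>(1)], of q]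
      by (intro btype_bfam_cong[OF _ _ \<pi>(1)] building_gamma) auto
    then show ?thesis
      using n unfolding P_Gamma_def B_Gamma_eq[OF n] by (simp add: ctype_nestohedron[OF building_gamma])
  qed
qed

text \<open>Three distinct points force \<open>n \<ge> 2\<close>, which keeps clear of the
  separately defined values of \<open>P_Mas\<close>.\<close>

lemma P_Mas_eq:
  assumes "finite A" "card A = n + 1" "a \<in> A" "b \<in> A" "z \<in> A" "distinct [a, b, z]"
  shows "P_Mas n = btype A (bfam (mas_cond a b z) A)"
proof -
  have "card {a, b, z} \<le> card A" using assms by (intro card_mono) auto
  then have n: "n \<ge> 2" using assms by simp
  obtain \<pi> where \<pi>: "bij_betw \<pi> A {1..n+1}" "map \<pi> [a, b, z] = [1, 2, n + 1]"
    by (rule bij_betw_extending[of A "{1..n+1}" "[a, b, z]" "[1, 2, n + 1]"]) (use assms n in auto)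
  have "btype A (bfam (mas_cond a b z) A) = btype {1..n+1} (bfam (mas_cond 1 2 (n+1)) {1..n+1})"
    using assms n \<pi>(2) inj_on_image_mem_iff[OF bij_betw_imp_inj_on[OF \<pi>(1)], of a]
      inj_on_image_mem_iff[OF bij_betw_imp_inj_on[OF \<pi>(1)], of b]
      inj_on_image_mem_iff[OF bij_betw_imp_inj_on[OF \<pi>(1)], of z]
    by (intro btype_bfam_cong[OF _ _ \<pi>(1)] building_mas) auto
  then show ?thesis
    using n unfolding P_Mas_def B_Mas_eq[OF n] by (simp add: ctype_nestohedron[OF building_mas])
qed

lemma Pe_0: "Pe 0 = 0"
proof -
  interpret nat_building_set "{1}" "bfam full_cond {1}"
    unfolding nat_building_set_def by (rule building_full) auto
  obtain x where x: "x extreme_point_of P"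
    by (rule polytope_extreme_point_exists[OF polytope_base])
      (use face_nonempty[OF nested_empty] face_empty in auto)
  have "pdim P = 0" using pdim_base[OF polytope_base] by simp
  then have "{x} = P"
    using x by (intro face_of_same_pdim[OF polytope_base]) (auto simp: face_of_singleton)
  then show ?thesis using Pe_eq[of "{1}" 0] ctype_singleton[of x] by (simp add: btype_def)
qed

lemma btype_singleton: "btype {j} (bfam \<phi> {j}) = 0"
proof -
  have "bfam \<phi> {j} = bfam full_cond {j}" by (auto simp: bfam_def is_singleton_def)
  then show ?thesis using Pe_eq[of "{j}" 0] Pe_0 by simp
qed

lemma St_0: "St 0 = 0"
  using St_eq[of "{1}" 0 1] by (simp add: btype_singleton)

lemma P_Mas_0: "P_Mas 0 = 0" and P_Gamma_0: "P_Gamma 0 = 0"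
  and P_Mas_1: "P_Mas 1 = Pe 1" and P_Gamma_1: "P_Gamma 1 = Pe 1"
  by (simp_all add: P_Mas_def P_Gamma_def segment_eq)


section \<open>The facets in the four families\<close>

lemma facet_type_bfam:
  assumes "S \<subseteq> A" "bfam (\<lambda>U. \<exists>V\<subseteq>S. \<phi> (U \<union> V)) (A - S) = bfam \<psi> (A - S)"
  shows "facet_type A (bfam \<phi> A) S = btype S (bfam \<phi> S) + btype (A - S) (bfam \<psi> (A - S))"
  unfolding facet_type_def restriction_bfam[OF assms(1)] contraction_bfam[OF assms(1)] assms(2) ..

lemma card_proper:
  assumes "finite A" "S \<in> bfam \<phi> A - {A}"
  shows "finite S" "finite (A - S)" "card S = card S - 1 + 1" "card (A - S) = card (A - S) - 1 + 1"
    "S \<subseteq> A" "S \<noteq> {}" "A - S \<noteq> {}"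
proof -
  show S: "S \<subseteq> A" "S \<noteq> {}" "A - S \<noteq> {}" using assms(2) by (auto simp: bfam_def)
  show fin: "finite S" "finite (A - S)" using S assms(1) finite_subset by auto
  have "card S \<noteq> 0" "card (A - S) \<noteq> 0" using fin S by simp_all
  then show "card S = card S - 1 + 1" "card (A - S) = card (A - S) - 1 + 1" by linarith+
qed

lemma facet_full:
  assumes "finite A" "S \<in> bfam full_cond A - {A}"
  shows "facet_type A (bfam full_cond A) S = Pe (card S - 1) + Pe (card (A - S) - 1)"
proof -
  note c = card_proper[OF assms]
  have "bfam (\<lambda>U. \<exists>V\<subseteq>S. True) (A - S) = bfam full_cond (A - S)" by (intro bfam_cong) auto
  then show ?thesis
    using facet_type_bfam[OF c(5), of full_cond full_cond] Pe_eq[OF c(1,3)] Pe_eq[OF c(2,4)] by simp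
qed

text \<open>Contracting a set with the centre makes every remaining subset admissible. Otherwise
  \<open>S\<close> is a leaf: the restriction is a point, and a smaller star remains.\<close>

lemma facet_star:
  assumes "finite A" "a \<in> A" "S \<in> bfam (star_cond a) A - {A}"
  shows "a \<in> S \<Longrightarrow> facet_type A (bfam (star_cond a) A) S = St (card S - 1) + Pe (card (A - S) - 1)"
    and "a \<notin> S \<Longrightarrow> facet_type A (bfam (star_cond a) A) S = St (card (A - S) - 1)"
proof -
  note c = card_proper[OF assms(1,3)]
  {
    assume a: "a \<in> S"
    have "bfam (\<lambda>U. \<exists>V\<subseteq>S. a \<in> U \<union> V) (A - S) = bfam full_cond (A - S)"
      using a by (intro bfam_cong) auto
    then show "facet_type A (bfam (star_cond a) A) S = St (card S - 1) + Pe (card (A - S) - 1)"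
      using facet_type_bfam[OF c(5), of "star_cond a" full_cond] St_eq[OF c(1,3) a] Pe_eq[OF c(2,4)] by simp
  next
    assume a: "a \<notin> S"
    then obtain j where j: "S = {j}" using assms(3) by (auto simp: bfam_def is_singleton_def)
    have "bfam (\<lambda>U. \<exists>V\<subseteq>S. a \<in> U \<union> V) (A - S) = bfam (star_cond a) (A - S)"
      using a by (intro bfam_cong) auto
    then show "facet_type A (bfam (star_cond a) A) S = St (card (A - S) - 1)"
      using facet_type_bfam[OF c(5), of "star_cond a" "star_cond a"] St_eq[OF c(2,4)] a assms(2)
      by (simp add: j btype_singleton)
  }
qed

text \<open>Contracting \<open>p\<close>, or \<open>q\<close> alone, frees the remaining points from
  the condition. Any other \<open>S\<close> avoids both points, so the condition survives on the
  complement and is vacuous on \<open>S\<close>.\<close>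

lemma facet_gamma:
  assumes "finite A" "p \<in> A" "q \<in> A" "p \<noteq> q" "S \<in> bfam (gamma_cond p q) A - {A}"
  shows "p \<in> S \<Longrightarrow> q \<in> S \<Longrightarrow> facet_type A (bfam (gamma_cond p q) A) S = P_Gamma (card S - 1) + Pe (card (A - S) - 1)"
    and "p \<in> S \<Longrightarrow> q \<notin> S \<Longrightarrow> facet_type A (bfam (gamma_cond p q) A) S = Pe (card S - 1) + Pe (card (A - S) - 1)"
    and "p \<notin> S \<Longrightarrow> q \<notin> S \<Longrightarrow> facet_type A (bfam (gamma_cond p q) A) S = Pe (card S - 1) + P_Gamma (card (A - S) - 1)"
    and "p \<notin> S \<Longrightarrow> q \<in> S \<Longrightarrow> facet_type A (bfam (gamma_cond p q) A) S = Pe (card (A - S) - 1)"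
proof -
  note c = card_proper[OF assms(1,5)]
  {
    assume p: "p \<in> S"
    have "bfam (\<lambda>U. \<exists>V\<subseteq>S. p \<in> U \<union> V \<or> q \<notin> U \<union> V) (A - S) = bfam full_cond (A - S)"
      using p by (intro bfam_cong) auto
    then have *: "facet_type A (bfam (gamma_cond p q) A) S = btype S (bfam (gamma_cond p q) S) + Pe (card (A - S) - 1)"
      using facet_type_bfam[OF c(5), of "gamma_cond p q" full_cond] Pe_eq[OF c(2,4)] by simp
    show "q \<in> S \<Longrightarrow> facet_type A (bfam (gamma_cond p q) A) S = P_Gamma (card S - 1) + Pe (card (A - S) - 1)"
      unfolding * using P_Gamma_eq[OF c(1,3) p _ assms(4)] by simp
    have "q \<notin> S \<Longrightarrow> bfam (gamma_cond p q) S = bfam full_cond S" by (intro bfam_cong) auto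
    then show "q \<notin> S \<Longrightarrow> facet_type A (bfam (gamma_cond p q) A) S = Pe (card S - 1) + Pe (card (A - S) - 1)"
      unfolding * using Pe_eq[OF c(1,3)] by simp
  next
    assume p: "p \<notin> S"
    {
      assume q: "q \<notin> S"
      have "bfam (\<lambda>U. \<exists>V\<subseteq>S. p \<in> U \<union> V \<or> q \<notin> U \<union> V) (A - S) = bfam (gamma_cond p q) (A - S)"
        using p q by (intro bfam_cong) auto
      moreover have "bfam (gamma_cond p q) S = bfam full_cond S" using q by (intro bfam_cong) auto
      ultimately show "facet_type A (bfam (gamma_cond p q) A) S = Pe (card S - 1) + P_Gamma (card (A - S) - 1)"
        using facet_type_bfam[OF c(5), of "gamma_cond p q" "gamma_cond p q"] Pe_eq[OF c(1,3)]
          P_Gamma_eq[OF c(2,4), of p q] p q assms by simp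
    next
      assume q: "q \<in> S"
      then have j: "S = {q}" using p assms(5) by (auto simp: bfam_def is_singleton_def)
      have "bfam (\<lambda>U. \<exists>V\<subseteq>S. p \<in> U \<union> V \<or> q \<notin> U \<union> V) (A - S) = bfam full_cond (A - S)"
        unfolding j by (intro bfam_cong) auto
      then show "facet_type A (bfam (gamma_cond p q) A) S = Pe (card (A - S) - 1)"
        using facet_type_bfam[OF c(5), of "gamma_cond p q" full_cond] Pe_eq[OF c(2,4)]
        by (simp add: j btype_singleton)
    }
  }
qed

text \<open>Once \<open>a\<close> is contracted, only the coupling of \<open>z\<close> to
  \<open>b\<close> survives, which is a gamma condition, and contracting \<open>b\<close> as well
  removes it. A set without \<open>a\<close> is a singleton: for \<open>b\<close> the coupling is
  always satisfied and for \<open>z\<close> it disappears, leaving a star; any other point leaves a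
  smaller mas condition.\<close>

lemma facet_mas:
  assumes "finite A" "a \<in> A" "b \<in> A" "z \<in> A" "distinct [a, b, z]" "S \<in> bfam (mas_cond a b z) A - {A}"
  shows "a \<in> S \<Longrightarrow> b \<in> S \<Longrightarrow> z \<in> S \<Longrightarrow>
      facet_type A (bfam (mas_cond a b z) A) S = P_Mas (card S - 1) + Pe (card (A - S) - 1)"
    and "a \<in> S \<Longrightarrow> b \<in> S \<Longrightarrow> z \<notin> S \<Longrightarrow>
      facet_type A (bfam (mas_cond a b z) A) S = St (card S - 1) + Pe (card (A - S) - 1)"
    and "a \<in> S \<Longrightarrow> b \<notin> S \<Longrightarrow>
      facet_type A (bfam (mas_cond a b z) A) S = St (card S - 1) + P_Gamma (card (A - S) - 1)"
    and "a \<notin> S \<Longrightarrow> S = {b} \<or> S = {z} \<Longrightarrow>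
      facet_type A (bfam (mas_cond a b z) A) S = St (card (A - S) - 1)"
    and "a \<notin> S \<Longrightarrow> S \<noteq> {b} \<Longrightarrow> S \<noteq> {z} \<Longrightarrow>
      facet_type A (bfam (mas_cond a b z) A) S = P_Mas (card (A - S) - 1)"
proof -
  note c = card_proper[OF assms(1,6)]
  let ?c = "\<lambda>U. \<exists>V\<subseteq>S. a \<in> U \<union> V \<and> (b \<in> U \<union> V \<or> z \<notin> U \<union> V)"
  note ft = facet_type_bfam[OF c(5), of "mas_cond a b z"]
  {
    assume ab: "a \<in> S" "b \<in> S"
    have "bfam ?c (A - S) = bfam full_cond (A - S)"
      using ab by (intro bfam_cong) auto
    then have *: "facet_type A (bfam (mas_cond a b z) A) S = btype S (bfam (mas_cond a b z) S) + Pe (card (A - S) - 1)"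
      using ft Pe_eq[OF c(2,4)] by simp
    show "z \<in> S \<Longrightarrow> facet_type A (bfam (mas_cond a b z) A) S = P_Mas (card S - 1) + Pe (card (A - S) - 1)"
      unfolding * using P_Mas_eq[OF c(1,3) ab _ assms(5)] by simp
    have "z \<notin> S \<Longrightarrow> bfam (mas_cond a b z) S = bfam (star_cond a) S" by (intro bfam_cong) auto
    then show "z \<notin> S \<Longrightarrow> facet_type A (bfam (mas_cond a b z) A) S = St (card S - 1) + Pe (card (A - S) - 1)"
      unfolding * using St_eq[OF c(1,3) ab(1)] by simp
  next
    assume ab: "a \<in> S" "b \<notin> S"
    then have z: "z \<notin> S" using assms(5,6) by (auto simp: bfam_def is_singleton_def)
    \<comment> \<open>The witness \<open>V = {a}\<close> supplies the contracted point
      \<open>a\<close>; nothing in \<open>S\<close> can supply \<open>b\<close>.\<close>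
    have "?c U \<longleftrightarrow> b \<in> U \<or> z \<notin> U" if "U \<subseteq> A - S" for U
      using ab z that by (auto intro: exI[of _ "{a}"])
    then have "bfam ?c (A - S) = bfam (gamma_cond b z) (A - S)"
      by (intro bfam_cong) auto
    moreover have "bfam (mas_cond a b z) S = bfam (star_cond a) S" using z by (intro bfam_cong) auto
    ultimately show "facet_type A (bfam (mas_cond a b z) A) S = St (card S - 1) + P_Gamma (card (A - S) - 1)"
      using ft[of "gamma_cond b z"] St_eq[OF c(1,3) ab(1)] P_Gamma_eq[OF c(2,4), of b z] ab z assms by simp
  next
    assume a: "a \<notin> S"
    {
      assume S: "S = {b} \<or> S = {z}"
      have "?c U \<longleftrightarrow> a \<in> U" if "U \<subseteq> A - S" for U
        using S a that by (auto intro: exI[of _ S] exI[of _ "{}"])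
      then have "bfam ?c (A - S) = bfam (star_cond a) (A - S)" by (intro bfam_cong) auto
      then show "facet_type A (bfam (mas_cond a b z) A) S = St (card (A - S) - 1)"
        using ft[of "star_cond a"] St_eq[OF c(2,4), of a] a assms(2) S by (auto simp: btype_singleton)
    next
      assume S: "S \<noteq> {b}" "S \<noteq> {z}"
      obtain j where j: "S = {j}" using a assms(6) by (auto simp: bfam_def is_singleton_def)
      have "?c U \<longleftrightarrow> a \<in> U \<and> (b \<in> U \<or> z \<notin> U)" if "U \<subseteq> A - S" for U
        using S j a that by (auto intro: exI[of _ "{}"])
      then have "bfam ?c (A - S) = bfam (mas_cond a b z) (A - S)" by (intro bfam_cong) auto
      then show "facet_type A (bfam (mas_cond a b z) A) S = P_Mas (card (A - S) - 1)"
        using ft[of "mas_cond a b z"] P_Mas_eq[OF c(2,4), of a b z] a assms S j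
        by (auto simp: btype_singleton)
    }
  }
qed


text \<open>Turns sums over sets of free points into binomial sums; the second form serves the class
  in which the full set of free points would give the whole ground set.\<close>

lemma sum_Pow_card:
  fixes h :: "nat \<Rightarrow> 'b::comm_ring_1"
  assumes "finite M"
  shows "(\<Sum>J\<in>Pow M. h (card J)) = (\<Sum>s\<le>card M. of_nat (card M choose s) * h s)"
    and "(\<Sum>J\<in>Pow M - {M}. h (card J)) = (\<Sum>s<card M. of_nat (card M choose s) * h s)"
proof -
  have "(\<Sum>J\<in>Pow M. h (card J)) = (\<Sum>s\<le>card M. \<Sum>J\<in>{J \<in> Pow M. card J = s}. h (card J))"
    using assms by (intro sum.group[symmetric]) (auto intro: card_mono)
  also have "\<dots> = (\<Sum>s\<le>card M. of_nat (card M choose s) * h s)"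
  proof (intro sum.cong refl)
    fix s
    have "(\<Sum>J\<in>{J \<in> Pow M. card J = s}. h (card J)) = of_nat (card {J. J \<subseteq> M \<and> card J = s}) * h s"
      by (simp add: Pow_def)
    then show "(\<Sum>J\<in>{J \<in> Pow M. card J = s}. h (card J)) = of_nat (card M choose s) * h s"
      by (simp add: n_subsets[OF assms])
  qed
  finally show 1: "(\<Sum>J\<in>Pow M. h (card J)) = (\<Sum>s\<le>card M. of_nat (card M choose s) * h s)" .
  have "(\<Sum>J\<in>Pow M. h (card J)) = h (card M) + (\<Sum>J\<in>Pow M - {M}. h (card J))"
    using assms by (intro sum.remove) auto
  moreover have "(\<Sum>s\<le>card M. of_nat (card M choose s) * h s) = (\<Sum>s<card M. of_nat (card M choose s) * h s) + h (card M)"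
    by (simp flip: lessThan_Suc_atMost)
  ultimately show "(\<Sum>J\<in>Pow M - {M}. h (card J)) = (\<Sum>s<card M. of_nat (card M choose s) * h s)"
    using 1 by simp
qed

lemma singleton_in_bfam:
  assumes "j \<in> A" "card A \<ge> 2" shows "{j} \<in> bfam \<phi> A - {A}"
proof -
  have "card {j} \<noteq> card A" using assms(2) by simp
  then have "{j} \<noteq> A" by metis
  then show ?thesis using assms(1) by (simp add: bfam_def)
qed

lemma inj_on_Un_disjoint:
  assumes "\<And>J. J \<in> X \<Longrightarrow> C \<inter> J = {}" shows "inj_on (\<lambda>J. C \<union> J) X"
proof (rule inj_onI)
  fix J K assume "J \<in> X" "K \<in> X" "C \<union> J = C \<union> K"
  moreover from this have "C \<inter> J = {}" "C \<inter> K = {}" using assms by blast+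
  ultimately show "J = K" by blast
qed

lemma frag_of_plus: "frag_of (c + c' :: cpolytope) = frag_of c * frag_of c'"
  by (simp add: mult_single)

text \<open>The members other than the ground set fall into five classes according to their trace on
  \<open>{1, 2, n+1}\<close>, with the other points \<open>{3..n}\<close> free. Each class produces
  one term of the formula, and \<open>s\<close> counts free points, whence the binomials over
  \<open>n - 2\<close>.\<close>

lemma boundary_P_Mas:
  assumes n: "n \<ge> 2"
  shows "boundary (P_Mas n) = 2 * frag_of (St (n - 1))
      + of_nat (n - 2) * frag_of (P_Mas (n - 1))
      + (\<Sum>s\<le>n - 2. of_nat ((n - 2) choose s) * (frag_of (St s) * frag_of (P_Gamma (n - s - 1))))
      + (\<Sum>s\<le>n - 2. of_nat ((n - 2) choose s) * (frag_of (St (s + 1)) * frag_of (Pe (n - s - 2))))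
      + (\<Sum>s<n - 2. of_nat ((n - 2) choose s) * (frag_of (P_Mas (s + 2)) * frag_of (Pe (n - s - 3))))"
proof -
  let ?z = "n + 1"
  let ?A = "{1..n+1}"
  let ?M = "{3..n}"
  let ?B = "bfam (mas_cond 1 2 ?z) ?A"
  interpret nat_building_set ?A ?B
    unfolding nat_building_set_def using n by (intro building_mas) auto
  have PM: "P_Mas n = btype ?A ?B" using n by (intro P_Mas_eq) auto
  have A: "?A = {1, 2, ?z} \<union> ?M" using n by auto
  have cM: "card ?M = n - 2" "finite ?M" by auto
  \<comment> \<open>\<open>?S1\<close> and \<open>?S2\<close> are the members without 1. In
    \<open>?S5\<close> the choice \<open>?M\<close> is excluded since it would give
    \<open>?A\<close>, so the last sum stops before \<open>n - 2\<close>.\<close>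
  let ?S1 = "{{2}, {?z}}" and ?S2 = "(\<lambda>j. {j}) ` ?M" and ?S3 = "(\<lambda>J. {1} \<union> J) ` Pow ?M"
  let ?S4 = "(\<lambda>J. {1, 2} \<union> J) ` Pow ?M" and ?S5 = "(\<lambda>J. {1, 2, ?z} \<union> J) ` (Pow ?M - {?M})"
  have disj: "1 \<notin> ?M" "2 \<notin> ?M" "?z \<notin> ?M" using n by auto
  have mem: "S \<in> ?B - {?A} \<longleftrightarrow> S \<in> ?S1 \<or> S \<in> ?S2 \<or> S \<in> ?S3 \<or> S \<in> ?S4 \<or> S \<in> ?S5" for S
  proof
    assume "S \<in> ?B - {?A}"
    then have S: "S \<subseteq> ?A" "S \<noteq> {}" "is_singleton S \<or> 1 \<in> S \<and> (2 \<in> S \<or> ?z \<notin> S)" "S \<noteq> ?A"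
      by (auto simp: bfam_def)
    show "S \<in> ?S1 \<or> S \<in> ?S2 \<or> S \<in> ?S3 \<or> S \<in> ?S4 \<or> S \<in> ?S5"
    proof (cases "1 \<in> S")
      case False
      then obtain j where j: "S = {j}" using S by (auto simp: is_singleton_def)
      then have "j \<noteq> 1" "1 \<le> j" "j \<le> n + 1" using S False by auto
      then have "j = 2 \<or> j = ?z \<or> j \<in> ?M" by auto
      then show ?thesis using j by auto
    next
      case True
      let ?J = "S \<inter> ?M"
      have dec: "S = (S \<inter> {1, 2, ?z}) \<union> ?J" using S(1) A by blast
      consider "2 \<notin> S" "?z \<notin> S" | "2 \<in> S" "?z \<notin> S" | "2 \<in> S" "?z \<in> S"
        using S(3) True n by (auto simp: is_singleton_def)
      then show ?thesis
      proof cases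
        case 1
        then have "S \<inter> {1, 2, ?z} = {1}" using True by auto
        then have "S = {1} \<union> ?J" using dec by auto
        then show ?thesis by blast
      next
        case 2
        then have "S \<inter> {1, 2, ?z} = {1, 2}" using True by auto
        then have "S = {1, 2} \<union> ?J" using dec by auto
        then show ?thesis by blast
      next
        case 3
        then have "S \<inter> {1, 2, ?z} = {1, 2, ?z}" using True by auto
        then have eq: "S = {1, 2, ?z} \<union> ?J" using dec by auto
        then have "?J \<noteq> ?M" using S(4) A by metis
        then have "?J \<in> Pow ?M - {?M}" by blast
        then show ?thesis using eq by blast
      qed
    qed
  next
    have sing: "{j} \<in> ?B - {?A}" if "j \<in> ?A" for j
      using that n by (intro singleton_in_bfam) simp_all
    assume "S \<in> ?S1 \<or> S \<in> ?S2 \<or> S \<in> ?S3 \<or> S \<in> ?S4 \<or> S \<in> ?S5"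
    then consider "S = {2}" | "S = {?z}" | j where "j \<in> ?M" "S = {j}" | J where "J \<subseteq> ?M" "S = {1} \<union> J"
      | J where "J \<subseteq> ?M" "S = {1, 2} \<union> J" | J where "J \<subseteq> ?M" "J \<noteq> ?M" "S = {1, 2, ?z} \<union> J" by auto
    then show "S \<in> ?B - {?A}"
    proof cases
      case 1
      then show ?thesis using sing[of 2] n by simp
    next
      case 2
      then show ?thesis using sing[of ?z] by simp
    next
      case 3
      then show ?thesis using sing[of j] by simp
    next
      case 4
      then have "?z \<notin> S" "S \<subseteq> ?A" "1 \<in> S" using n by auto
      then show ?thesis by (auto simp: bfam_def)
    next
      case 5
      then have "?z \<notin> S" "S \<subseteq> ?A" "1 \<in> S" "2 \<in> S" using n by auto
      then show ?thesis by (auto simp: bfam_def)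
    next
      case 6
      then obtain i where i: "i \<in> ?M" "i \<notin> J" by blast
      then have "i \<notin> S" "i \<in> ?A" using 6 disj by auto
      moreover have "S \<subseteq> ?A" "1 \<in> S" "2 \<in> S" using 6 n by auto
      ultimately show ?thesis by (auto simp: bfam_def)
    qed
  qed
  have BA: "?B - {?A} = ?S1 \<union> (?S2 \<union> (?S3 \<union> (?S4 \<union> ?S5)))"
    by (rule set_eqI) (simp only: mem Un_iff)
  have char: "S \<in> ?S1 \<Longrightarrow> 1 \<notin> S \<and> (2 \<in> S \<or> ?z \<in> S)" "S \<in> ?S2 \<Longrightarrow> 1 \<notin> S \<and> 2 \<notin> S \<and> ?z \<notin> S"
    "S \<in> ?S3 \<Longrightarrow> 1 \<in> S \<and> 2 \<notin> S \<and> ?z \<notin> S" "S \<in> ?S4 \<Longrightarrow> 1 \<in> S \<and> 2 \<in> S \<and> ?z \<notin> S"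
    "S \<in> ?S5 \<Longrightarrow> 1 \<in> S \<and> 2 \<in> S \<and> ?z \<in> S" for S
    using n disj by auto
  let ?g = "\<lambda>S. frag_of (facet_type ?A ?B S)"
  \<comment> \<open>\<open>C\<close> is the fixed part and \<open>J\<close> the free part of a
    member. The factors have \<open>card J + k + 1\<close> and \<open>n - card J - k\<close> ground
    points, hence dimensions \<open>card J + k\<close> and \<open>n - card J - l\<close>.\<close>
  have piece: "sum ?g ((\<lambda>J. C \<union> J) ` X) = (\<Sum>J\<in>X. frag_of (p (card J + k)) * frag_of (q (n - card J - l)))"
    if X: "X \<subseteq> Pow ?M" and C: "C \<subseteq> {1, 2, ?z}" "card C = k + 1" "l = k + 1"
      and ft: "\<And>S. S \<in> (\<lambda>J. C \<union> J) ` X \<Longrightarrow>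
        S \<in> ?B - {?A} \<and> facet_type ?A ?B S = p (card S - 1) + q (card (?A - S) - 1)" for C X p q k l
  proof -
    have CJ: "C \<inter> J = {}" "finite J" if "J \<in> X" for J
    proof -
      have J: "J \<subseteq> ?M" using X that by auto
      then show "finite J" by (rule finite_subset) simp
      have "{1, 2, ?z} \<inter> ?M = {}" using disj by auto
      then show "C \<inter> J = {}" using J C(1) by blast
    qed
    have "?g (C \<union> J) = frag_of (p (card J + k)) * frag_of (q (n - card J - l))" if J: "J \<in> X" for J
    proof -
      let ?S = "C \<union> J"
      have S: "?S \<in> ?B - {?A}" "facet_type ?A ?B ?S = p (card ?S - 1) + q (card (?A - ?S) - 1)"
        using ft J by blast+
      have "card ?S = card J + k + 1"
        using CJ[OF J] C finite_subset[OF C(1)] by (simp add: card_Un_disjoint)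
      moreover from this have "card (?A - ?S) = n - card J - k"
        using card_proper(1,5)[OF finite_ground S(1)] by (simp add: card_Diff_subset)
      ultimately show ?thesis using S(2) C(3) by (simp add: frag_of_plus)
    qed
    moreover have "inj_on (\<lambda>J. C \<union> J) X" by (rule inj_on_Un_disjoint[OF CJ(1)])
    ultimately show ?thesis by (simp add: sum.reindex)
  qed
  have "(\<Sum>S\<in>?B - {?A}. ?g S) = sum ?g ?S1 + (sum ?g ?S2 + (sum ?g ?S3 + (sum ?g ?S4 + sum ?g ?S5)))"
  proof -
    have d: "?S1 \<inter> (?S2 \<union> (?S3 \<union> (?S4 \<union> ?S5))) = {}" "?S2 \<inter> (?S3 \<union> (?S4 \<union> ?S5)) = {}"
      "?S3 \<inter> (?S4 \<union> ?S5) = {}" "?S4 \<inter> ?S5 = {}"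
      by (rule equals0I, elim IntE UnE; drule char; drule char; simp)+
    have f: "finite ?S1" "finite ?S2" "finite ?S3" "finite ?S4" "finite ?S5" by simp_all
    note f' = f(5) finite_UnI[OF f(4,5)] finite_UnI[OF f(3) finite_UnI[OF f(4,5)]]
      finite_UnI[OF f(2) finite_UnI[OF f(3) finite_UnI[OF f(4,5)]]]
    show ?thesis
      unfolding BA sum.union_disjoint[OF f(1) f'(4) d(1)] sum.union_disjoint[OF f(2) f'(3) d(2)]
        sum.union_disjoint[OF f(3) f'(2) d(3)] sum.union_disjoint[OF f(4) f'(1) d(4)] ..
  qed
  moreover have "sum ?g ?S1 = 2 * frag_of (St (n - 1))"
  proof -
    have "?g S = frag_of (St (n - 1))" if S: "S \<in> ?S1" for S
    proof -
      have SB: "S \<in> ?B - {?A}" unfolding mem using S by (simp only: simp_thms)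
      obtain j where "j \<in> ?A" "S = {j}" using S n by auto
      then have "card (?A - S) = n" by (simp add: card_Diff_singleton)
      then show ?thesis using facet_mas(4)[OF _ _ _ _ _ SB] char(1)[OF S] S n by auto
    qed
    then have "sum ?g ?S1 = of_nat (card ?S1) * frag_of (St (n - 1))" by simp
    moreover have "card ?S1 = 2" using n by simp
    ultimately show ?thesis by simp
  qed
  moreover have "sum ?g ?S2 = of_nat (n - 2) * frag_of (P_Mas (n - 1))"
  proof -
    have "?g S = frag_of (P_Mas (n - 1))" if S: "S \<in> ?S2" for S
    proof -
      have SB: "S \<in> ?B - {?A}" unfolding mem using S by (simp only: simp_thms)
      obtain j where "j \<in> ?A" "S = {j}" using S n by auto
      then have "card (?A - S) = n" by (simp add: card_Diff_singleton)
      moreover have "S \<noteq> {2}" "S \<noteq> {?z}" using char(2)[OF S] by auto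
      ultimately show ?thesis using facet_mas(5)[OF _ _ _ _ _ SB] char(2)[OF S] n by auto
    qed
    then have "sum ?g ?S2 = of_nat (card ?S2) * frag_of (P_Mas (n - 1))" by simp
    moreover have "card ?S2 = n - 2" by (subst card_image) auto
    ultimately show ?thesis by simp
  qed
  moreover have "sum ?g ?S3 = (\<Sum>s\<le>n - 2. of_nat ((n - 2) choose s) * (frag_of (St s) * frag_of (P_Gamma (n - s - 1))))"
  proof -
    have "sum ?g ?S3 = (\<Sum>J\<in>Pow ?M. frag_of (St (card J + 0)) * frag_of (P_Gamma (n - card J - 1)))"
    proof (rule piece)
      fix S assume S: "S \<in> ?S3"
      have SB: "S \<in> ?B - {?A}" unfolding mem using S by (simp only: simp_thms)
      show "S \<in> ?B - {?A} \<and> facet_type ?A ?B S = St (card S - 1) + P_Gamma (card (?A - S) - 1)"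
        using facet_mas(3)[OF _ _ _ _ _ SB] char(3)[OF S] SB n by simp
    qed auto
    then show ?thesis
      using sum_Pow_card(1)[OF cM(2), of "\<lambda>s. frag_of (St s) * frag_of (P_Gamma (n - s - 1))"]
      unfolding cM(1) add_0_right by (rule trans)
  qed
  moreover have "sum ?g ?S4 = (\<Sum>s\<le>n - 2. of_nat ((n - 2) choose s) * (frag_of (St (s + 1)) * frag_of (Pe (n - s - 2))))"
  proof -
    have "sum ?g ?S4 = (\<Sum>J\<in>Pow ?M. frag_of (St (card J + 1)) * frag_of (Pe (n - card J - 2)))"
    proof (rule piece)
      fix S assume S: "S \<in> ?S4"
      have SB: "S \<in> ?B - {?A}" unfolding mem using S by (simp only: simp_thms)
      show "S \<in> ?B - {?A} \<and> facet_type ?A ?B S = St (card S - 1) + Pe (card (?A - S) - 1)"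
        using facet_mas(2)[OF _ _ _ _ _ SB] char(4)[OF S] SB n by simp
    qed auto
    then show ?thesis
      using sum_Pow_card(1)[OF cM(2), of "\<lambda>s. frag_of (St (s + 1)) * frag_of (Pe (n - s - 2))"]
      unfolding cM(1) by (rule trans)
  qed
  moreover have "sum ?g ?S5 = (\<Sum>s<n - 2. of_nat ((n - 2) choose s) * (frag_of (P_Mas (s + 2)) * frag_of (Pe (n - s - 3))))"
  proof -
    have "sum ?g ?S5 = (\<Sum>J\<in>Pow ?M - {?M}. frag_of (P_Mas (card J + 2)) * frag_of (Pe (n - card J - 3)))"
    proof (rule piece)
      fix S assume S: "S \<in> ?S5"
      have SB: "S \<in> ?B - {?A}" unfolding mem using S by (simp only: simp_thms)
      show "S \<in> ?B - {?A} \<and> facet_type ?A ?B S = P_Mas (card S - 1) + Pe (card (?A - S) - 1)"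
        using facet_mas(1)[OF _ _ _ _ _ SB] char(5)[OF S] SB n by simp
    qed (use n in \<open>auto simp: numeral_3_eq_3\<close>)
    then show ?thesis
      using sum_Pow_card(2)[OF cM(2), of "\<lambda>s. frag_of (P_Mas (s + 2)) * frag_of (Pe (n - s - 3))"]
      unfolding cM(1) by (rule trans)
  qed
  ultimately show ?thesis
    unfolding PM boundary_btype by (simp only: add.assoc)
qed


section \<open>Complexity\<close>

inductive_set submonoid :: "'a::comm_monoid_add set \<Rightarrow> 'a set" for S
  where
    zero: "0 \<in> submonoid S"
  | add: "x \<in> S \<Longrightarrow> y \<in> submonoid S \<Longrightarrow> x + y \<in> submonoid S"

lemma submonoid_base: "x \<in> S \<Longrightarrow> x \<in> submonoid S"
  using submonoid.add[OF _ submonoid.zero, of x S] by simp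

lemma submonoid_add: "x \<in> submonoid S \<Longrightarrow> y \<in> submonoid S \<Longrightarrow> x + y \<in> submonoid S"
  by (induction rule: submonoid.induct) (simp_all add: submonoid.add add.assoc)

text \<open>Reduces closure under \<open>d_op\<close> to a condition on monoid elements alone:
  products of basis elements are basis elements, and signs and multiplicities are always
  available.\<close>

lemma subring_generated_frag_of:
  "x \<in> subring_generated (frag_of ` F) \<longleftrightarrow> Poly_Mapping.keys x \<subseteq> submonoid (F :: cpolytope set)"
proof
  assume "x \<in> subring_generated (frag_of ` F)"
  then show "Poly_Mapping.keys x \<subseteq> submonoid F"
  proof (induction rule: subring_generated.induct)
    case (base x)
    then show ?case by (auto simp: keys_frag_of intro: submonoid_base)
  next
    case one
    then show ?case by (simp add: submonoid.zero)
  next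
    case (diff x y)
    then show ?case using keys_diff[of x y] by blast
  next
    case (mult x y)
    then show ?case using keys_mult[of x y] submonoid_add by blast
  qed
next
  assume "Poly_Mapping.keys x \<subseteq> submonoid F"
  then show "x \<in> subring_generated (frag_of ` F)"
  proof (induction x rule: frag_induction)
    case zero
    show ?case using subring_generated.diff[OF subring_generated.one subring_generated.one] by simp
  next
    case (one c)
    then show ?case
    proof (induction rule: submonoid.induct)
      case zero
      show ?case using subring_generated.one[of "frag_of ` F"] by (simp add: single_one)
    next
      case (add c c')
      then show ?case unfolding frag_of_plus
        by (intro subring_generated.mult subring_generated.base[of "frag_of c"]) auto
    qed
  next
    case (diff a b)
    then show ?case by (rule subring_generated.diff)
  qed
qed

text \<open>
  Facets are recorded up to \<open>comb_equiv\<close> rather than by \<open>ctype\<close>, because \<open>ctype F\<close> is junk unless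
  \<open>F\<close> is known to be simple.
\<close>

definition facets_in :: "cpolytope set \<Rightarrow> cpolytope \<Rightarrow> bool"
  where "facets_in M c \<longleftrightarrow> graded_simple (rep_cpolytope c) \<and>
    (\<forall>F\<in>facets (rep_cpolytope c). \<exists>c'\<in>M. comb_equiv F (rep_cpolytope c'))"

lemma facets_in_boundary:
  assumes "facets_in M c" shows "Poly_Mapping.keys (boundary c) \<subseteq> M"
proof -
  have "ctype F \<in> M" if "F \<in> facets (rep_cpolytope c)" for F
    using assms that ctype_eqI unfolding facets_in_def by metis
  then show ?thesis
    unfolding boundary_def using keys_sum[of "\<lambda>F. frag_of (ctype F)"] by (fastforce simp: keys_frag_of)
qed

text \<open>The derivation property at the level of polytopes: a facet of a product is a facet of
  one factor times the other factor.\<close>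

lemma facets_in_plus:
  assumes a: "facets_in (submonoid G) a" "a \<in> submonoid G" and b: "facets_in (submonoid G) b" "b \<in> submonoid G"
  shows "facets_in (submonoid G) (a + b)"
proof -
  let ?X = "rep_cpolytope a" and ?Y = "rep_cpolytope b"
  have gs: "graded_simple (?X \<times> ?Y)" using a b by (intro graded_simple_Times) (auto simp: facets_in_def)
  obtain f where f: "face_iso f (?X \<times> ?Y) (rep_cpolytope (a + b))"
    using comb_equiv_rep_plus comb_equiv_face_iso by blast
  note iso = graded_simple_iso[OF f gs simple_rep_cpolytope]
  have fac: "facets (?X \<times> ?Y) = (\<lambda>F. F \<times> ?Y) ` facets ?X \<union> (\<lambda>G. ?X \<times> G) ` facets ?Y"
    by (intro facets_Times polytope_rep)
  have "\<exists>c'\<in>submonoid G. comb_equiv F (rep_cpolytope c')" if F: "F \<in> facets (rep_cpolytope (a + b))" for F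
  proof -
    obtain E where E: "E \<in> facets (?X \<times> ?Y)" "F = f E" using F iso(3) by blast
    then have "comb_equiv E F" using comb_equiv_face[OF f] by (simp add: facets_def)
    then have FE: "comb_equiv F E" by (rule comb_equiv_sym)
    consider E' where "E' \<in> facets ?X" "E = E' \<times> ?Y" | E' where "E' \<in> facets ?Y" "E = ?X \<times> E'"
      using E(1) unfolding fac by blast
    then show ?thesis
    proof cases
      case 1
      then obtain c where c: "c \<in> submonoid G" "comb_equiv E' (rep_cpolytope c)"
        using a(1) by (auto simp: facets_in_def)
      have "convex E'" using 1 by (auto simp: facets_def dest: face_of_imp_convex)
      then have "comb_equiv E (rep_cpolytope (c + b))"
        unfolding 1(2) using c(2) by (intro comb_equiv_Times_rep comb_equiv_refl convex_rep_cpolytope)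
      then show ?thesis using submonoid_add[OF c(1) b(2)] comb_equiv_trans[OF FE] by blast
    next
      case 2
      then obtain c where c: "c \<in> submonoid G" "comb_equiv E' (rep_cpolytope c)"
        using b(1) by (auto simp: facets_in_def)
      have "convex E'" using 2 by (auto simp: facets_def dest: face_of_imp_convex)
      then have "comb_equiv E (rep_cpolytope (a + c))"
        unfolding 2(2) using c(2) by (intro comb_equiv_Times_rep comb_equiv_refl convex_rep_cpolytope)
      then show ?thesis using submonoid_add[OF a(2) c(1)] comb_equiv_trans[OF FE] by blast
    qed
  qed
  then show ?thesis unfolding facets_in_def using iso(2) by blast
qed

lemma d_closedI:
  assumes zero: "facets_in (submonoid G) 0" and gen: "\<And>c. c \<in> G \<Longrightarrow> facets_in (submonoid G) c"
    and x: "x \<in> subring_generated (frag_of ` G)"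
  shows "d_op x \<in> subring_generated (frag_of ` G)"
proof -
  have "facets_in (submonoid G) c" if "c \<in> submonoid G" for c
    using that
  proof (induction rule: submonoid.induct)
    case (add x y)
    then show ?case using gen submonoid_base by (intro facets_in_plus) auto
  qed (rule zero)
  then have "Poly_Mapping.keys (boundary c) \<subseteq> submonoid G" if "c \<in> submonoid G" for c
    using facets_in_boundary that by blast
  then show ?thesis
    using x keys_frag_extend[of boundary x] unfolding subring_generated_frag_of d_op_def by blast
qed

lemma (in nat_building_set) facets_in_btype:
  assumes "\<And>S. S \<in> B - {A} \<Longrightarrow> facet_type A B S \<in> M"
  shows "facets_in M (btype A B)"
  unfolding facets_in_def using graded_simple_btype facets_rep_btype assms by metis

text \<open>The coefficient counts the facets of this type, so nothing can cancel.\<close>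

lemma (in nat_building_set) facet_type_in_boundary:
  assumes "S \<in> B - {A}"
  shows "facet_type A B S \<in> Poly_Mapping.keys (boundary (btype A B))"
proof -
  have "Poly_Mapping.lookup (boundary (btype A B)) (facet_type A B S)
    = (\<Sum>T\<in>B - {A}. if facet_type A B S = facet_type A B T then 1 else 0)"
    unfolding boundary_btype by (simp add: lookup_sum lookup_single when_def eq_commute)
  also have "\<dots> = int (card {T \<in> B - {A}. facet_type A B S = facet_type A B T})"
    using finite_building_set by (simp add: sum.If_cases Int_def)
  also have "\<dots> \<noteq> 0" using assms finite_building_set by auto
  finally show ?thesis by (simp add: in_keys_iff)
qed


text \<open>Supplies the links for \<open>btype_indecomposable\<close>: every singleton is linked to
  \<open>{a}\<close> through \<open>{a, j}\<close>, and every larger proper member to a singleton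
  outside it through \<open>insert j S\<close>.\<close>

lemma btype_bfam_indecomposable:
  assumes B: "building_set_on A (bfam \<phi> A)" and a: "a \<in> A" "\<And>j. j \<in> A \<Longrightarrow> \<phi> {a, j}"
    and extend: "\<And>S. S \<subset> A \<Longrightarrow> \<phi> S \<Longrightarrow> \<exists>j\<in>A - S. \<phi> (insert j S)"
    and eq: "btype A (bfam \<phi> A) = x + y"
  shows "x = 0 \<or> y = 0"
proof -
  interpret nat_building_set A "bfam \<phi> A" using B by (simp add: nat_building_set_def)
  let ?B = "bfam \<phi> A"
  show ?thesis
  proof (rule btype_indecomposable[OF eq])
    fix \<kappa> :: "nat set \<Rightarrow> bool" and S T
    assume \<kappa>: "\<And>S T. S \<in> ?B - {A} \<Longrightarrow> T \<in> ?B - {A} \<Longrightarrow> \<not> S \<subseteq> T \<Longrightarrow> \<not> T \<subseteq> S \<Longrightarrow>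
        S \<union> T \<in> ?B \<Longrightarrow> \<kappa> S = \<kappa> T" and S: "S \<in> ?B - {A}" and T: "T \<in> ?B - {A}"
    have "S \<subset> A" "S \<noteq> {}" using S by (auto simp: bfam_def)
    then have "A \<noteq> {j}" for j by auto
    then have sing: "{j} \<in> ?B - {A}" if "j \<in> A" for j using that by (auto simp: bfam_def)
    have 1: "\<kappa> {j} = \<kappa> {a}" if j: "j \<in> A" for j
    proof (cases "j = a")
      case False
      have "{j} \<union> {a} \<in> ?B" using a(1) a(2)[OF j] j by (auto simp: bfam_def insert_commute)
      then show ?thesis using False by (intro \<kappa> sing j a) auto
    qed simp
    have 2: "\<kappa> S = \<kappa> {a}" if S: "S \<in> ?B - {A}" for S
    proof (cases "is_singleton S")
      case True
      then show ?thesis using 1 S by (auto simp: bfam_def is_singleton_def)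
    next
      case False
      then have "S \<subset> A" "S \<noteq> {}" "\<phi> S" using S by (auto simp: bfam_def)
      then obtain j where j: "j \<in> A" "j \<notin> S" "\<phi> (insert j S)" using extend by blast
      have "S \<union> {j} \<in> ?B" using j \<open>S \<subset> A\<close> by (auto simp: bfam_def)
      moreover have "\<not> S \<subseteq> {j}" using j \<open>S \<noteq> {}\<close> by auto
      ultimately have "\<kappa> S = \<kappa> {j}" using j by (intro \<kappa> sing S) auto
      then show ?thesis using 1[OF j(1)] by simp
    qed
    show "\<kappa> S = \<kappa> T" using 2[OF S] 2[OF T] by simp
  qed
qed

lemma St_indecomposable:
  assumes "St n = x + y" shows "x = 0 \<or> y = 0"
proof (rule btype_bfam_indecomposable[where A = "{1..n+1}" and \<phi> = "star_cond 1" and a = 1])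
  show "building_set_on {1..n+1} (bfam (star_cond 1) {1..n+1})" by (rule building_star) auto
  show "\<exists>j\<in>{1..n+1} - S. 1 \<in> insert j S" if "S \<subset> {1..n+1}" "1 \<in> S" for S
    using that by blast
  show "btype {1..n+1} (bfam (star_cond 1) {1..n+1}) = x + y"
    using St_eq[of "{1..n+1}" n 1] assms by simp
qed auto

lemma Pe_indecomposable:
  assumes "Pe n = x + y" shows "x = 0 \<or> y = 0"
proof (rule btype_bfam_indecomposable[where A = "{1..n+1}" and \<phi> = full_cond and a = 1])
  show "building_set_on {1..n+1} (bfam full_cond {1..n+1})" by (rule building_full) auto
  show "\<exists>j\<in>{1..n+1} - S. True" if "S \<subset> {1..n+1}" for S
    using that by blast
  show "btype {1..n+1} (bfam full_cond {1..n+1}) = x + y"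
    using Pe_eq[of "{1..n+1}" n] assms by simp
qed auto

lemma P_Gamma_indecomposable:
  assumes "P_Gamma n = x + y" shows "x = 0 \<or> y = 0"
proof (cases "n = 0")
  case True
  then show ?thesis using Pe_indecomposable[of 0 x y] assms by (simp add: P_Gamma_0 Pe_0)
next
  case False
  let ?c = "gamma_cond 1 (n+1)"
  show ?thesis
  proof (rule btype_bfam_indecomposable[where A = "{1..n+1}" and \<phi> = ?c and a = 1])
    show "building_set_on {1..n+1} (bfam ?c {1..n+1})" by (rule building_gamma) auto
    show "\<exists>j\<in>{1..n+1} - S. 1 \<in> insert j S \<or> n + 1 \<notin> insert j S"
      if "S \<subset> {1..n+1}" for S
    proof (cases "1 \<in> S")
      case True
      then show ?thesis using that by blast
    next
      case False
      then show ?thesis by (intro bexI[of _ 1]) auto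
    qed
    show "btype {1..n+1} (bfam ?c {1..n+1}) = x + y"
      using P_Gamma_eq[of "{1..n+1}" n 1 "n + 1"] False assms by simp
  qed auto
qed

section \<open>Dimensions of the four families\<close>

lemma cdim_Pe: "cdim (Pe n) = n"
proof -
  interpret nat_building_set "{1..n+1}" "bfam full_cond {1..n+1}"
    unfolding nat_building_set_def by (rule building_full) auto
  show ?thesis using cdim_btype by (simp add: Pe_eq[of "{1..n+1}"])
qed

lemma cdim_St: "cdim (St n) = n"
proof -
  interpret nat_building_set "{1..n+1}" "bfam (star_cond 1) {1..n+1}"
    unfolding nat_building_set_def by (rule building_star) auto
  show ?thesis using cdim_btype by (simp add: St_eq[of "{1..n+1}" n 1])
qed

lemma cdim_P_Gamma: "cdim (P_Gamma n) = n"
proof (cases "n = 0")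
  case True
  then show ?thesis using cdim_Pe[of 0] by (simp add: P_Gamma_0 Pe_0)
next
  case False
  interpret nat_building_set "{1..n+1}" "bfam (gamma_cond 1 (n+1)) {1..n+1}"
    unfolding nat_building_set_def by (rule building_gamma) auto
  show ?thesis using cdim_btype False by (simp add: P_Gamma_eq[of "{1..n+1}" n 1 "n+1"])
qed

lemma P_Mas_small: "n < 2 \<Longrightarrow> P_Mas n = Pe n"
  by (cases "n = 0") (simp_all add: P_Mas_0 Pe_0 P_Mas_1[simplified] less_2_cases_iff)

lemma cdim_P_Mas: "cdim (P_Mas n) = n"
proof (cases "n < 2")
  case True
  then show ?thesis by (simp add: P_Mas_small cdim_Pe)
next
  case False
  interpret nat_building_set "{1..n+1}" "bfam (mas_cond 1 2 (n+1)) {1..n+1}"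
    unfolding nat_building_set_def using False by (intro building_mas) auto
  show ?thesis using cdim_btype False by (simp add: P_Mas_eq[of "{1..n+1}" n 1 2 "n+1"])
qed

section \<open>The d-closure of the family\<close>

definition Mas_closure :: "cpolytope set"
  where "Mas_closure = range P_Mas \<union> range St \<union> range P_Gamma \<union> range Pe"

lemma Mas_closure_submonoid:
  "P_Mas n \<in> submonoid Mas_closure" "St n \<in> submonoid Mas_closure"
  "P_Gamma n \<in> submonoid Mas_closure" "Pe n \<in> submonoid Mas_closure"
  by (auto simp: Mas_closure_def intro!: submonoid_base)

lemma facets_in_Pe: "facets_in (submonoid Mas_closure) (Pe n)"
proof -
  let ?A = "{1..n+1}"
  interpret nat_building_set ?A "bfam full_cond ?A"
    unfolding nat_building_set_def by (rule building_full) auto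
  show ?thesis
    unfolding Pe_eq[of ?A n, simplified]
    using facets_in_btype by (simp add: facet_full submonoid_add Mas_closure_submonoid)
qed

lemma facets_in_St: "facets_in (submonoid Mas_closure) (St n)"
proof -
  let ?A = "{1..n+1}"
  interpret nat_building_set ?A "bfam (star_cond 1) ?A"
    unfolding nat_building_set_def by (rule building_star) auto
  have "facet_type ?A (bfam (star_cond 1) ?A) S \<in> submonoid Mas_closure"
    if "S \<in> bfam (star_cond 1) ?A - {?A}" for S
    by (cases "1 \<in> S") (use facet_star[OF _ _ that] in \<open>simp_all add: submonoid_add Mas_closure_submonoid\<close>)
  then have "facets_in (submonoid Mas_closure) (btype ?A (bfam (star_cond 1) ?A))" by (rule facets_in_btype)
  then show ?thesis using St_eq[of ?A n 1] by simp
qed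

lemma facets_in_P_Gamma: "facets_in (submonoid Mas_closure) (P_Gamma n)"
proof (cases "n = 0")
  case True
  then show ?thesis using facets_in_Pe[of 0] by (simp add: P_Gamma_0 Pe_0)
next
  case False
  let ?A = "{1..n+1}" and ?c = "gamma_cond 1 (n+1)"
  interpret nat_building_set ?A "bfam ?c ?A"
    unfolding nat_building_set_def by (rule building_gamma) auto
  have "facet_type ?A (bfam ?c ?A) S \<in> submonoid Mas_closure"
    if "S \<in> bfam ?c ?A - {?A}" for S
    by (cases "1 \<in> S"; cases "n + 1 \<in> S")
      (use facet_gamma[OF _ _ _ _ that] False in \<open>simp_all add: submonoid_add Mas_closure_submonoid\<close>)
  then have "facets_in (submonoid Mas_closure) (btype ?A (bfam ?c ?A))" by (rule facets_in_btype)
  then show ?thesis using P_Gamma_eq[of ?A n 1 "n+1"] False by simp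
qed

lemma facets_in_P_Mas: "facets_in (submonoid Mas_closure) (P_Mas n)"
proof (cases "n < 2")
  case True
  then show ?thesis using facets_in_Pe by (simp add: P_Mas_small)
next
  case False
  let ?A = "{1..n+1}" and ?c = "mas_cond 1 2 (n+1)"
  interpret nat_building_set ?A "bfam ?c ?A"
    unfolding nat_building_set_def using False by (intro building_mas) auto
  have "facet_type ?A (bfam ?c ?A) S \<in> submonoid Mas_closure"
    if "S \<in> bfam ?c ?A - {?A}" for S
  proof -
    note fm = facet_mas[OF _ _ _ _ _ that]
    consider "1 \<in> S" "2 \<in> S" "n + 1 \<in> S" | "1 \<in> S" "2 \<in> S" "n + 1 \<notin> S" | "1 \<in> S" "2 \<notin> S"
      | "1 \<notin> S" "S = {2} \<or> S = {n + 1}" | "1 \<notin> S" "S \<noteq> {2}" "S \<noteq> {n + 1}" by blast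
    then show ?thesis
      by cases (use fm False in \<open>simp_all add: submonoid_add Mas_closure_submonoid\<close>)
  qed
  then have "facets_in (submonoid Mas_closure) (btype ?A (bfam ?c ?A))" by (rule facets_in_btype)
  then show ?thesis using P_Mas_eq[of ?A n 1 2 "n+1"] False by simp
qed

lemma d_family_Mas_closure: "d_family Mas_closure"
  unfolding d_family_def
proof
  have "{c \<in> Mas_closure. cdim c = n} = {P_Mas n, St n, P_Gamma n, Pe n}" for n
    by (auto simp: Mas_closure_def cdim_P_Mas cdim_St cdim_P_Gamma cdim_Pe)
  then show "family Mas_closure" by (simp add: family_def)
  have zero: "facets_in (submonoid Mas_closure) 0" using facets_in_Pe[of 0] by (simp add: Pe_0)
  have "facets_in (submonoid Mas_closure) c" if c: "c \<in> Mas_closure" for c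
  proof -
    obtain n where "c = P_Mas n \<or> c = St n \<or> c = P_Gamma n \<or> c = Pe n"
      using c unfolding Mas_closure_def by blast
    then show ?thesis using facets_in_Pe facets_in_St facets_in_P_Gamma facets_in_P_Mas by metis
  qed
  then show "\<forall>x\<in>subring_generated (frag_of ` Mas_closure). d_op x \<in> subring_generated (frag_of ` Mas_closure)"
    using d_closedI[OF zero] by blast
qed

lemma d_family_boundary:
  assumes "d_family H" "c \<in> H"
  shows "Poly_Mapping.keys (boundary c) \<subseteq> submonoid H"
proof -
  have "frag_of c \<in> subring_generated (frag_of ` H)" using assms(2) by (intro subring_generated.base) simp
  then have "d_op (frag_of c) \<in> subring_generated (frag_of ` H)" using assms(1) by (simp add: d_family_def)
  then show ?thesis by (simp add: d_op_def subring_generated_frag_of)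
qed

text \<open>In a product of generators with indecomposable value all factors but one are the point,
  so the value is the remaining generator.\<close>

lemma indecomposable_in_generators:
  assumes "c \<in> submonoid H" "c \<noteq> 0" "\<And>x y. c = x + y \<Longrightarrow> x = 0 \<or> y = (0 :: cpolytope)"
  shows "c \<in> H"
  using assms
proof (induction rule: submonoid.induct)
  case (add x y)
  then consider "x = 0" | "y = 0" by blast
  then show ?case
  proof cases
    case 1
    then show ?thesis using add by simp
  next
    case 2
    then show ?thesis using add by simp
  qed
qed simp

text \<open>\<open>Mas_closure\<close> even lies in every d-family containing
  \<open>range P_Mas\<close>. In dimension 0 all four families give the point, which is
  \<open>P_Mas 0\<close>; facets produce the members of positive dimension.\<close>

lemma Mas_closure_minimal:
  assumes H: "range P_Mas \<subseteq> H" "d_family H"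
  shows "Mas_closure \<subseteq> H"
proof -
  have cdim_0: "cdim 0 = 0" using cdim_Pe[of 0] by (simp add: Pe_0)
  have zero: "0 \<in> H" using H(1) P_Mas_0 by (metis rangeI subset_iff)
  have inH: "c \<in> H" if "c \<in> Poly_Mapping.keys (boundary b)" "b \<in> H" "cdim c \<noteq> 0"
    "\<And>x y. c = x + y \<Longrightarrow> x = 0 \<or> y = 0" for b c
  proof (rule indecomposable_in_generators)
    show "c \<in> submonoid H" using d_family_boundary[OF H(2) that(2)] that(1) by (rule subsetD)
    show "c \<noteq> 0" using that(3) cdim_0 by auto
  qed (rule that(4))
  have mas: "St n \<in> H \<and> P_Gamma n \<in> H" if n: "n \<ge> 1" for n
  proof -
    let ?A = "{1..n+2}" and ?c = "mas_cond 1 2 (n+2)"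
    interpret nat_building_set ?A "bfam ?c ?A"
      unfolding nat_building_set_def using n by (intro building_mas) auto
    have PM: "P_Mas (n + 1) = btype ?A (bfam ?c ?A)" using n by (intro P_Mas_eq) auto
    \<comment> \<open>Contracting 2 leaves a star on \<open>n + 1\<close> points. Contracting 1
      leaves the gamma condition, and the restriction to \<open>{1}\<close> contributes only the
      point \<open>St 0\<close>.\<close>
    have 2: "{2} \<in> bfam ?c ?A - {?A}" and 1: "{1} \<in> bfam ?c ?A - {?A}"
      using n by (intro singleton_in_bfam; simp)+
    have cards: "card (?A - {2}) = n + 1" "card (?A - {1}) = n + 1" by (auto simp: card_Diff_singleton)
    have f2: "facet_type ?A (bfam ?c ?A) {2} = St n"
      using facet_mas(4)[OF _ _ _ _ _ 2] cards(1) n by simp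
    have f1: "facet_type ?A (bfam ?c ?A) {1} = P_Gamma n"
      using facet_mas(3)[OF _ _ _ _ _ 1] cards(2) n by (simp add: St_0)
    have "P_Mas (n + 1) \<in> H" using H(1) by blast
    moreover have "St n \<in> Poly_Mapping.keys (boundary (P_Mas (n + 1)))"
      "P_Gamma n \<in> Poly_Mapping.keys (boundary (P_Mas (n + 1)))"
      using facet_type_in_boundary[OF 2] facet_type_in_boundary[OF 1] by (simp_all only: f1 f2 PM)
    ultimately show ?thesis
      using inH St_indecomposable P_Gamma_indecomposable n by (metis cdim_St cdim_P_Gamma not_one_le_zero)
  qed
  have Pe: "Pe n \<in> H" if n: "n \<ge> 1" for n
  proof -
    let ?A = "{1..n+2}" and ?c = "gamma_cond 1 (n+2)"
    interpret nat_building_set ?A "bfam ?c ?A"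
      unfolding nat_building_set_def by (intro building_gamma) auto
    have PG: "P_Gamma (n + 1) = btype ?A (bfam ?c ?A)" by (intro P_Gamma_eq) auto
    \<comment> \<open>Contracting 1 frees all remaining subsets, and the restriction contributes the
      point \<open>Pe 0\<close>.\<close>
    have 1: "{1} \<in> bfam ?c ?A - {?A}" by (rule singleton_in_bfam) auto
    have "card (?A - {1}) = n + 1" by (auto simp: card_Diff_singleton)
    then have f1: "facet_type ?A (bfam ?c ?A) {1} = Pe n"
      using facet_gamma(2)[OF _ _ _ _ 1] by (simp add: Pe_0)
    have "P_Gamma (n + 1) \<in> H" using mas by simp
    moreover have "Pe n \<in> Poly_Mapping.keys (boundary (P_Gamma (n + 1)))"
      using facet_type_in_boundary[OF 1] by (simp only: f1 PG)
    ultimately show ?thesis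
      using inH Pe_indecomposable n by (metis cdim_Pe not_one_le_zero)
  qed
  have "St n \<in> H \<and> P_Gamma n \<in> H \<and> Pe n \<in> H" for n
    using mas[of n] Pe[of n] zero by (cases "n = 0") (simp_all add: St_0 P_Gamma_0 Pe_0)
  then show ?thesis using H(1) by (auto simp: Mas_closure_def)
qed

lemma linear_family_range:
  assumes "\<And>n. cdim (f n) = n" shows "linear_family (range f)"
  unfolding linear_family_def using assms by auto

lemma range_neq:
  assumes "\<And>n. cdim (f n) = n" "\<And>n. cdim (g n) = n" "f k \<noteq> g k"
  shows "range f \<noteq> range g"
  using assms by (metis rangeE rangeI)

text \<open>In dimension 3 the four building sets on \<open>{1,2,3,4}\<close> form a strictly increasing chain.\<close>

lemma four_families_distinct:
  "distinct [range P_Mas, range St, range P_Gamma, range Pe]"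
proof -
  let ?A = "{1..3+1::nat}"
  let ?n = "\<lambda>c. card (facets (rep_cpolytope c))"
  let ?M = "bfam (mas_cond 1 2 4) ?A" and ?S = "bfam (star_cond 1) ?A"
    and ?G = "bfam (gamma_cond 1 4) ?A" and ?P = "bfam full_cond ?A"
  have b: "nat_building_set ?A ?M" "nat_building_set ?A ?S" "nat_building_set ?A ?G" "nat_building_set ?A ?P"
    unfolding nat_building_set_def
    by (intro building_mas building_star building_gamma building_full; auto)+
  \<comment> \<open>A nestohedron has \<open>card B - 1\<close> facets, so a strict chain of
    building sets separates the types. Dimension 2 would not do: there the star and gamma conditions
    select the same sets.\<close>
  have n: "?n (P_Mas 3) = card ?M - 1" "?n (St 3) = card ?S - 1" "?n (P_Gamma 3) = card ?G - 1" "?n (Pe 3) = card ?P - 1"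
    using P_Mas_eq[of ?A 3 1 2 4] St_eq[of ?A 3 1] P_Gamma_eq[of ?A 3 1 4] Pe_eq[of ?A 3]
      b[THEN nat_building_set.card_facets_btype] by auto
  have fin: "finite ?M" "finite ?S" "finite ?G" "finite ?P"
    by (rule finite_subset[of _ "Pow ?A"]; auto simp: bfam_def)+
  have "{1, 4} \<in> ?S - ?M" "{2, 3} \<in> ?G - ?S" "{2, 4} \<in> ?P - ?G" "{1} \<in> ?M"
    by (auto simp: bfam_def is_singleton_def doubleton_eq_iff)
  moreover have "?M \<subseteq> ?S" "?S \<subseteq> ?G" "?G \<subseteq> ?P" by (auto simp: bfam_def)
  ultimately have "?M \<noteq> {}" "?M \<subset> ?S" "?S \<subset> ?G" "?G \<subset> ?P" by blast+
  then have "0 < card ?M" "card ?M < card ?S" "card ?S < card ?G" "card ?G < card ?P"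
    using fin by (simp_all add: card_gt_0_iff psubset_card_mono)
  then have "?n (P_Mas 3) < ?n (St 3)" "?n (St 3) < ?n (P_Gamma 3)" "?n (P_Gamma 3) < ?n (Pe 3)"
    unfolding n by linarith+
  then have "P_Mas 3 \<noteq> St 3" "P_Mas 3 \<noteq> P_Gamma 3" "P_Mas 3 \<noteq> Pe 3" "St 3 \<noteq> P_Gamma 3" "St 3 \<noteq> Pe 3" "P_Gamma 3 \<noteq> Pe 3"
    by auto
  then show ?thesis
    using range_neq[of _ _ 3] cdim_P_Mas cdim_St cdim_P_Gamma cdim_Pe by simp
qed

lemma has_complexity_P_Mas: "has_complexity (range P_Mas) 4"
  unfolding has_complexity_def
proof (intro conjI exI)
  have "{c \<in> range P_Mas. cdim c = n} = {P_Mas n}" for n by (auto simp: cdim_P_Mas)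
  then show "family (range P_Mas)" by (simp add: family_def)
  show "d_closure (range P_Mas) Mas_closure"
    unfolding d_closure_def
  proof (intro conjI allI impI)
    show "range P_Mas \<subseteq> Mas_closure" unfolding Mas_closure_def by blast
    show "H = Mas_closure" if "range P_Mas \<subseteq> H \<and> d_family H \<and> H \<subseteq> Mas_closure" for H
      using Mas_closure_minimal that by (intro subset_antisym) auto
  qed (rule d_family_Mas_closure)
  let ?L = "set [range P_Mas, range St, range P_Gamma, range Pe]"
  show "finite ?L" by simp
  show "card ?L = 4" unfolding distinct_card[OF four_families_distinct] by simp
  show "\<forall>L\<in>?L. linear_family L"
    by (simp add: linear_family_range cdim_P_Mas cdim_St cdim_P_Gamma cdim_Pe)
  show "Mas_closure = \<Union>?L" by (auto simp: Mas_closure_def)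
qed simp

theorem theorem4p10:
  shows "(\<forall>n\<ge>2. d_op (frag_of (P_Mas n)) =
      2 * frag_of (St (n - 1))
      + of_nat (n - 2) * frag_of (P_Mas (n - 1))
      + (\<Sum>s\<le>n - 2. of_nat ((n - 2) choose s) * (frag_of (St s) * frag_of (P_Gamma (n - s - 1))))
      + (\<Sum>s\<le>n - 2. of_nat ((n - 2) choose s) * (frag_of (St (s + 1)) * frag_of (Pe (n - s - 2))))
      + (\<Sum>s<n - 2. of_nat ((n - 2) choose s) * (frag_of (P_Mas (s + 2)) * frag_of (Pe (n - s - 3)))))
    \<and> has_complexity (range P_Mas) 4"
  unfolding d_op_def frag_extend_of using boundary_P_Mas has_complexity_P_Mas by blast

end
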